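(* Let $(G,V)$ be an orthogonal representation of a compact Lie group $G$ on a Euclidean space $V$, let $N$ be a principal orbit, and suppose there is a $G$-invariant, $k$-dimensional distribution $\mathcal D$ on $N$ which is autoparallel in $N$ and invariant under the second fundamental form of $N$. Let $\mathcal E$ be the orthogonal complement distribution of $\mathcal D$ in $N$. Assume that every equivariant normal vector field on $N$ is parallel along $\mathcal E$. Then $\mathrm{copol}(G,V)\leq k$.
   Context: A distribution $\mathcal D$ on $N$ is autoparallel in $N$ if $\nabla^N_XY\in\mathcal D$ for all sections $X,Y$ of $\mathcal D$, where $\nabla^N$ is the Levi-Civita connection of $N$; it is invariant under the second fundamental form $\alpha$ of $N$ if $\alpha(\mathcal D,\mathcal E)=0$. A normal vector field $\hat v$ on $N$ is equivariant if $\hat v(gp)=g_*\hat v(p)$ for all $g\in G$, $p\in N$; it is parallel along $\mathcal E$ if $\nabla^\perp_u\hat v=0$ for all $u\in\mathcal E$, where $\nabla^\perp$ is the normal connection. A point is called $G$-regular if it lies on a principal orbit. For a nonnegative integer $k$, a $k$-section of $(G,V)$ is a connected, complete submanifold $\Sigma$ of $V$ such that: (C1) $\Sigma$ is totally geodesic in $V$; (C2) $\Sigma$ intersects all $G$-orbits; (C3) for every $G$-regular point $p\in\Sigma$, $T_p\Sigma$ contains the normal space $\nu_p(Gp)$ as a subspace of codimension $k$; (C4) for every $G$-regular point $p\in\Sigma$, if $gp\in\Sigma$ for some $g\in G$, then $g\Sigma=\Sigma$. Through a given $G$-regular point, the set of all $k$-sections ($k=0,1,2,\dots$) has a unique minimal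 element with respect to inclusion; if this is a $k_0$-section then the copolarity is $\mathrm{copol}(G,V)=k_0$ (independent of the regular point). *)

theory Defs
  imports "HOL-Analysis.Analysis" "HOL-Algebra.Group_Action"
begin

subsection \<open>Smooth maps and submanifolds of Euclidean space\<close>

primrec C_on :: "nat \<Rightarrow> 'a::euclidean_space set \<Rightarrow> ('a \<Rightarrow> 'b::euclidean_space) \<Rightarrow> bool" where
  "C_on 0 U f \<longleftrightarrow> continuous_on U f"
| "C_on (Suc n) U f \<longleftrightarrow>
     (\<forall>x\<in>U. f differentiable (at x)) \<and> (\<forall>v. C_on n U (\<lambda>x. frechet_derivative f (at x) v))"

text \<open>On a set that need not be open, smooth means: locally the restriction of a smooth map
  defined on an open subset of the ambient space.\<close>

definition smooth_on :: "'a::euclidean_space set \<Rightarrow> ('a \<Rightarrow> 'b::euclidean_space) \<Rightarrow> bool" where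
  "smooth_on S f \<longleftrightarrow>
     (\<forall>x\<in>S. \<exists>U F. open U \<and> x \<in> U \<and> (\<forall>n. C_on n U F) \<and> (\<forall>y\<in>S \<inter> U. F y = f y))"

definition submanifold :: "'v::euclidean_space set \<Rightarrow> bool" where
  "submanifold M \<longleftrightarrow>
     (\<exists>d. \<forall>p\<in>M. \<exists>U (W :: 'v set) \<Phi> \<Psi> L.
        open U \<and> p \<in> U \<and> open W \<and> homeomorphism U W \<Phi> \<Psi> \<and> smooth_on U \<Phi> \<and> smooth_on W \<Psi> \<and>
        subspace L \<and> dim L = d \<and> \<Phi> ` (M \<inter> U) = L \<inter> W)"

definition tangent_space :: "'v::euclidean_space set \<Rightarrow> 'v \<Rightarrow> 'v set" where
  "tangent_space M p =
     {v. \<exists>\<epsilon>>0. \<exists>c :: real \<Rightarrow> 'v. smooth_on {-\<epsilon><..<\<epsilon>} c \<and> c ` {-\<epsilon><..<\<epsilon>} \<subseteq> M \<and> c 0 = p \<and>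
        (c has_vector_derivative v) (at 0)}"

definition normal_space :: "'v::euclidean_space set \<Rightarrow> 'v \<Rightarrow> 'v set" where
  "normal_space M p = orthogonal_comp (tangent_space M p)"

definition orth_proj :: "'v::euclidean_space set \<Rightarrow> 'v \<Rightarrow> 'v" where
  "orth_proj S x = (THE y. y \<in> S \<and> x - y \<in> orthogonal_comp S)"

definition tangent_field :: "'v::euclidean_space set \<Rightarrow> ('v \<Rightarrow> 'v) \<Rightarrow> bool" where
  "tangent_field M X \<longleftrightarrow> smooth_on M X \<and> (\<forall>p\<in>M. X p \<in> tangent_space M p)"

definition normal_field :: "'v::euclidean_space set \<Rightarrow> ('v \<Rightarrow> 'v) \<Rightarrow> bool" where
  "normal_field M \<xi> \<longleftrightarrow> smooth_on M \<xi> \<and> (\<forall>p\<in>M. \<xi> p \<in> normal_space M p)"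

text \<open>The derivative of a field along a submanifold is taken within the submanifold. As a
  linear map on the whole space it is not unique, but its value on a tangent vector is, since it
  is the derivative of the field along any curve in the submanifold with that velocity. The
  tangential and normal parts of this value are given by the Gauss and Weingarten formulas.\<close>

definition levi_civita ::
    "'v::euclidean_space set \<Rightarrow> ('v \<Rightarrow> 'v) \<Rightarrow> ('v \<Rightarrow> 'v) \<Rightarrow> 'v \<Rightarrow> 'v" where
  "levi_civita M X Y p =
     orth_proj (tangent_space M p) (frechet_derivative Y (at p within M) (X p))"

definition second_fundamental_form ::
    "'v::euclidean_space set \<Rightarrow> ('v \<Rightarrow> 'v) \<Rightarrow> ('v \<Rightarrow> 'v) \<Rightarrow> 'v \<Rightarrow> 'v" where
  "second_fundamental_form M X Y p =
     orth_proj (normal_space M p) (frechet_derivative Y (at p within M) (X p))"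

definition normal_connection ::
    "'v::euclidean_space set \<Rightarrow> 'v \<Rightarrow> ('v \<Rightarrow> 'v) \<Rightarrow> 'v \<Rightarrow> 'v" where
  "normal_connection M u \<xi> p =
     orth_proj (normal_space M p) (frechet_derivative \<xi> (at p within M) u)"

definition totally_geodesic :: "'v::euclidean_space set \<Rightarrow> bool" where
  "totally_geodesic M \<longleftrightarrow>
     (\<forall>X Y. tangent_field M X \<and> tangent_field M Y \<longrightarrow>
        (\<forall>p\<in>M. second_fundamental_form M X Y p = 0))"

definition complete_geodesic :: "'v::euclidean_space set \<Rightarrow> (real \<Rightarrow> 'v) \<Rightarrow> bool" where
  "complete_geodesic M \<gamma> \<longleftrightarrow> smooth_on UNIV \<gamma> \<and>
     (\<forall>t. \<gamma> t \<in> M \<and>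
        vector_derivative (\<lambda>s. vector_derivative \<gamma> (at s)) (at t) \<in> normal_space M (\<gamma> t))"

text \<open>Completeness of the induced Riemannian metric, which is not the same as closedness of the
  set in the ambient space.\<close>

definition complete_submanifold :: "'v::euclidean_space set \<Rightarrow> bool" where
  "complete_submanifold M \<longleftrightarrow> submanifold M \<and>
     (\<forall>p\<in>M. \<forall>v\<in>tangent_space M p.
        \<exists>\<gamma>. complete_geodesic M \<gamma> \<and> \<gamma> 0 = p \<and> vector_derivative \<gamma> (at 0) = v)"


subsection \<open>Distributions\<close>

definition distribution :: "'v::euclidean_space set \<Rightarrow> nat \<Rightarrow> ('v \<Rightarrow> 'v set) \<Rightarrow> bool" where
  "distribution M k \<D> \<longleftrightarrow>
     (\<forall>p\<in>M. subspace (\<D> p) \<and> \<D> p \<subseteq> tangent_space M p \<and> dim (\<D> p) = k) \<and>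
     (\<forall>p\<in>M. \<exists>U (F :: nat \<Rightarrow> 'v \<Rightarrow> 'v). open U \<and> p \<in> U \<and>
        (\<forall>i<k. smooth_on (M \<inter> U) (F i)) \<and>
        (\<forall>q\<in>M \<inter> U. \<D> q = span {F i q | i. i < k}))"

definition section_of :: "'v::euclidean_space set \<Rightarrow> ('v \<Rightarrow> 'v set) \<Rightarrow> ('v \<Rightarrow> 'v) \<Rightarrow> bool" where
  "section_of M \<D> X \<longleftrightarrow> smooth_on M X \<and> (\<forall>p\<in>M. X p \<in> \<D> p)"

definition complement_distribution ::
    "'v::euclidean_space set \<Rightarrow> ('v \<Rightarrow> 'v set) \<Rightarrow> 'v \<Rightarrow> 'v set" where
  "complement_distribution M \<D> p = tangent_space M p \<inter> orthogonal_comp (\<D> p)"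

definition autoparallel :: "'v::euclidean_space set \<Rightarrow> ('v \<Rightarrow> 'v set) \<Rightarrow> bool" where
  "autoparallel M \<D> \<longleftrightarrow>
     (\<forall>X Y. section_of M \<D> X \<and> section_of M \<D> Y \<longrightarrow>
        (\<forall>p\<in>M. levi_civita M X Y p \<in> \<D> p))"

definition sff_invariant :: "'v::euclidean_space set \<Rightarrow> ('v \<Rightarrow> 'v set) \<Rightarrow> bool" where
  "sff_invariant M \<D> \<longleftrightarrow>
     (\<forall>X Y. section_of M \<D> X \<and> section_of M (complement_distribution M \<D>) Y \<longrightarrow>
        (\<forall>p\<in>M. second_fundamental_form M X Y p = 0))"

definition parallel_along ::
    "'v::euclidean_space set \<Rightarrow> ('v \<Rightarrow> 'v set) \<Rightarrow> ('v \<Rightarrow> 'v) \<Rightarrow> bool" where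
  "parallel_along M \<E> \<xi> \<longleftrightarrow> (\<forall>p\<in>M. \<forall>u\<in>\<E> p. normal_connection M u \<xi> p = 0)"


subsection \<open>Compact Lie groups and orthogonal representations\<close>

text \<open>Charts take values in a linear subspace \<open>L\<close> of a Euclidean space, because the type of the
  latter has positive dimension and finite groups must be allowed.\<close>

definition smooth_atlas ::
    "'g topology \<Rightarrow> 'e::euclidean_space set \<Rightarrow> ('g set \<times> ('g \<Rightarrow> 'e)) set \<Rightarrow> bool" where
  "smooth_atlas T L A \<longleftrightarrow> subspace L \<and> (\<Union>(fst ` A)) = topspace T \<and>
     (\<forall>(U, \<phi>)\<in>A. openin T U \<and> openin (top_of_set L) (\<phi> ` U) \<and>
        homeomorphic_map (subtopology T U) (top_of_set (\<phi> ` U)) \<phi>) \<and>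
     (\<forall>(U, \<phi>)\<in>A. \<forall>(W, \<psi>)\<in>A. smooth_on (\<phi> ` (U \<inter> W)) (\<lambda>x. \<psi> (inv_into U \<phi> x)))"

definition compact_lie_group ::
    "'g monoid \<Rightarrow> 'g topology \<Rightarrow> 'e::euclidean_space set \<Rightarrow> ('g set \<times> ('g \<Rightarrow> 'e)) set \<Rightarrow> bool" where
  "compact_lie_group G T L A \<longleftrightarrow>
     group G \<and> topspace T = carrier G \<and> Hausdorff_space T \<and> compact_space T \<and>
     smooth_atlas T L A \<and>
     continuous_map (prod_topology T T) T (\<lambda>(g, h). g \<otimes>\<^bsub>G\<^esub> h) \<and>
     continuous_map T T (m_inv G) \<and>
     (\<forall>(U, \<phi>)\<in>A. \<forall>(W, \<psi>)\<in>A. \<forall>(Z, \<theta>)\<in>A.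
        smooth_on {(\<phi> g, \<psi> h) | g h. g \<in> U \<and> h \<in> W \<and> g \<otimes>\<^bsub>G\<^esub> h \<in> Z}
          (\<lambda>(x, y). \<theta> (inv_into U \<phi> x \<otimes>\<^bsub>G\<^esub> inv_into W \<psi> y))) \<and>
     (\<forall>(U, \<phi>)\<in>A. \<forall>(W, \<psi>)\<in>A.
        smooth_on {\<phi> g | g. g \<in> U \<and> m_inv G g \<in> W} (\<lambda>x. \<psi> (m_inv G (inv_into U \<phi> x))))"

definition orthogonal_representation ::
    "'g monoid \<Rightarrow> ('g set \<times> ('g \<Rightarrow> 'e::euclidean_space)) set \<Rightarrow> ('g \<Rightarrow> 'v::euclidean_space \<Rightarrow> 'v) \<Rightarrow> bool"
  where
  "orthogonal_representation G A \<rho> \<longleftrightarrow>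
     group_action G UNIV \<rho> \<and> (\<forall>g\<in>carrier G. orthogonal_transformation (\<rho> g)) \<and>
     (\<forall>(U, \<phi>)\<in>A. \<forall>v. smooth_on (\<phi> ` U) (\<lambda>x. \<rho> (inv_into U \<phi> x) v))"

text \<open>Principal orbits are those of maximal orbit type: the isotropy group is, up to conjugation,
  contained in every other isotropy group.\<close>

definition G_regular :: "'g monoid \<Rightarrow> ('g \<Rightarrow> 'v \<Rightarrow> 'v) \<Rightarrow> 'v \<Rightarrow> bool" where
  "G_regular G \<rho> p \<longleftrightarrow>
     (\<forall>q. \<exists>g\<in>carrier G. (\<lambda>h. g \<otimes>\<^bsub>G\<^esub> h \<otimes>\<^bsub>G\<^esub> m_inv G g) ` stabilizer G \<rho> p \<subseteq> stabilizer G \<rho> q)"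

definition principal_orbit :: "'g monoid \<Rightarrow> ('g \<Rightarrow> 'v \<Rightarrow> 'v) \<Rightarrow> 'v set \<Rightarrow> bool" where
  "principal_orbit G \<rho> N \<longleftrightarrow> (\<exists>p. G_regular G \<rho> p \<and> N = orbit G \<rho> p)"

text \<open>The differential of the linear map \<open>\<rho> g\<close> is \<open>\<rho> g\<close> itself.\<close>

definition invariant_distribution ::
    "'g monoid \<Rightarrow> ('g \<Rightarrow> 'v \<Rightarrow> 'v) \<Rightarrow> 'v set \<Rightarrow> ('v \<Rightarrow> 'v set) \<Rightarrow> bool" where
  "invariant_distribution G \<rho> N \<D> \<longleftrightarrow> (\<forall>g\<in>carrier G. \<forall>p\<in>N. \<D> (\<rho> g p) = \<rho> g ` \<D> p)"

definition equivariant_field ::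
    "'g monoid \<Rightarrow> ('g \<Rightarrow> 'v \<Rightarrow> 'v) \<Rightarrow> 'v set \<Rightarrow> ('v \<Rightarrow> 'v) \<Rightarrow> bool" where
  "equivariant_field G \<rho> N \<xi> \<longleftrightarrow> (\<forall>g\<in>carrier G. \<forall>p\<in>N. \<xi> (\<rho> g p) = \<rho> g (\<xi> p))"


subsection \<open>Sections and copolarity\<close>

definition k_section ::
    "'g monoid \<Rightarrow> ('g \<Rightarrow> 'v::euclidean_space \<Rightarrow> 'v) \<Rightarrow> nat \<Rightarrow> 'v set \<Rightarrow> bool" where
  "k_section G \<rho> k \<Sigma> \<longleftrightarrow>
     connected \<Sigma> \<and> complete_submanifold \<Sigma> \<and>
     totally_geodesic \<Sigma> \<and>
     (\<forall>x. \<Sigma> \<inter> orbit G \<rho> x \<noteq> {}) \<and>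
     (\<forall>p\<in>\<Sigma>. G_regular G \<rho> p \<longrightarrow>
        normal_space (orbit G \<rho> p) p \<subseteq> tangent_space \<Sigma> p \<and>
        dim (tangent_space \<Sigma> p) = dim (normal_space (orbit G \<rho> p) p) + k) \<and>
     (\<forall>p\<in>\<Sigma>. G_regular G \<rho> p \<longrightarrow> (\<forall>g\<in>carrier G. \<rho> g p \<in> \<Sigma> \<longrightarrow> \<rho> g ` \<Sigma> = \<Sigma>))"

definition sections_through ::
    "'g monoid \<Rightarrow> ('g \<Rightarrow> 'v::euclidean_space \<Rightarrow> 'v) \<Rightarrow> 'v \<Rightarrow> 'v set set" where
  "sections_through G \<rho> p = {\<Sigma>. p \<in> \<Sigma> \<and> (\<exists>k. k_section G \<rho> k \<Sigma>)}"

definition minimal_section ::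
    "'g monoid \<Rightarrow> ('g \<Rightarrow> 'v::euclidean_space \<Rightarrow> 'v) \<Rightarrow> 'v \<Rightarrow> 'v set \<Rightarrow> bool" where
  "minimal_section G \<rho> p \<Sigma> \<longleftrightarrow> \<Sigma> \<in> sections_through G \<rho> p \<and>
     (\<forall>\<Sigma>'\<in>sections_through G \<rho> p. \<Sigma>' \<subseteq> \<Sigma> \<longrightarrow> \<Sigma>' = \<Sigma>)"

definition copol :: "'g monoid \<Rightarrow> ('g \<Rightarrow> 'v::euclidean_space \<Rightarrow> 'v) \<Rightarrow> nat" where
  "copol G \<rho> = (THE k. \<forall>p. G_regular G \<rho> p \<longrightarrow> (\<exists>\<Sigma>. minimal_section G \<rho> p \<Sigma> \<and> k_section G \<rho> k \<Sigma>))"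

end

theory Submission
  imports Defs
begin

text \<open>Replace the group by the compact set of endomorphisms \<open>K\<close> given by the representation; its
  Lie algebra is the set of all \<open>X\<close> with \<open>exp (t X) \<in> K\<close> for all \<open>t\<close>. The two conditions on \<open>\<D>\<close>
  say that \<open>X \<E>\<^sub>p \<subseteq> \<E>\<^sub>p\<close> whenever \<open>X p \<in> \<D>\<^sub>p\<close>, and parallelism along \<open>\<E>\<close> says that
  \<open>X \<eta> \<in> \<E>\<^sub>p\<close> whenever \<open>X p \<in> \<E>\<^sub>p\<close> and \<open>\<eta>\<close> is normal at \<open>p\<close>. Hence
  \<open>W = \<D>\<^sub>p \<oplus> \<nu>\<^sub>p N\<close> contains the normal spaces at all its regular points. Among the linear subspaces
  with this property, intersections at common regular points are allowed, so one of least
  dimension satisfies (C4): it is a minimal section, of dimension at most \<open>dim W\<close>. Since every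
  \<open>k\<close>-section is a complete totally geodesic submanifold of a Euclidean space, it is such a linear
  subspace, and the least dimension determines the copolarity.\<close>

text \<open>The hypotheses speak of smooth fields on all of \<open>N\<close>, whereas the argument
  is linear algebra at one point \<open>p\<close>. The passage needs global fields with prescribed
  values. For \<open>\<D>\<close> and \<open>\<E>\<close>, constant vectors are projected
  orthogonally, and the projections are smooth by Gram-Schmidt. For a normal vector
  \<open>\<eta>\<close>, the field sending \<open>A p\<close> to \<open>A \<eta>\<close> is used: it
  is well defined because the principal isotropy group fixes the normal space, and smooth because
  the orbit map has smooth local sections, which is why an inverse function theorem appears. As
  \<open>copol\<close> is a definite description, both the existence of minimal sections through
  every regular point and the uniqueness of their index have to be proved.\<close>

section \<open>Calculus of smooth maps on open sets\<close>

lemma C_on_cong: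
  assumes "open U" "\<And>x. x \<in> U \<Longrightarrow> f x = g x"
  shows "C_on n U f \<longleftrightarrow> C_on n U g"
  using assms(2)
proof (induction n arbitrary: f g)
  case 0
  then show ?case by (simp cong: continuous_on_cong)
next
  case (Suc n)
  have der: "(f has_derivative D) (at x) \<longleftrightarrow> (g has_derivative D) (at x)" if "x \<in> U" for x D
  proof
    show "(g has_derivative D) (at x)" if "(f has_derivative D) (at x)"
      by (rule has_derivative_transform_within_open[OF that assms(1) \<open>x \<in> U\<close>]) (use Suc.prems in auto)
    show "(f has_derivative D) (at x)" if "(g has_derivative D) (at x)"
      by (rule has_derivative_transform_within_open[OF that assms(1) \<open>x \<in> U\<close>]) (use Suc.prems in auto)
  qed
  have "f differentiable (at x) \<longleftrightarrow> g differentiable (at x)" if "x \<in> U" for x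
    using der[OF that] by (simp add: differentiable_def)
  moreover have "C_on n U (\<lambda>x. frechet_derivative f (at x) v) \<longleftrightarrow> C_on n U (\<lambda>x. frechet_derivative g (at x) v)" for v
    by (rule Suc.IH) (simp add: der frechet_derivative_def)
  ultimately show ?case by auto
qed

text \<open>\<open>C_on\<close> is stated with the choice operator
  \<open>frechet_derivative\<close>; with this rule an induction on the order can use any known
  derivative formula.\<close>

lemma C_on_SucI:
  assumes "open U" "\<And>x. x \<in> U \<Longrightarrow> (f has_derivative f' x) (at x)"
    and "\<And>v. C_on n U (\<lambda>x. f' x v)"
  shows "C_on (Suc n) U f"
proof -
  have "f' x = frechet_derivative f (at x)" if "x \<in> U" for x
    using frechet_derivative_at[OF assms(2)[OF that]] .
  then have "C_on n U (\<lambda>x. frechet_derivative f (at x) v)" for v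
    by (subst C_on_cong[OF assms(1), where g = "\<lambda>x. f' x v"]) (simp_all add: assms(3))
  moreover have "f differentiable (at x)" if "x \<in> U" for x
    using assms(2)[OF that] differentiable_def by blast
  ultimately show ?thesis by simp
qed

lemma C_on_SucD:
  assumes "C_on (Suc n) U f"
  shows "x \<in> U \<Longrightarrow> (f has_derivative frechet_derivative f (at x)) (at x)"
    and "C_on n U (\<lambda>x. frechet_derivative f (at x) v)"
  using assms by (auto simp: frechet_derivative_works)

lemma C_on_Suc_mono: "C_on (Suc n) U f \<Longrightarrow> C_on n U f"
proof (induction n arbitrary: f)
  case 0
  then show ?case
    by (auto intro!: continuous_at_imp_continuous_on differentiable_imp_continuous_within)
next
  case (Suc n)
  then show ?case by (metis C_on.simps(2))
qed

lemma C_on_subset: "C_on n U f \<Longrightarrow> V \<subseteq> U \<Longrightarrow> C_on n V f"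
  by (induction n arbitrary: f) (auto intro: continuous_on_subset)

text \<open>On open sets this agrees with \<open>smooth_on\<close>
  (\<open>smooth_on_open_iff\<close>), and it passes to directional derivatives without choosing
  extensions.\<close>

definition smooth_open :: "'a::euclidean_space set \<Rightarrow> ('a \<Rightarrow> 'b::euclidean_space) \<Rightarrow> bool" where
  "smooth_open U f \<longleftrightarrow> open U \<and> (\<forall>n. C_on n U f)"

lemma smooth_open_cong:
  "smooth_open U f \<Longrightarrow> (\<And>x. x \<in> U \<Longrightarrow> f x = g x) \<Longrightarrow> smooth_open U g"
  unfolding smooth_open_def using C_on_cong by blast

lemma smooth_open_subset: "smooth_open U f \<Longrightarrow> open V \<Longrightarrow> V \<subseteq> U \<Longrightarrow> smooth_open V f"
  unfolding smooth_open_def using C_on_subset by blast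

lemma smooth_open_continuous: "smooth_open U f \<Longrightarrow> continuous_on U f"
  unfolding smooth_open_def by (metis C_on.simps(1))

lemma smooth_open_has_derivative:
  "smooth_open U f \<Longrightarrow> x \<in> U \<Longrightarrow> (f has_derivative frechet_derivative f (at x)) (at x)"
  unfolding smooth_open_def using C_on_SucD(1) by blast

lemma smooth_open_frechet_derivative:
  "smooth_open U f \<Longrightarrow> smooth_open U (\<lambda>x. frechet_derivative f (at x) v)"
  unfolding smooth_open_def using C_on_SucD(2) by blast

lemma C_on_const: "C_on n U (\<lambda>x. c)"
proof (induction n arbitrary: c)
  case (Suc n)
  have "frechet_derivative (\<lambda>x. c) (at x) = (\<lambda>v. 0)" for x :: 'a
    by simp
  with Suc show ?case by simp
qed simp

lemma C_on_linear:
  assumes "bounded_linear L" "open U" "C_on n U f"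
  shows "C_on n U (\<lambda>x. L (f x))"
  using assms(3)
proof (induction n arbitrary: f)
  case 0
  then show ?case using bounded_linear.continuous_on[OF assms(1)] by simp
next
  case (Suc n)
  note D = C_on_SucD[OF Suc.prems]
  show ?case
    by (rule C_on_SucI[OF assms(2) bounded_linear.has_derivative[OF assms(1) D(1)] Suc.IH[OF D(2)]])
qed

lemma C_on_ident: "C_on n U (\<lambda>x. x)"
proof (cases n)
  case (Suc m)
  have "frechet_derivative (\<lambda>x. x) (at x) = (\<lambda>v. v)" for x :: 'a
    by (simp add: frechet_derivative_ident)
  with Suc show ?thesis by (simp add: C_on_const)
qed auto

lemma C_on_add:
  assumes "open U" "C_on n U f" "C_on n U g"
  shows "C_on n U (\<lambda>x. f x + g x)"
  using assms(2,3)
proof (induction n arbitrary: f g)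
  case 0
  then show ?case by (auto intro: continuous_intros)
next
  case (Suc n)
  note D = C_on_SucD[OF Suc.prems(1)] C_on_SucD[OF Suc.prems(2)]
  show ?case
    by (rule C_on_SucI[OF assms(1) has_derivative_add[OF D(1) D(3)] Suc.IH[OF D(2) D(4)]])
qed

lemma C_on_sum:
  assumes "open U" "\<And>i. i \<in> I \<Longrightarrow> C_on n U (f i)"
  shows "C_on n U (\<lambda>x. \<Sum>i\<in>I. f i x)"
  using assms(2)
  by (induction I rule: infinite_finite_induct) (auto simp: C_on_const C_on_add[OF assms(1)])

lemma C_on_bilinear:
  assumes B: "bounded_bilinear B" and "open U" "C_on n U f" "C_on n U g"
  shows "C_on n U (\<lambda>x. B (f x) (g x))"
  using assms(3,4)
proof (induction n arbitrary: f g)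
  case 0
  then show ?case using bounded_bilinear.continuous_on[OF B] by simp
next
  case (Suc n)
  note D = C_on_SucD[OF Suc.prems(1)] C_on_SucD[OF Suc.prems(2)]
  have "C_on n U (\<lambda>x. B (f x) (frechet_derivative g (at x) v) + B (frechet_derivative f (at x) v) (g x))" for v
    by (intro C_on_add[OF assms(2)] Suc.IH D C_on_Suc_mono[OF Suc.prems(1)]
        C_on_Suc_mono[OF Suc.prems(2)])
  then show ?case
    using C_on_SucI[OF assms(2) bounded_bilinear.FDERIV[OF B D(1) D(3)]] by blast
qed

lemma linear_euclidean_expand:
  fixes f :: "'a::euclidean_space \<Rightarrow> 'b::real_vector"
  assumes "linear f" shows "f v = (\<Sum>b\<in>Basis. (v \<bullet> b) *\<^sub>R f b)"
proof -
  have "f v = f (\<Sum>b\<in>Basis. (v \<bullet> b) *\<^sub>R b)" by (simp add: euclidean_representation)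
  also have "\<dots> = (\<Sum>b\<in>Basis. (v \<bullet> b) *\<^sub>R f b)"
    using assms by (simp add: linear_sum linear_scale)
  finally show ?thesis .
qed

text \<open>By the chain rule the derivative in direction \<open>v\<close> is
  \<open>g' (f x) (f' x v)\<close>, where both the linear map and its argument depend on
  \<open>x\<close>. Expanding the argument in the standard basis leaves products of functions to
  which the induction hypothesis applies.\<close>

lemma C_on_compose:
  fixes f :: "'a::euclidean_space \<Rightarrow> 'b::euclidean_space" and g :: "'b \<Rightarrow> 'c::euclidean_space"
  assumes "open U" "open W" "f ` U \<subseteq> W" "C_on n U f" "C_on n W g"
  shows "C_on n U (\<lambda>x. g (f x))"
  using assms(4,5)
proof (induction n arbitrary: g)
  case 0
  then show ?case using assms(3) by (auto intro: continuous_on_compose2)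
next
  case (Suc n)
  note D = C_on_SucD[OF Suc.prems(1)] C_on_SucD[OF Suc.prems(2)]
  define f' where "f' x = frechet_derivative f (at x)" for x
  define g' where "g' y = frechet_derivative g (at y)" for y
  have der: "((\<lambda>x. g (f x)) has_derivative (\<lambda>v. g' (f x) (f' x v))) (at x)" if "x \<in> U" for x
  proof -
    have "f x \<in> W" using that assms(3) by auto
    from has_derivative_compose[OF D(1)[OF that] D(3)[OF this]] show ?thesis
      unfolding f'_def g'_def .
  qed
  have "C_on n U (\<lambda>x. \<Sum>b\<in>Basis. (f' x v \<bullet> b) *\<^sub>R g' (f x) b)" for v
    unfolding f'_def g'_def
    by (intro C_on_sum C_on_bilinear[OF bounded_bilinear_scaleR] assms(1)
        C_on_linear[OF bounded_linear_inner_left assms(1)] D(2) Suc.IH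
        C_on_Suc_mono[OF Suc.prems(1)] D(4))
  moreover have "(\<Sum>b\<in>Basis. (f' x v \<bullet> b) *\<^sub>R g' (f x) b) = g' (f x) (f' x v)" if "x \<in> U" for v x
  proof -
    have "linear (g' (f x))"
      unfolding g'_def using that assms(3) D(3) has_derivative_linear by blast
    then show ?thesis by (metis linear_euclidean_expand)
  qed
  ultimately have "C_on n U (\<lambda>x. g' (f x) (f' x v))" for v
    by (subst C_on_cong[OF assms(1), where g = "\<lambda>x. \<Sum>b\<in>Basis. (f' x v \<bullet> b) *\<^sub>R g' (f x) b"]) simp_all
  then show ?case using C_on_SucI[OF assms(1) der] by blast
qed

lemma open_nonzero: "open (- {0::'a::{t1_space,zero}})"
  by (rule open_Compl) simp

text \<open>The induction closes because the derivative of \<open>inverse\<close> is a polynomial in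
  \<open>inverse\<close> itself.\<close>

lemma C_on_inverse: "C_on n (- {0}) (inverse :: real \<Rightarrow> real)"
proof (induction n)
  case 0
  then show ?case by (auto intro!: continuous_intros)
next
  case (Suc n)
  note op = open_nonzero[where 'a = real]
  show ?case
  proof (rule C_on_SucI[OF op])
    show "(inverse has_derivative (\<lambda>v. - (inverse x * v * inverse x))) (at x)" if "x \<in> - {0}" for x :: real
      using has_derivative_inverse'[of x UNIV] that by simp
    show "C_on n (- {0}) (\<lambda>x::real. - (inverse x * v * inverse x))" for v
      by (intro C_on_linear[OF bounded_linear_minus[OF bounded_linear_ident] op]
          C_on_bilinear[OF bounded_bilinear_mult op] Suc C_on_const)
  qed
qed

lemma smooth_open_const: "open U \<Longrightarrow> smooth_open U (\<lambda>x. c)"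
  and smooth_open_ident: "open U \<Longrightarrow> smooth_open U (\<lambda>x. x)"
  by (auto simp: smooth_open_def C_on_const C_on_ident)

lemma smooth_open_add: "smooth_open U f \<Longrightarrow> smooth_open U g \<Longrightarrow> smooth_open U (\<lambda>x. f x + g x)"
  by (simp add: smooth_open_def C_on_add)

lemma smooth_open_sum:
  "open U \<Longrightarrow> (\<And>i. i \<in> I \<Longrightarrow> smooth_open U (f i)) \<Longrightarrow> smooth_open U (\<lambda>x. \<Sum>i\<in>I. f i x)"
  by (simp add: smooth_open_def C_on_sum)

lemma smooth_open_bilinear:
  "bounded_bilinear B \<Longrightarrow> smooth_open U f \<Longrightarrow> smooth_open U g \<Longrightarrow> smooth_open U (\<lambda>x. B (f x) (g x))"
  by (simp add: smooth_open_def C_on_bilinear)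

lemma smooth_open_linear:
  "bounded_linear L \<Longrightarrow> smooth_open U f \<Longrightarrow> smooth_open U (\<lambda>x. L (f x))"
  by (simp add: smooth_open_def C_on_linear)

lemma smooth_open_diff: "smooth_open U f \<Longrightarrow> smooth_open U g \<Longrightarrow> smooth_open U (\<lambda>x. f x - g x)"
  using smooth_open_add[of U f "\<lambda>x. - g x"]
    smooth_open_linear[OF bounded_linear_minus[OF bounded_linear_ident], of U g] by simp

lemma smooth_open_compose:
  "smooth_open U f \<Longrightarrow> smooth_open W g \<Longrightarrow> f ` U \<subseteq> W \<Longrightarrow> smooth_open U (\<lambda>x. g (f x))"
  unfolding smooth_open_def using C_on_compose by blast

lemma smooth_open_divide:
  assumes "smooth_open U f" "smooth_open U g" "\<And>x. x \<in> U \<Longrightarrow> g x \<noteq> 0"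
  shows "smooth_open U (\<lambda>x. f x / (g x :: real))"
proof -
  have "smooth_open (- {0}) (inverse :: real \<Rightarrow> real)"
    by (simp add: smooth_open_def C_on_inverse open_nonzero)
  from smooth_open_compose[OF assms(2) this] have "smooth_open U (\<lambda>x. inverse (g x))"
    using assms(3) by (metis ComplI image_subsetI singletonD)
  then show ?thesis
    using smooth_open_bilinear[OF bounded_bilinear_mult assms(1)] by (simp add: divide_inverse)
qed

lemma smooth_onI:
  assumes "\<And>x. x \<in> S \<Longrightarrow> \<exists>U F. smooth_open U F \<and> x \<in> U \<and> (\<forall>y\<in>S \<inter> U. F y = f y)"
  shows "smooth_on S f"
  unfolding smooth_on_def
proof
  fix x assume "x \<in> S"
  from assms[OF this] obtain U F where "smooth_open U F" "x \<in> U" "\<forall>y\<in>S \<inter> U. F y = f y" by blast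
  then show "\<exists>U F. open U \<and> x \<in> U \<and> (\<forall>n. C_on n U F) \<and> (\<forall>y\<in>S \<inter> U. F y = f y)"
    by (intro exI[of _ U] exI[of _ F]) (simp add: smooth_open_def)
qed

lemma smooth_onE:
  assumes "smooth_on S f" "x \<in> S"
  obtains U F where "smooth_open U F" "x \<in> U" "\<forall>y\<in>S \<inter> U. F y = f y"
proof -
  from bspec[OF assms(1)[unfolded smooth_on_def] assms(2)]
  obtain U F where "open U" "x \<in> U" "\<forall>n. C_on n U F" "\<forall>y\<in>S \<inter> U. F y = f y"
    by (elim exE conjE)
  then show thesis by (intro that[of U F]) (simp_all add: smooth_open_def)
qed

lemma smooth_open_Un:
  assumes "open U" "\<And>x. x \<in> U \<Longrightarrow> \<exists>V. x \<in> V \<and> smooth_open V f"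
  shows "smooth_open U f"
proof -
  have "C_on n U f" for n
    using assms(2)
  proof (induction n arbitrary: f)
    case 0
    have "continuous (at x) f" if "x \<in> U" for x
    proof -
      obtain V where "x \<in> V" "smooth_open V f" using 0[OF \<open>x \<in> U\<close>] by blast
      then show ?thesis
        using continuous_on_eq_continuous_at smooth_open_continuous unfolding smooth_open_def by blast
    qed
    then show ?case by (simp add: continuous_at_imp_continuous_on)
  next
    case (Suc n)
    have "C_on n U (\<lambda>x. frechet_derivative f (at x) v)" for v
      by (rule Suc.IH) (use Suc.prems smooth_open_frechet_derivative in blast)
    moreover have "f differentiable (at x)" if "x \<in> U" for x
      using Suc.prems[OF that] smooth_open_has_derivative unfolding differentiable_def by blast
    ultimately show ?case by simp
  qed
  then show ?thesis using assms(1) by (simp add: smooth_open_def)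
qed

lemma smooth_on_open_iff:
  assumes "open U" shows "smooth_on U f \<longleftrightarrow> smooth_open U f"
proof
  assume f: "smooth_on U f"
  show "smooth_open U f"
  proof (rule smooth_open_Un[OF assms])
    fix x assume x: "x \<in> U"
    obtain V F where V: "smooth_open V F" "x \<in> V" "\<forall>y\<in>U \<inter> V. F y = f y"
      by (rule smooth_onE[OF f x])
    have "open V" using V(1) by (simp add: smooth_open_def)
    then have "smooth_open (U \<inter> V) F" using smooth_open_subset[OF V(1)] assms by auto
    then have "smooth_open (U \<inter> V) f" by (rule smooth_open_cong) (use V(3) in auto)
    then show "\<exists>V. x \<in> V \<and> smooth_open V f" using x V(2) by blast
  qed
next
  assume "smooth_open U f" then show "smooth_on U f"
    by (intro smooth_onI) auto
qed

text \<open>For \<open>M\<close> of lower dimension the derivative within \<open>M\<close> is not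
  unique, so \<open>frechet_derivative\<close> is an arbitrary choice; a local extension shows that
  there is a derivative to choose.\<close>

lemma smooth_on_has_derivative_within:
  assumes "smooth_on M f" "p \<in> M"
  shows "(f has_derivative frechet_derivative f (at p within M)) (at p within M)"
proof -
  obtain U F where F: "smooth_open U F" "p \<in> U" "\<forall>y\<in>M \<inter> U. F y = f y"
    by (rule smooth_onE[OF assms])
  have "(F has_derivative frechet_derivative F (at p)) (at p within M)"
    using smooth_open_has_derivative[OF F(1,2)] has_derivative_at_withinI by blast
  moreover have "open U" using F(1) smooth_open_def by blast
  ultimately have "(f has_derivative frechet_derivative F (at p)) (at p within M)"
  proof -
    assume a: "(F has_derivative frechet_derivative F (at p)) (at p within M)" and "open U"
    from \<open>open U\<close> F(2) obtain d where "d > 0" "ball p d \<subseteq> U" by (auto simp: open_contains_ball)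
    then show ?thesis
      by (intro has_derivative_transform_within[OF a \<open>d > 0\<close> assms(2)])
        (use F(3) in \<open>auto simp: dist_commute subset_iff\<close>)
  qed
  then show ?thesis using differentiable_def frechet_derivative_works by blast
qed

text \<open>The arbitrariness of the derivative within \<open>M\<close> disappears on velocities of
  curves in \<open>M\<close>. All later computations with the connections pass through this chain
  rule.\<close>

lemma smooth_on_along_curve:
  assumes f: "smooth_on M f" and t: "t \<in> J" and J: "open J"
    and cM: "c ` J \<subseteq> M" and c: "(c has_vector_derivative v) (at t)"
  shows "((\<lambda>s. f (c s)) has_vector_derivative frechet_derivative f (at (c t) within M) v) (at t)"
proof -
  have 1: "(f has_derivative frechet_derivative f (at (c t) within M)) (at (c t) within M)"
    using smooth_on_has_derivative_within[OF f] cM t by blast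
  have 2: "(f has_derivative frechet_derivative f (at (c t) within M)) (at (c t) within c ` J)"
    by (rule has_derivative_subset[OF 1 cM])
  have "(c has_vector_derivative v) (at t within J)"
    using c has_vector_derivative_at_within by blast
  from vector_derivative_diff_chain_within[OF this 2]
  have "((\<lambda>s. f (c s)) has_vector_derivative frechet_derivative f (at (c t) within M) v) (at t within J)"
    by (simp add: o_def)
  then show ?thesis using at_within_open[OF t J] by simp
qed

subsection \<open>Orthogonal projections\<close>

lemma orth_proj_eqI:
  assumes "subspace S" "y \<in> S" "x - y \<in> orthogonal_comp S"
  shows "orth_proj S x = y"
  unfolding orth_proj_def
proof (rule the_equality)
  show "y \<in> S \<and> x - y \<in> orthogonal_comp S" using assms by simp
  fix z assume z: "z \<in> S \<and> x - z \<in> orthogonal_comp S"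
  have "(x - y) - (x - z) \<in> orthogonal_comp S"
    using z assms(3) subspace_orthogonal_comp subspace_diff by blast
  then have "z - y \<in> orthogonal_comp S" by simp
  moreover have "z - y \<in> S" using z assms by (simp add: subspace_diff)
  ultimately have "orthogonal (z - y) (z - y)" by (auto simp: orthogonal_comp_def)
  then show "z = y" by (simp add: orthogonal_self)
qed

lemma orth_proj_in:
  assumes "subspace S"
  shows "orth_proj S x \<in> S" and "x - orth_proj S x \<in> orthogonal_comp S"
proof -
  obtain y z where "y \<in> span S" "\<And>w. w \<in> span S \<Longrightarrow> orthogonal z w" "x = y + z"
    using orthogonal_subspace_decomp_exists by metis
  then have yz: "y \<in> S" "x - y \<in> orthogonal_comp S"
    using assms by (auto simp: orthogonal_comp_def span_eq_iff[THEN iffD2] orthogonal_commute)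
  then have "orth_proj S x = y" using orth_proj_eqI[OF assms] by blast
  with yz show "orth_proj S x \<in> S" "x - orth_proj S x \<in> orthogonal_comp S" by auto
qed

lemma orth_proj_id: "subspace S \<Longrightarrow> x \<in> S \<Longrightarrow> orth_proj S x = x"
  by (rule orth_proj_eqI) (auto simp: subspace_0 subspace_orthogonal_comp)

lemma linear_orth_proj:
  assumes "subspace S" shows "linear (orth_proj S)"
proof (rule linearI)
  fix x y and r :: real
  note P = orth_proj_in[OF assms] and C = subspace_orthogonal_comp[of S]
  show "orth_proj S (x + y) = orth_proj S x + orth_proj S y"
    using subspace_add[OF C P(2) P(2), of x y]
    by (intro orth_proj_eqI assms subspace_add P) (simp add: algebra_simps)
  show "orth_proj S (r *\<^sub>R x) = r *\<^sub>R orth_proj S x"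
    using subspace_mul[OF C P(2), of r x]
    by (intro orth_proj_eqI assms subspace_mul P) (simp add: algebra_simps)
qed

lemma orthogonal_compD: "x \<in> orthogonal_comp S \<Longrightarrow> y \<in> S \<Longrightarrow> y \<bullet> x = 0"
  by (auto simp: orthogonal_comp_def orthogonal_def inner_commute)

lemma orthogonal_compI: "(\<And>y. y \<in> S \<Longrightarrow> y \<bullet> x = 0) \<Longrightarrow> x \<in> orthogonal_comp S"
  by (auto simp: orthogonal_comp_def orthogonal_def inner_commute)

lemma orth_proj_inner: "subspace S \<Longrightarrow> y \<in> S \<Longrightarrow> y \<bullet> orth_proj S x = y \<bullet> x"
  using orthogonal_compD[OF orth_proj_in(2)[of S x]] by (simp add: inner_diff_right)

lemma orth_proj_eq_0_iff: "subspace S \<Longrightarrow> orth_proj S x = 0 \<longleftrightarrow> x \<in> orthogonal_comp S"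
  using orth_proj_in(2)[of S x] orth_proj_eqI[of S 0 x] subspace_0[of S] by auto

text \<open>One Gram-Schmidt step. For \<open>w \<in> S\<close> the vector \<open>u\<close> is zero
  and the correction term vanishes, so no case distinction arises.\<close>

lemma orth_proj_span_insert:
  assumes S: "subspace S" and u: "u = w - orth_proj S w"
  shows "orth_proj (span (insert w S)) v = orth_proj S v + ((v \<bullet> u) / (u \<bullet> u)) *\<^sub>R u"
proof (rule orth_proj_eqI)
  note P = orth_proj_in[OF S]
  have Ssub: "S \<subseteq> span (insert w S)" by (meson span_superset subset_insertI subset_trans)
  have uin: "u \<in> span (insert w S)"
    unfolding u using P(1)[of w] Ssub by (intro span_diff) (auto intro: span_base)
  show "orth_proj S v + ((v \<bullet> u) / (u \<bullet> u)) *\<^sub>R u \<in> span (insert w S)"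
    using P(1)[of v] Ssub uin by (intro span_add span_mul) auto
  let ?r = "v - (orth_proj S v + ((v \<bullet> u) / (u \<bullet> u)) *\<^sub>R u)"
  have uperp: "u \<in> orthogonal_comp S" unfolding u by (rule P)
  have "?r = (v - orth_proj S v) - ((v \<bullet> u) / (u \<bullet> u)) *\<^sub>R u" by simp
  then have rS: "?r \<in> orthogonal_comp S"
    using P(2) uperp by (metis subspace_diff subspace_mul subspace_orthogonal_comp)
  have "orth_proj S v \<bullet> u = 0" using orthogonal_compD[OF uperp P(1)] .
  then have "?r \<bullet> u = 0" by (simp add: inner_diff_left inner_add_left)
  moreover have "w = u + orth_proj S w" by (simp add: u)
  ultimately have "w \<bullet> ?r = 0" using orthogonal_compD[OF rS P(1), of w]
    by (metis add.right_neutral inner_add_left inner_commute)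
  then have "\<forall>y\<in>insert w S. orthogonal ?r y"
    using orthogonal_compD[OF rS] by (auto simp: orthogonal_def inner_commute)
  then show "?r \<in> orthogonal_comp (span (insert w S))"
    by (intro orthogonal_compI) (metis orthogonal_def orthogonal_to_span inner_commute)
qed auto

lemma smooth_open_orth_proj_field:
  assumes "open V" "\<And>x. subspace (S x)" "\<And>v. smooth_open V (\<lambda>x. orth_proj (S x) v)" "smooth_open V f"
  shows "smooth_open V (\<lambda>x. orth_proj (S x) (f x))"
proof -
  have "smooth_open V (\<lambda>x. \<Sum>b\<in>Basis. (f x \<bullet> b) *\<^sub>R orth_proj (S x) b)"
    by (intro smooth_open_sum smooth_open_bilinear[OF bounded_bilinear_scaleR] assms
        smooth_open_linear[OF bounded_linear_inner_left assms(4)])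
  then show ?thesis
    by (rule smooth_open_cong) (rule linear_euclidean_expand[OF linear_orth_proj[OF assms(2)], symmetric])
qed

text \<open>Gram-Schmidt without normalisation: all denominators stay nonzero near a point where the
  frame is independent.\<close>

lemma smooth_orth_proj_frame_ex:
  fixes F :: "nat \<Rightarrow> 'a::euclidean_space \<Rightarrow> 'b::euclidean_space"
  assumes "\<And>i. i < k \<Longrightarrow> smooth_open U (F i)" "open U" "q \<in> U" "dim (span {F i q | i. i < k}) = k"
  shows "\<exists>V. q \<in> V \<and> V \<subseteq> U \<and> open V \<and> (\<forall>v. smooth_open V (\<lambda>x. orth_proj (span {F i x | i. i < k}) v)) \<and>
     (\<forall>x\<in>V. dim (span {F i x | i. i < k}) = k)"
  using assms
proof (induction k)
  case 0
  have "orth_proj {0} v = 0" for v :: 'b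
    by (rule orth_proj_eqI) (simp_all add: subspace_def orthogonal_comp_def orthogonal_def)
  with 0(2,3) show ?case by (intro exI[of _ U]) (simp add: smooth_open_const)
next
  case (Suc k)
  define S where "S x = span {F i x | i. i < k}" for x
  have ins: "{F i x | i. i < Suc k} = insert (F k x) {F i x | i. i < k}" for x
    by (auto simp: less_Suc_eq)
  have spS: "span {F i x | i. i < Suc k} = span (insert (F k x) (S x))" for x
    unfolding ins S_def span_insert span_span ..
  have dimS: "dim (span {F i x | i. i < Suc k}) = (if F k x \<in> S x then dim (S x) else dim (S x) + 1)" for x
    unfolding ins S_def by (simp add: dim_span dim_insert)
  have le: "dim (S x) \<le> k" for x
  proof -
    have "dim {F i x | i. i < k} \<le> card ((\<lambda>i. F i x) ` {..<k})"
      by (rule dim_le_card) (auto intro: span_base)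
    also have "\<dots> \<le> k" using card_image_le[of "{..<k}" "\<lambda>i. F i x"] by simp
    finally show ?thesis by (simp add: S_def)
  qed
  \<comment> \<open>Each vector raises the dimension by at most one, so the full dimension
    \<open>Suc k\<close> forces the first \<open>k\<close> vectors to be independent and the last
    one to lie outside their span.\<close>
  have q: "dim (S q) = k" "F k q \<notin> S q"
    using dimS[of q] Suc.prems(4) le[of q] by (auto split: if_splits)
  have "\<exists>V. q \<in> V \<and> V \<subseteq> U \<and> open V \<and> (\<forall>v. smooth_open V (\<lambda>x. orth_proj (S x) v)) \<and>
     (\<forall>x\<in>V. dim (S x) = k)"
    unfolding S_def
    by (rule Suc.IH[OF Suc.prems(1)[OF less_SucI] Suc.prems(2,3)]) (use q(1) in \<open>simp_all add: S_def\<close>)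
  then obtain V where V: "q \<in> V" "V \<subseteq> U" "open V" "\<forall>v. smooth_open V (\<lambda>x. orth_proj (S x) v)"
     "\<forall>x\<in>V. dim (S x) = k"
    by (elim exE conjE)
  have sub: "subspace (S x)" for x by (simp add: S_def)
  define u where "u x = F k x - orth_proj (S x) (F k x)" for x
  have FkV: "smooth_open V (F k)" using Suc.prems(1)[of k] V smooth_open_subset by blast
  have usm: "smooth_open V u"
    unfolding u_def by (rule smooth_open_diff[OF FkV smooth_open_orth_proj_field[OF V(3) sub spec[OF V(4)] FkV]])
  define V' where "V' = {x\<in>V. u x \<noteq> 0}"
  have "open V'"
  proof -
    have "V' = V \<inter> u -` (- {0})" by (auto simp: V'_def)
    then show ?thesis using continuous_open_preimage[OF smooth_open_continuous[OF usm] V(3)] by auto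
  qed
  have unz: "u x \<noteq> 0 \<longleftrightarrow> F k x \<notin> S x" for x
    unfolding u_def using orth_proj_id[OF sub, of "F k x" x] orth_proj_in(1)[OF sub, of x "F k x"] by auto
  have usm': "smooth_open V' u" and Pm: "smooth_open V' (\<lambda>x. orth_proj (S x) v)" for v
    by (rule smooth_open_subset[OF usm \<open>open V'\<close>] smooth_open_subset[OF spec[OF V(4)] \<open>open V'\<close>],
        simp add: V'_def)+
  have "smooth_open V' (\<lambda>x. orth_proj (S x) v + ((v \<bullet> u x) / (u x \<bullet> u x)) *\<^sub>R u x)" for v
  proof -
    have "smooth_open V' (\<lambda>x. (v \<bullet> u x) / (u x \<bullet> u x))"
      by (rule smooth_open_divide[OF smooth_open_linear[OF bounded_linear_inner_right usm']
            smooth_open_bilinear[OF bounded_bilinear_inner usm' usm']]) (simp add: V'_def)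
    from smooth_open_add[OF Pm smooth_open_bilinear[OF bounded_bilinear_scaleR this usm']]
    show ?thesis .
  qed
  moreover have "orth_proj (span {F i x | i. i < Suc k}) v
      = orth_proj (S x) v + ((v \<bullet> u x) / (u x \<bullet> u x)) *\<^sub>R u x" for v x
    unfolding spS by (rule orth_proj_span_insert[OF sub]) (simp add: u_def)
  ultimately have "smooth_open V' (\<lambda>x. orth_proj (span {F i x | i. i < Suc k}) v)" for v
    by simp
  moreover have "q \<in> V'" "V' \<subseteq> U" using V(1,2) q(2) unz by (auto simp: V'_def)
  moreover have "\<forall>x\<in>V'. dim (span {F i x | i. i < Suc k}) = Suc k"
  proof
    fix x assume "x \<in> V'"
    then have "x \<in> V" "F k x \<notin> S x" using unz by (auto simp: V'_def)
    with V(5) show "dim (span {F i x | i. i < Suc k}) = Suc k" unfolding dimS by simp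
  qed
  ultimately show ?case using \<open>open V'\<close> by (intro exI[of _ V'] conjI allI) assumption+
qed

lemma smooth_orth_proj_frame:
  fixes F :: "nat \<Rightarrow> 'a::euclidean_space \<Rightarrow> 'b::euclidean_space"
  assumes "\<forall>i<k. smooth_open U (F i)" "open U" "q \<in> U" "dim (span {F i q | i. i < k}) = k"
  obtains V where "q \<in> V" "V \<subseteq> U" "open V" "\<forall>v. smooth_open V (\<lambda>x. orth_proj (span {F i x | i. i < k}) v)"
    "\<forall>x\<in>V. dim (span {F i x | i. i < k}) = k"
proof -
  have "\<exists>V. q \<in> V \<and> V \<subseteq> U \<and> open V \<and> (\<forall>v. smooth_open V (\<lambda>x. orth_proj (span {F i x | i. i < k}) v)) \<and>
     (\<forall>x\<in>V. dim (span {F i x | i. i < k}) = k)"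
    by (rule smooth_orth_proj_frame_ex[where F = F and k = k, OF _ assms(2-4)]) (use assms(1) in blast)
  then show thesis by (elim exE conjE) (rule that)
qed

subsection \<open>The Banach algebra of endomorphisms\<close>

text \<open>A copy of the bounded linear endomorphisms, so that the power series \<open>exp\<close> of the library
  becomes available.\<close>

typedef (overloaded) 'v endo = "UNIV :: ('v::euclidean_space \<Rightarrow>\<^sub>L 'v) set"
  morphisms endo_blinfun Endo ..

setup_lifting type_definition_endo

instantiation endo :: (euclidean_space) real_normed_algebra_1
begin

lift_definition zero_endo :: "'a endo" is 0 .
lift_definition one_endo :: "'a endo" is id_blinfun .
lift_definition plus_endo :: "'a endo \<Rightarrow> 'a endo \<Rightarrow> 'a endo" is "(+)" .
lift_definition minus_endo :: "'a endo \<Rightarrow> 'a endo \<Rightarrow> 'a endo" is "(-)" .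
lift_definition uminus_endo :: "'a endo \<Rightarrow> 'a endo" is uminus .
lift_definition times_endo :: "'a endo \<Rightarrow> 'a endo \<Rightarrow> 'a endo" is "(o\<^sub>L)" .
lift_definition scaleR_endo :: "real \<Rightarrow> 'a endo \<Rightarrow> 'a endo" is "(*\<^sub>R)" .
lift_definition norm_endo :: "'a endo \<Rightarrow> real" is norm .
lift_definition dist_endo :: "'a endo \<Rightarrow> 'a endo \<Rightarrow> real" is dist .
lift_definition sgn_endo :: "'a endo \<Rightarrow> 'a endo" is sgn .

definition uniformity_endo :: "('a endo \<times> 'a endo) filter" where
  "uniformity_endo = (INF e\<in>{0 <..}. principal {(x, y). dist x y < e})"

definition open_endo :: "'a endo set \<Rightarrow> bool" where
  "open_endo U = (\<forall>x\<in>U. \<forall>\<^sub>F (x', y) in uniformity. x' = x \<longrightarrow> y \<in> U)"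

instance
proof
  fix a b c :: "'a endo" and r s :: real and U :: "'a endo set"
  show "dist a b = norm (a - b)" by transfer (rule dist_norm)
  show "sgn a = inverse (norm a) *\<^sub>R a" by transfer (rule sgn_div_norm)
  show "uniformity = (INF e\<in>{0 <..}. principal {(x, y). dist x y < e :: bool} :: ('a endo \<times> 'a endo) filter)"
    by (rule uniformity_endo_def)
  show "open U = (\<forall>x\<in>U. \<forall>\<^sub>F (x', y) in uniformity. x' = x \<longrightarrow> y \<in> U)"
    by (rule open_endo_def)
  show "a + b + c = a + (b + c)" "a + b = b + a" "0 + a = a" "- a + a = 0" "a - b = a + - b"
    by (transfer, simp add: algebra_simps)+
  show "r *\<^sub>R (a + b) = r *\<^sub>R a + r *\<^sub>R b" "(r + s) *\<^sub>R a = r *\<^sub>R a + s *\<^sub>R a"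
    "r *\<^sub>R s *\<^sub>R a = (r * s) *\<^sub>R a" "1 *\<^sub>R a = a"
    by (transfer, simp add: algebra_simps)+
  show "(norm a = 0) = (a = 0)" "norm (r *\<^sub>R a) = \<bar>r\<bar> * norm a"
    by (transfer, simp)+
  show "norm (a + b) \<le> norm a + norm b" by transfer (rule norm_triangle_ineq)
  show "norm (a * b) \<le> norm a * norm b" by transfer (rule norm_blinfun_compose)
  show "norm (1 :: 'a endo) = 1" by transfer simp
  show "a * b * c = a * (b * c)" by transfer (rule blinfun_eqI, simp)
  show "(a + b) * c = a * c + b * c" "a * (b + c) = a * b + a * c"
    by (transfer, rule blinfun_eqI, simp add: blinfun.bilinear_simps)+
  show "r *\<^sub>R a * b = r *\<^sub>R (a * b)" "a * r *\<^sub>R b = r *\<^sub>R (a * b)"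
    by (transfer, rule blinfun_eqI, simp add: blinfun.bilinear_simps)+
  show "1 * a = a" "a * 1 = a" by (transfer, rule blinfun_eqI, simp)+
  show "(0 :: 'a endo) \<noteq> 1"
  proof transfer
    have "norm (id_blinfun :: 'a \<Rightarrow>\<^sub>L 'a) = 1" by simp
    then show "(0 :: 'a \<Rightarrow>\<^sub>L 'a) \<noteq> id_blinfun" by (metis norm_zero zero_neq_one)
  qed
qed

end

lemma dist_endo_blinfun: "dist (endo_blinfun f) (endo_blinfun g) = dist f g"
  by (simp add: dist_endo.rep_eq)

instance endo :: (euclidean_space) banach
proof
  fix X :: "nat \<Rightarrow> 'a endo" assume "Cauchy X"
  then have "Cauchy (\<lambda>n. endo_blinfun (X n))" by (simp add: Cauchy_def dist_endo_blinfun)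
  then obtain L where "(\<lambda>n. endo_blinfun (X n)) \<longlonglongrightarrow> L"
    using Cauchy_convergent convergent_def by blast
  then have "X \<longlonglongrightarrow> Endo L"
    by (simp add: lim_sequentially dist_endo.rep_eq Endo_inverse)
  then show "convergent X" by (auto simp: convergent_def)
qed

text \<open>Finite dimension enters here: bounded sequences of endomorphisms acquire convergent
  subsequences, on which the limiting arguments for \<open>K\<close> rest.\<close>

instance endo :: (euclidean_space) heine_borel
proof
  fix f :: "nat \<Rightarrow> 'a endo" assume "bounded (range f)"
  then obtain B where "\<And>n. norm (f n) \<le> B" by (auto simp: bounded_iff)
  then have "bounded (range (\<lambda>n. endo_blinfun (f n)))"
    by (auto simp: bounded_iff norm_endo.rep_eq)
  then obtain l r where r: "strict_mono r" "((\<lambda>n. endo_blinfun (f n)) \<circ> r) \<longlonglongrightarrow> l"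
    using bounded_imp_convergent_subsequence by blast
  then have "(f \<circ> r) \<longlonglongrightarrow> Endo l"
    by (simp add: lim_sequentially dist_endo.rep_eq Endo_inverse)
  with r show "\<exists>l r. strict_mono r \<and> (f \<circ> r) \<longlonglongrightarrow> l" by blast
qed

lift_definition endo_apply :: "'v::euclidean_space endo \<Rightarrow> 'v \<Rightarrow> 'v" (infixr "\<star>" 75) is blinfun_apply .

lift_definition endo_of :: "('v::euclidean_space \<Rightarrow> 'v) \<Rightarrow> 'v endo" is Blinfun .

lemma endo_of_apply: "linear f \<Longrightarrow> endo_of f \<star> v = f v"
  by transfer (simp add: bounded_linear_Blinfun_apply linear_conv_bounded_linear)

lemma endo_eqI: "(\<And>v. A \<star> v = B \<star> v) \<Longrightarrow> A = B"
  by transfer (rule blinfun_eqI)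

lemma endo_mult_apply [simp]: "(A * B) \<star> v = A \<star> B \<star> v"
  by transfer simp

lemma endo_one_apply [simp]: "1 \<star> v = v"
  by transfer simp

lemma bounded_bilinear_endo_apply: "bounded_bilinear (\<star>)"
proof
  fix A B :: "'a endo" and v w :: 'a and r :: real
  show "(A + B) \<star> v = A \<star> v + B \<star> v" "A \<star> (v + w) = A \<star> v + A \<star> w"
    "(r *\<^sub>R A) \<star> v = r *\<^sub>R (A \<star> v)" "A \<star> (r *\<^sub>R v) = r *\<^sub>R (A \<star> v)"
    by (transfer, simp add: blinfun.bilinear_simps)+
  have "norm (A \<star> v) \<le> norm A * norm v * 1" for A :: "'a endo" and v
    by transfer (simp add: norm_blinfun)
  then show "\<exists>K. \<forall>(A::'a endo) v. norm (A \<star> v) \<le> norm A * norm v * K" by blast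
qed

interpretation endo: bounded_bilinear "(\<star>)"
  by (rule bounded_bilinear_endo_apply)

lemma linear_endo_apply: "linear ((\<star>) A)"
  using endo.bounded_linear_right bounded_linear.linear by blast

lemma norm_endo_le:
  assumes "\<And>v. norm (A \<star> v) \<le> norm v" shows "norm A \<le> 1"
  using assms by transfer (auto intro: norm_blinfun_bound)

lemma exp_scaleR_add: "exp ((s + t) *\<^sub>R X) = exp (s *\<^sub>R X) * exp (t *\<^sub>R (X :: 'v::euclidean_space endo))"
  by (simp add: scaleR_add_left exp_add_commuting)

lemma exp_scaleR_minus_mult:
  "exp (- t *\<^sub>R X) * exp (t *\<^sub>R (X :: 'v::euclidean_space endo)) = 1"
  "exp (t *\<^sub>R X) * exp (- t *\<^sub>R (X :: 'v::euclidean_space endo)) = 1"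
  using exp_scaleR_add[of "-t" t X] exp_scaleR_add[of t "-t" X] by simp_all

lemma exp_endo_has_vector_derivative:
  "((\<lambda>t. exp (t *\<^sub>R X) \<star> v) has_vector_derivative X \<star> exp (t *\<^sub>R X) \<star> v) (at t)"
proof -
  have "((\<lambda>t. exp (t *\<^sub>R X)) has_vector_derivative X * exp (t *\<^sub>R X)) (at t)"
    by (rule exp_scaleR_has_vector_derivative_left)
  from bounded_linear.has_vector_derivative[OF endo.bounded_linear_left this, of v]
  show ?thesis by simp
qed

lemma has_vector_derivative_quotient_seq:
  assumes f: "(f has_vector_derivative D) (at 0)" and s: "s \<longlonglongrightarrow> 0" "\<And>n. s n \<noteq> 0"
  shows "(\<lambda>n. (f (s n) - f 0) /\<^sub>R s n) \<longlonglongrightarrow> D"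
proof -
  have "((\<lambda>h. norm (f (0 + h) - f 0 - h *\<^sub>R D) / norm h) \<longlongrightarrow> 0) (at 0)"
    using f unfolding has_vector_derivative_def has_derivative_at by blast
  moreover have "filterlim s (at 0) sequentially"
    using s by (simp add: filterlim_at)
  ultimately have "((\<lambda>n. norm (f (0 + s n) - f 0 - s n *\<^sub>R D) / norm (s n)) \<longlongrightarrow> 0) sequentially"
    by (rule filterlim_compose)
  moreover have "norm (f (0 + s n) - f 0 - s n *\<^sub>R D) / norm (s n) = norm ((f (s n) - f 0) /\<^sub>R s n - D)" for n
  proof -
    have "(f (s n) - f 0) /\<^sub>R s n - D = (f (0 + s n) - f 0 - s n *\<^sub>R D) /\<^sub>R s n"
      using s(2)[of n] by (simp add: algebra_simps)
    then show ?thesis by (simp add: divide_inverse mult.commute)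
  qed
  ultimately have "(\<lambda>n. norm ((f (s n) - f 0) /\<^sub>R s n - D)) \<longlonglongrightarrow> 0" by simp
  then show ?thesis by (simp add: tendsto_norm_zero_iff LIM_zero_iff)
qed

lemma exp_quotient_tendsto:
  fixes X :: "'v::euclidean_space endo"
  assumes "s \<longlonglongrightarrow> 0" "\<And>n. s n \<noteq> 0"
  shows "(\<lambda>n. (exp (s n *\<^sub>R X) - 1) /\<^sub>R s n) \<longlonglongrightarrow> X"
proof -
  have "((\<lambda>t. exp (t *\<^sub>R X)) has_vector_derivative X * exp (0 *\<^sub>R X)) (at 0)"
    by (rule exp_scaleR_has_vector_derivative_left)
  from has_vector_derivative_quotient_seq[OF this assms] show ?thesis by simp
qed

lemma exp_scaleR_power: "exp ((real m * s) *\<^sub>R X) = exp (s *\<^sub>R (X :: 'v::euclidean_space endo)) ^ m"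
  by (induction m) (simp_all add: distrib_right exp_scaleR_add)

text \<open>The partial sums of the exponential series stay in \<open>S\<close>, and a subspace of a
  Euclidean space is closed.\<close>

lemma exp_endo_subspace:
  assumes S: "subspace S" and X: "\<And>v. v \<in> S \<Longrightarrow> X \<star> v \<in> S" and v: "v \<in> S"
  shows "exp (t *\<^sub>R X) \<star> v \<in> S"
proof -
  have pow: "(t *\<^sub>R X) ^ n \<star> v \<in> S" for n
  proof (induction n)
    case (Suc n)
    have "(t *\<^sub>R X) ^ Suc n \<star> v = t *\<^sub>R (X \<star> ((t *\<^sub>R X) ^ n \<star> v))"
      by (simp add: endo.scaleR_left del: scaleR_power)
    with Suc show ?case using X[OF Suc] S by (simp add: subspace_mul del: scaleR_power power_Suc)
  qed (use v in simp)
  have "(\<lambda>n. ((t *\<^sub>R X) ^ n /\<^sub>R fact n) \<star> v) sums (exp (t *\<^sub>R X) \<star> v)"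
    by (rule bounded_linear.sums[OF endo.bounded_linear_left exp_converges])
  then have "(\<lambda>n. \<Sum>i<n. ((t *\<^sub>R X) ^ i /\<^sub>R fact i) \<star> v) \<longlonglongrightarrow> exp (t *\<^sub>R X) \<star> v"
    by (simp add: sums_def)
  moreover have "(\<Sum>i<n. ((t *\<^sub>R X) ^ i /\<^sub>R fact i) \<star> v) \<in> S" for n
    by (intro subspace_sum S) (simp add: endo.scaleR_left subspace_mul[OF S] pow del: scaleR_power)
  ultimately show ?thesis
    using closed_sequentially[OF closed_subspace[OF S], of "\<lambda>n. \<Sum>i<n. ((t *\<^sub>R X) ^ i /\<^sub>R fact i) \<star> v"]
    by blast
qed

text \<open>Telescoping. As \<open>a\<close> is a contraction, only powers of \<open>b\<close>
  contribute to the growth; \<open>b\<close> will be \<open>exp (s X)\<close>, whose norm is bounded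
  by a number slightly above 1.\<close>

lemma norm_power_diff_le:
  fixes a b :: "'a::real_normed_algebra_1"
  assumes "norm a \<le> 1" "norm b \<le> B" "1 \<le> B"
  shows "norm (a ^ m - b ^ m) \<le> real m * norm (a - b) * B ^ m"
proof (induction m)
  case (Suc m)
  have "a ^ Suc m - b ^ Suc m = a * (a ^ m - b ^ m) + (a - b) * b ^ m"
    by (simp add: algebra_simps)
  also have "norm \<dots> \<le> norm a * norm (a ^ m - b ^ m) + norm (a - b) * norm (b ^ m)"
    by (intro norm_triangle_mono norm_mult_ineq)
  also have "\<dots> \<le> 1 * (real m * norm (a - b) * B ^ m) + norm (a - b) * B ^ m"
    using order_trans[OF norm_power_ineq power_mono[OF assms(2) norm_ge_zero]]
    by (intro add_mono mult_mono Suc.IH assms(1)) auto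
  also have "\<dots> = real (Suc m) * norm (a - b) * B ^ m" by (simp add: algebra_simps)
  also have "\<dots> \<le> real (Suc m) * norm (a - b) * B ^ Suc m"
    using assms(3) by (intro mult_left_mono power_increasing) auto
  finally show ?case .
qed simp

text \<open>\<open>h n\<close> and \<open>exp (s n X)\<close> agree up to an error that is small
  compared with \<open>s n\<close>. Taking about \<open>t / s n\<close> powers multiplies this error
  by at most a bounded multiple of \<open>1 / s n\<close>, so it still tends to zero.\<close>

lemma power_tendsto_exp:
  fixes X :: "'v::euclidean_space endo"
  assumes h: "\<And>n. norm (h n) \<le> 1" and s: "\<And>n. s n > 0" "s \<longlonglongrightarrow> 0"
    and lim: "(\<lambda>n. (h n - 1) /\<^sub>R s n) \<longlonglongrightarrow> X" and t: "t \<ge> 0"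
  shows "(\<lambda>n. h n ^ nat \<lfloor>t / s n\<rfloor>) \<longlonglongrightarrow> exp (t *\<^sub>R X)"
proof -
  define m where "m n = nat \<lfloor>t / s n\<rfloor>" for n
  have m: "real (m n) \<le> t / s n" "t / s n < real (m n) + 1" for n
    using t s(1)[of n] unfolding m_def by (simp_all add: divide_nonneg_pos of_nat_nat)
  have ms: "real (m n) * s n \<le> t" "t < real (m n) * s n + s n" for n
    using m[of n] s(1)[of n] by (simp_all add: field_simps)
  have "(\<lambda>n. real (m n) * s n) \<longlonglongrightarrow> t"
  proof (rule tendsto_sandwich)
    show "(\<lambda>n. t - s n) \<longlonglongrightarrow> t" using tendsto_diff[OF tendsto_const s(2)] by simp
    show "(\<lambda>n. t) \<longlonglongrightarrow> t" by simp
  qed (use ms in \<open>auto simp: algebra_simps less_imp_le intro!: always_eventually\<close>)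
  then have 1: "(\<lambda>n. exp ((real (m n) * s n) *\<^sub>R X)) \<longlonglongrightarrow> exp (t *\<^sub>R X)"
    by (rule isCont_tendsto_compose[rotated])
      (rule has_vector_derivative_continuous[OF exp_scaleR_has_vector_derivative_left])
  \<comment> \<open>The factor in front does not depend on \<open>n\<close>: since
    \<open>m n * s n\<close> is at most \<open>t\<close>, both the accumulated error and the
    exponential growth are controlled by \<open>t\<close>.\<close>
  have bd: "norm (h n ^ m n - exp (s n *\<^sub>R X) ^ m n)
      \<le> t * exp (t * norm X) * norm ((h n - 1) /\<^sub>R s n - (exp (s n *\<^sub>R X) - 1) /\<^sub>R s n)" for n
  proof -
    have "norm (exp (s n *\<^sub>R X)) \<le> exp (s n * norm X)"
      using norm_exp[of "s n *\<^sub>R X"] s(1)[of n] by simp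
    moreover have "1 \<le> exp (s n * norm X)" using s(1)[of n] by simp
    ultimately have "norm (h n ^ m n - exp (s n *\<^sub>R X) ^ m n)
        \<le> real (m n) * norm (h n - exp (s n *\<^sub>R X)) * exp (s n * norm X) ^ m n"
      by (intro norm_power_diff_le h)
    also have "\<dots> \<le> real (m n) * norm (h n - exp (s n *\<^sub>R X)) * exp (t * norm X)"
    proof (rule mult_left_mono)
      have "exp (s n * norm X) ^ m n = exp ((real (m n) * s n) * norm X)"
        by (simp add: exp_of_nat_mult[symmetric] mult.assoc)
      also have "\<dots> \<le> exp (t * norm X)" using ms(1)[of n] by (simp add: mult_right_mono)
      finally show "exp (s n * norm X) ^ m n \<le> exp (t * norm X)" .
    qed simp
    also have "\<dots> \<le> (t / s n * norm (h n - exp (s n *\<^sub>R X))) * exp (t * norm X)"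
      by (intro mult_right_mono m(1)) simp_all
    also have "t / s n * norm (h n - exp (s n *\<^sub>R X)) = t * norm ((h n - exp (s n *\<^sub>R X)) /\<^sub>R s n)"
      using s(1)[of n] by (simp add: divide_inverse mult_ac)
    also have "(h n - exp (s n *\<^sub>R X)) /\<^sub>R s n = (h n - 1) /\<^sub>R s n - (exp (s n *\<^sub>R X) - 1) /\<^sub>R s n"
      by (simp add: algebra_simps)
    finally show ?thesis by (simp only: mult_ac)
  qed
  have "(\<lambda>n. (h n - 1) /\<^sub>R s n - (exp (s n *\<^sub>R X) - 1) /\<^sub>R s n) \<longlonglongrightarrow> X - X"
    by (intro tendsto_diff lim exp_quotient_tendsto s) (use s(1) in \<open>simp add: less_imp_neq[symmetric]\<close>)
  then have "(\<lambda>n. norm ((h n - 1) /\<^sub>R s n - (exp (s n *\<^sub>R X) - 1) /\<^sub>R s n)) \<longlonglongrightarrow> 0"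
    using tendsto_norm_zero by force
  from tendsto_mult_right_zero[OF this, of "t * exp (t * norm X)"]
  have "(\<lambda>n. h n ^ m n - exp (s n *\<^sub>R X) ^ m n) \<longlonglongrightarrow> 0"
    by (rule Lim_null_comparison[rotated]) (auto intro!: always_eventually bd)
  from tendsto_add[OF this 1[unfolded exp_scaleR_power]] show ?thesis by (simp add: m_def)
qed

subsection \<open>Compact groups of orthogonal transformations\<close>

lemma closed_orthogonal_comp: "closed (orthogonal_comp (S :: 'a::euclidean_space set))"
  by (rule closed_subspace) (rule subspace_orthogonal_comp)

lemma dim_orthogonal_comp:
  assumes "subspace (S :: 'a::euclidean_space set)"
  shows "dim (orthogonal_comp S) + dim S = DIM('a)"
proof -
  have "orthogonal_comp S = {y \<in> UNIV. \<forall>x\<in>S. orthogonal x y}" by (auto simp: orthogonal_comp_def)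
  then show ?thesis
    using dim_subspace_orthogonal_to_vectors[OF assms subspace_UNIV] by simp
qed

locale orth_group =
  fixes K :: "'v::euclidean_space endo set"
  assumes compact_K: "compact K" and one_K: "1 \<in> K"
    and mult_K: "\<And>A B. A \<in> K \<Longrightarrow> B \<in> K \<Longrightarrow> A * B \<in> K"
    and ex_inv_K: "\<And>A. A \<in> K \<Longrightarrow> \<exists>B\<in>K. A * B = 1 \<and> B * A = 1"
    and norm_K: "\<And>A v. A \<in> K \<Longrightarrow> norm (A \<star> v) = norm v"
begin

definition inv_K :: "'v endo \<Rightarrow> 'v endo" where
  "inv_K A = (SOME B. B \<in> K \<and> A * B = 1 \<and> B * A = 1)"

lemma inv_K: assumes "A \<in> K" shows "inv_K A \<in> K" "A * inv_K A = 1" "inv_K A * A = 1"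
proof -
  from ex_inv_K[OF assms] have "\<exists>B. B \<in> K \<and> A * B = 1 \<and> B * A = 1" by blast
  from someI_ex[OF this] show "inv_K A \<in> K" "A * inv_K A = 1" "inv_K A * A = 1"
    unfolding inv_K_def by auto
qed

lemma inv_K_apply: assumes "A \<in> K" shows "A \<star> inv_K A \<star> v = v" "inv_K A \<star> A \<star> v = v"
  using inv_K[OF assms] by (metis endo_mult_apply endo_one_apply)+

lemma inner_K: "A \<in> K \<Longrightarrow> (A \<star> u) \<bullet> (A \<star> w) = u \<bullet> w"
  using orthogonal_transformation[of "(\<star>) A"] norm_K[of A] linear_endo_apply
  by (auto simp: orthogonal_transformation_def)

lemma norm_K_le: "A \<in> K \<Longrightarrow> norm A \<le> 1"
  by (rule norm_endo_le) (simp add: norm_K)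

lemma closed_K: "closed K"
  using compact_K compact_imp_closed by blast

lemma power_K: "A \<in> K \<Longrightarrow> A ^ n \<in> K"
  by (induction n) (auto simp: one_K mult_K)

definition lie :: "'v endo set" where
  "lie = {X. \<forall>t. exp (t *\<^sub>R X) \<in> K}"

lemma exp_lie: "X \<in> lie \<Longrightarrow> exp (t *\<^sub>R X) \<in> K"
  by (simp add: lie_def)

text \<open>The core of the closed subgroup theorem: \<open>exp (t X)\<close> is a limit of powers
  of the \<open>h n\<close> and so lies in the closed set \<open>K\<close>; negative
  \<open>t\<close> are reached by inverses.\<close>

lemma lie_limit:
  assumes h: "\<And>n. h n \<in> K" and s: "\<And>n. s n > 0" "s \<longlonglongrightarrow> 0"
    and lim: "(\<lambda>n. (h n - 1) /\<^sub>R s n) \<longlonglongrightarrow> X"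
  shows "X \<in> lie"
proof -
  have pos: "exp (t *\<^sub>R X) \<in> K" if "t \<ge> 0" for t
    using closed_sequentially[OF closed_K _ power_tendsto_exp[OF norm_K_le[OF h] s lim that]] h
    by (auto simp: power_K)
  have "exp (t *\<^sub>R X) \<in> K" for t
  proof (cases "t \<ge> 0")
    case False
    then have p: "exp (- t *\<^sub>R X) \<in> K" using pos[of "- t"] by simp
    have "exp (t *\<^sub>R X) = (inv_K (exp (- t *\<^sub>R X)) * exp (- t *\<^sub>R X)) * exp (t *\<^sub>R X)"
      using inv_K(3)[OF p] by simp
    also have "\<dots> = inv_K (exp (- t *\<^sub>R X))"
      unfolding mult.assoc exp_scaleR_minus_mult by simp
    finally show ?thesis using inv_K(1)[OF p] by simp
  qed (use pos in blast)
  then show ?thesis by (simp add: lie_def)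
qed

text \<open>The curve may be any curve in \<open>K\<close> through 1, not only a one-parameter
  group. Sums and conjugates of elements of \<open>lie\<close> are obtained from it as velocities of
  products.\<close>

lemma lie_derivative:
  assumes "\<And>t. c t \<in> K" "c 0 = 1" "(c has_vector_derivative X) (at 0)"
  shows "X \<in> lie"
proof (rule lie_limit[of "\<lambda>n. c (inverse (real (Suc n)))"])
  show "(\<lambda>n. inverse (real (Suc n))) \<longlonglongrightarrow> 0" by (rule LIMSEQ_inverse_real_of_nat)
  show "(\<lambda>n. (c (inverse (real (Suc n))) - 1) /\<^sub>R inverse (real (Suc n))) \<longlonglongrightarrow> X"
    using has_vector_derivative_quotient_seq[OF assms(3) LIMSEQ_inverse_real_of_nat] assms(2) by simp
qed (use assms(1) in auto)

lemma subspace_lie: "subspace lie"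
proof (rule subspaceI)
  show "0 \<in> lie" by (simp add: lie_def one_K)
  show "r *\<^sub>R X \<in> lie" if "X \<in> lie" for r X using that by (simp add: lie_def)
  fix X Y assume XY: "X \<in> lie" "Y \<in> lie"
  have "((\<lambda>t. exp (t *\<^sub>R X) * exp (t *\<^sub>R Y)) has_vector_derivative
      exp (0 *\<^sub>R X) * (Y * exp (0 *\<^sub>R Y)) + (X * exp (0 *\<^sub>R X)) * exp (0 *\<^sub>R Y)) (at 0)"
    by (intro has_vector_derivative_mult exp_scaleR_has_vector_derivative_left)
  then show "X + Y \<in> lie"
    by (intro lie_derivative[of "\<lambda>t. exp (t *\<^sub>R X) * exp (t *\<^sub>R Y)"])
      (simp_all add: XY mult_K exp_lie add.commute)
qed

lemma lie_conj:
  assumes "A \<in> K" "X \<in> lie" shows "A * X * inv_K A \<in> lie"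
proof (rule lie_derivative[of "\<lambda>t. A * exp (t *\<^sub>R X) * inv_K A"])
  have "((\<lambda>t. A * (exp (t *\<^sub>R X) * inv_K A)) has_vector_derivative A * ((X * exp (0 *\<^sub>R X)) * inv_K A)) (at 0)"
    by (intro bounded_linear.has_vector_derivative[OF bounded_linear_mult_right]
        bounded_linear.has_vector_derivative[OF bounded_linear_mult_left]
        exp_scaleR_has_vector_derivative_left)
  then show "((\<lambda>t. A * exp (t *\<^sub>R X) * inv_K A) has_vector_derivative A * X * inv_K A) (at 0)"
    by (simp add: mult.assoc)
qed (use assms in \<open>auto simp: mult_K exp_lie inv_K\<close>)

lemma lie_skew:
  assumes "X \<in> lie" shows "(X \<star> u) \<bullet> w = - (u \<bullet> (X \<star> w))"
proof -
  have "((\<lambda>t. (exp (t *\<^sub>R X) \<star> u) \<bullet> (exp (t *\<^sub>R X) \<star> w)) has_vector_derivative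
      (exp (0 *\<^sub>R X) \<star> u) \<bullet> (X \<star> exp (0 *\<^sub>R X) \<star> w) + (X \<star> exp (0 *\<^sub>R X) \<star> u) \<bullet> (exp (0 *\<^sub>R X) \<star> w)) (at 0)"
    by (intro bounded_bilinear.has_vector_derivative[OF bounded_bilinear_inner]
        exp_endo_has_vector_derivative)
  moreover have "((\<lambda>t. (exp (t *\<^sub>R X) \<star> u) \<bullet> (exp (t *\<^sub>R X) \<star> w)) has_vector_derivative 0) (at 0)"
    by (simp add: inner_K exp_lie assms)
  ultimately have "(exp (0 *\<^sub>R X) \<star> u) \<bullet> (X \<star> exp (0 *\<^sub>R X) \<star> w) + (X \<star> exp (0 *\<^sub>R X) \<star> u) \<bullet> (exp (0 *\<^sub>R X) \<star> w) = 0"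
    by (rule vector_derivative_unique_at)
  then show ?thesis by simp
qed

definition stab :: "'v \<Rightarrow> 'v endo set" where
  "stab p = {A \<in> K. A \<star> p = p}"

lemma stab_K: "A \<in> stab p \<Longrightarrow> A \<in> K" and stab_apply: "A \<in> stab p \<Longrightarrow> A \<star> p = p"
  by (auto simp: stab_def)

lemma one_stab: "1 \<in> stab p"
  by (simp add: stab_def one_K)

lemma mult_stab: "A \<in> stab p \<Longrightarrow> B \<in> stab p \<Longrightarrow> A * B \<in> stab p"
  by (simp add: stab_def mult_K)

lemma inv_stab: "A \<in> stab p \<Longrightarrow> inv_K A \<in> stab p"
  using inv_K(1)[of A] inv_K_apply(2)[of A p] by (auto simp: stab_def)

lemma compact_stab: "compact (stab p)"
proof -
  have "stab p = K \<inter> (\<lambda>A. A \<star> p) -` {p}" by (auto simp: stab_def)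
  moreover have "closed ((\<lambda>A. A \<star> p) -` {p})"
    by (intro closed_vimage closed_singleton linear_continuous_on endo.bounded_linear_left)
  ultimately show ?thesis using compact_Int_closed[OF compact_K] by simp
qed

text \<open>Meant as the tangent space of the orbit at \<open>p\<close>; the identification with
  \<open>tangent_space\<close> is \<open>tangent_space_orb\<close>.\<close>

definition tan_space :: "'v \<Rightarrow> 'v set" where
  "tan_space p = (\<lambda>X. X \<star> p) ` lie"

definition nor_space :: "'v \<Rightarrow> 'v set" where
  "nor_space p = orthogonal_comp (tan_space p)"

lemma subspace_tan: "subspace (tan_space p)"
  unfolding tan_space_def
  by (intro linear_subspace_image bounded_linear.linear[OF endo.bounded_linear_left] subspace_lie)

lemma subspace_nor: "subspace (nor_space p)"
  by (simp add: nor_space_def subspace_orthogonal_comp)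

lemma nor_tan: "x \<in> nor_space p \<Longrightarrow> y \<in> tan_space p \<Longrightarrow> x \<bullet> y = 0"
  using orthogonal_compD[of x "tan_space p" y] by (simp add: nor_space_def inner_commute)

lemma nor_K:
  assumes "A \<in> K" "x \<in> nor_space p" shows "A \<star> x \<in> nor_space (A \<star> p)"
  unfolding nor_space_def
proof (rule orthogonal_compI)
  fix y assume "y \<in> tan_space (A \<star> p)"
  then obtain X where X: "X \<in> lie" "y = X \<star> A \<star> p" by (auto simp: tan_space_def)
  have "inv_K A * X * inv_K (inv_K A) \<in> lie" by (rule lie_conj) (use assms X inv_K in auto)
  moreover have "inv_K (inv_K A) = A"
    using inv_K[OF assms(1)] inv_K[OF inv_K(1)[OF assms(1)]] by (metis mult.assoc mult_1_left mult_1_right)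
  ultimately have "inv_K A \<star> y \<in> tan_space p" unfolding X(2) tan_space_def
    by (intro image_eqI[of _ _ "inv_K A * X * A"]) simp_all
  from nor_tan[OF assms(2) this] inner_K[OF assms(1), of x "inv_K A \<star> y"]
  show "y \<bullet> (A \<star> x) = 0" by (simp add: inv_K_apply assms(1) inner_commute)
qed

lemma nor_stab: "A \<in> stab p \<Longrightarrow> x \<in> nor_space p \<Longrightarrow> A \<star> x \<in> nor_space p"
  using nor_K[of A x p] by (simp add: stab_K stab_apply)

lemma tan_K:
  assumes "A \<in> K" "x \<in> tan_space p" shows "A \<star> x \<in> tan_space (A \<star> p)"
proof -
  obtain X where X: "X \<in> lie" "x = X \<star> p" using assms(2) by (auto simp: tan_space_def)
  have "A \<star> x = (A * X * inv_K A) \<star> A \<star> p" by (simp add: X(2) inv_K_apply assms(1))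
  then show ?thesis using lie_conj[OF assms(1) X(1)] unfolding tan_space_def by blast
qed

text \<open>Orbits lie in spheres around the origin. This is what later makes sections linear
  subspaces and not merely affine ones.\<close>

lemma self_nor: "p \<in> nor_space p"
  unfolding nor_space_def
proof (rule orthogonal_compI)
  fix y assume "y \<in> tan_space p"
  then obtain X where X: "X \<in> lie" "y = X \<star> p" by (auto simp: tan_space_def)
  show "y \<bullet> p = 0" using lie_skew[OF X(1), of p p] by (simp add: X(2) inner_commute)
qed

lemma exp_fix:
  assumes "X \<star> p = 0" shows "exp (t *\<^sub>R X) \<star> (p :: 'v) = p"
proof -
  have "((\<lambda>t. exp (t *\<^sub>R X) \<star> p) has_vector_derivative 0) (at t within UNIV)" for t
  proof -
    have "((\<lambda>t. exp (t *\<^sub>R X) \<star> p) has_vector_derivative (exp (t *\<^sub>R X) * X) \<star> p) (at t)"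
      by (rule bounded_linear.has_vector_derivative[OF endo.bounded_linear_left
            exp_scaleR_has_vector_derivative_right])
    then show ?thesis by (simp add: assms endo.zero_right)
  qed
  then obtain c where "\<And>t. exp (t *\<^sub>R X) \<star> p = c"
    using has_vector_derivative_zero_constant[of UNIV "\<lambda>t. exp (t *\<^sub>R X) \<star> p"] by auto
  from this[of t] this[of 0] show ?thesis by simp
qed

text \<open>The elements \<open>a n\<close> are corrected by elements of the isotropy group so that they are as close
  to the identity as possible. If the limit direction \<open>X\<close> killed \<open>p\<close>, then multiplication with
  \<open>exp (- s n X)\<close> would bring them even closer.\<close>

lemma orbit_direction:
  assumes a: "\<And>n. a n \<in> K" and ap: "(\<lambda>n. a n \<star> p) \<longlonglongrightarrow> p" and ne: "\<And>n. a n \<star> p \<noteq> p"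
  obtains r h s X where "strict_mono (r :: nat \<Rightarrow> nat)" "\<And>n. h n \<in> stab p" "\<And>n. s n > (0::real)"
    "s \<longlonglongrightarrow> 0" "X \<in> lie" "X \<star> p \<noteq> 0" "(\<lambda>n. (a (r n) * h n - 1) /\<^sub>R s n) \<longlonglongrightarrow> X"
proof -
  obtain g r1 where g: "g \<in> K" and r1: "strict_mono r1" "(a \<circ> r1) \<longlonglongrightarrow> g"
    using compact_imp_seq_compact[OF compact_K] a unfolding seq_compact_def by blast
  have "(\<lambda>n. (a \<circ> r1) n \<star> p) \<longlonglongrightarrow> g \<star> p"
    by (rule endo.tendsto[OF r1(2) tendsto_const])
  moreover have "(\<lambda>n. (a \<circ> r1) n \<star> p) \<longlonglongrightarrow> p"
    using LIMSEQ_subseq_LIMSEQ[OF ap r1(1)] by (simp add: o_def)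
  ultimately have gp: "g \<in> stab p" using LIMSEQ_unique g by (auto simp: stab_def)
  have "\<exists>h\<in>stab p. \<forall>k\<in>stab p. norm (a n * h - 1) \<le> norm (a n * k - 1)" for n
  proof (rule continuous_attains_inf[OF compact_stab])
    show "stab p \<noteq> {}" using one_stab by blast
  qed (intro continuous_intros)
  then obtain h where h: "\<And>n. h n \<in> stab p"
    and hmin: "\<And>n k. k \<in> stab p \<Longrightarrow> norm (a n * h n - 1) \<le> norm (a n * k - 1)" by metis
  define b where "b n = a (r1 n) * h (r1 n)" for n
  define s where "s n = norm (b n - 1)" for n
  have bK: "b n \<in> K" for n by (simp add: b_def mult_K a stab_K[OF h])
  have spos: "s n > 0" for n
  proof -
    have "b n \<star> p \<noteq> p" by (simp add: b_def stab_apply[OF h] ne)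
    then have "b n \<noteq> 1" by auto
    then show ?thesis by (simp add: s_def)
  qed
  \<comment> \<open>The limit \<open>g\<close> fixes \<open>p\<close>, so \<open>inv_K g\<close>
    competes in the minimisation that defines \<open>h\<close> and forces the distances
    \<open>s n\<close> to zero.\<close>
  have "(\<lambda>n. (a \<circ> r1) n * inv_K g - 1) \<longlonglongrightarrow> g * inv_K g - 1"
    by (intro tendsto_intros r1)
  then have "(\<lambda>n. norm ((a \<circ> r1) n * inv_K g - 1)) \<longlonglongrightarrow> 0"
    using inv_K(2)[OF g] tendsto_norm by fastforce
  then have s0: "s \<longlonglongrightarrow> 0"
    by (rule Lim_null_comparison[rotated])
      (auto intro!: always_eventually hmin inv_stab gp simp: s_def b_def)
  have "bounded (range (\<lambda>n. (b n - 1) /\<^sub>R s n))"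
    unfolding bounded_iff by (rule exI[of _ 1]) (use spos in \<open>auto simp: s_def\<close>)
  then obtain X r2 where r2: "strict_mono r2" "((\<lambda>n. (b n - 1) /\<^sub>R s n) \<circ> r2) \<longlonglongrightarrow> X"
    using bounded_imp_convergent_subsequence by blast
  define s' where "s' n = s (r2 n)" for n
  define b' where "b' n = b (r2 n)" for n
  have lim: "(\<lambda>n. (b' n - 1) /\<^sub>R s' n) \<longlonglongrightarrow> X" using r2(2) by (simp add: o_def b'_def s'_def)
  have s': "\<And>n. s' n > 0" "s' \<longlonglongrightarrow> 0"
    using spos LIMSEQ_subseq_LIMSEQ[OF s0 r2(1)] by (auto simp: s'_def[abs_def] o_def)
  have X: "X \<in> lie" using lie_limit[OF _ s' lim] bK by (simp add: b'_def)
  have "X \<star> p \<noteq> 0"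
  proof
    assume Xp: "X \<star> p = 0"
    define e where "e n = exp (s' n *\<^sub>R (- X))" for n
    have e: "e n \<in> stab p" for n
      using exp_fix[OF Xp, of "- s' n"] exp_lie[OF X, of "- s' n"] by (simp add: stab_def e_def)
    have elim: "(\<lambda>n. (e n - 1) /\<^sub>R s' n) \<longlonglongrightarrow> - X"
      unfolding e_def by (rule exp_quotient_tendsto[OF s'(2)]) (use s'(1) in \<open>simp add: less_imp_neq[symmetric]\<close>)
    have "(\<lambda>n. s' n *\<^sub>R ((e n - 1) /\<^sub>R s' n) + 1) \<longlonglongrightarrow> 0 *\<^sub>R (- X) + 1"
      by (intro tendsto_intros s' elim)
    moreover have "s' n *\<^sub>R ((e n - 1) /\<^sub>R s' n) + 1 = e n" for n using s'(1)[of n] by simp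
    ultimately have e1: "e \<longlonglongrightarrow> 1" by simp
    \<comment> \<open>The first-order terms \<open>X\<close> and \<open>- X\<close> cancel in the
      limit, whereas minimality of \<open>h\<close> keeps the norm of the combined quotient at least
      1.\<close>
    have "(\<lambda>n. ((b' n - 1) /\<^sub>R s' n) * e n + (e n - 1) /\<^sub>R s' n) \<longlonglongrightarrow> X * 1 + - X"
      by (intro tendsto_intros lim e1 elim)
    moreover have "((b' n - 1) /\<^sub>R s' n) * e n + (e n - 1) /\<^sub>R s' n = (b' n * e n - 1) /\<^sub>R s' n" for n
      by (simp add: scaleR_add_right[symmetric] left_diff_distrib)
    ultimately have "(\<lambda>n. (b' n * e n - 1) /\<^sub>R s' n) \<longlonglongrightarrow> 0" by simp
    from tendsto_norm[OF this] have "(\<lambda>n. norm ((b' n * e n - 1) /\<^sub>R s' n)) \<longlonglongrightarrow> 0" by simp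
    moreover have "norm ((b' n * e n - 1) /\<^sub>R s' n) \<ge> 1" for n
    proof -
      have "norm (b' n - 1) \<le> norm (b' n * e n - 1)"
        unfolding b'_def b_def mult.assoc by (intro hmin mult_stab h e)
      then have "s' n \<le> norm (b' n * e n - 1)" by (simp add: s'_def b'_def s_def)
      then show ?thesis using s'(1)[of n] by (simp add: norm_scaleR inverse_eq_divide del: scaleR_diff_right real_scaleR_def)
    qed
    ultimately show False
      using LIMSEQ_le_const[of _ 0 1] by fastforce
  qed
  show thesis
  proof (rule that[of "r1 \<circ> r2" "\<lambda>n. h (r1 (r2 n))" s' X])
    show "strict_mono (r1 \<circ> r2)" using r1(1) r2(1) by (simp add: strict_mono_o)
    show "(\<lambda>n. (a ((r1 \<circ> r2) n) * h (r1 (r2 n)) - 1) /\<^sub>R s' n) \<longlonglongrightarrow> X"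
      using lim by (simp add: b'_def b_def)
  qed (use h s' X \<open>X \<star> p \<noteq> 0\<close> in auto)
qed

text \<open>The displacements of \<open>p\<close> divided by \<open>t n\<close> tend to
  \<open>v\<close>. Along a subsequence the same displacements, divided by the scale from
  \<open>orbit_direction\<close>, tend to a nonzero \<open>X p\<close>. Both scales are positive, so
  a nonzero \<open>v\<close> is a multiple of \<open>X p\<close>.\<close>

lemma tan_velocity:
  assumes a: "\<And>n. a n \<in> K" and t: "\<And>n. t n > 0" "t \<longlonglongrightarrow> 0"
    and v: "(\<lambda>n. (a n \<star> p - p) /\<^sub>R t n) \<longlonglongrightarrow> v"
  shows "v \<in> tan_space p"
proof (cases "v = 0")
  case True then show ?thesis using subspace_0[OF subspace_tan] by simp
next
  case False
  have "(\<lambda>n. t n *\<^sub>R ((a n \<star> p - p) /\<^sub>R t n) + p) \<longlonglongrightarrow> 0 *\<^sub>R v + p"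
    by (intro tendsto_intros t v)
  moreover have "t n *\<^sub>R ((a n \<star> p - p) /\<^sub>R t n) + p = a n \<star> p" for n using t(1)[of n] by simp
  ultimately have ap: "(\<lambda>n. a n \<star> p) \<longlonglongrightarrow> p" by simp
  have "eventually (\<lambda>n. (a n \<star> p - p) /\<^sub>R t n \<noteq> 0) sequentially"
    using tendsto_imp_eventually_ne[OF v False] .
  then obtain N where N: "\<And>n. n \<ge> N \<Longrightarrow> a n \<star> p \<noteq> p" by (auto simp: eventually_sequentially)
  obtain r h s X where r: "strict_mono (r :: nat \<Rightarrow> nat)" and h: "\<And>n. h n \<in> stab p"
    and s: "\<And>n. s n > (0::real)" "s \<longlonglongrightarrow> 0" and X: "X \<in> lie" "X \<star> p \<noteq> 0"
    and lim: "(\<lambda>n. (a (r n + N) * h n - 1) /\<^sub>R s n) \<longlonglongrightarrow> X"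
    by (rule orbit_direction[of "\<lambda>n. a (n + N)" p])
      (use a N LIMSEQ_ignore_initial_segment[OF ap, of N] in auto)
  define q where "q n = a (r n + N) \<star> p - p" for n
  define t' where "t' n = t (r n + N)" for n
  have t': "t' n > 0" for n by (simp add: t'_def t)
  have "(\<lambda>n. ((a (r n + N) * h n - 1) /\<^sub>R s n) \<star> p) \<longlonglongrightarrow> X \<star> p"
    by (rule endo.tendsto[OF lim tendsto_const])
  then have qs: "(\<lambda>n. q n /\<^sub>R s n) \<longlonglongrightarrow> X \<star> p"
    by (simp add: endo.scaleR_left endo.diff_left stab_apply[OF h] q_def)
  have qt: "(\<lambda>n. q n /\<^sub>R t' n) \<longlonglongrightarrow> v"
    using LIMSEQ_subseq_LIMSEQ[OF LIMSEQ_ignore_initial_segment[OF v, of N] r]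
    by (simp add: o_def q_def t'_def)
  have q0: "q n \<noteq> 0" for n by (simp add: q_def N)
  have "(\<lambda>n. (norm (q n /\<^sub>R s n) / norm (q n /\<^sub>R t' n)) *\<^sub>R (q n /\<^sub>R t' n)) \<longlonglongrightarrow> (norm (X \<star> p) / norm v) *\<^sub>R v"
    by (intro tendsto_intros qs qt) (use False in simp)
  moreover have "(norm (q n /\<^sub>R s n) / norm (q n /\<^sub>R t' n)) *\<^sub>R (q n /\<^sub>R t' n) = q n /\<^sub>R s n" for n
    using s(1)[of n] t'[of n] q0[of n] by simp
  ultimately have "(\<lambda>n. q n /\<^sub>R s n) \<longlonglongrightarrow> (norm (X \<star> p) / norm v) *\<^sub>R v" by (simp only:)
  then have "X \<star> p = (norm (X \<star> p) / norm v) *\<^sub>R v" by (rule LIMSEQ_unique[OF qs])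
  then have "(norm v / norm (X \<star> p)) *\<^sub>R (X \<star> p) = (norm v / norm (X \<star> p) * (norm (X \<star> p) / norm v)) *\<^sub>R v"
    by (metis scaleR_scaleR)
  then have "v = (norm v / norm (X \<star> p)) *\<^sub>R (X \<star> p)" using False X(2) by simp
  also have "\<dots> \<in> tan_space p"
    by (intro subspace_mul subspace_tan) (use X(1) in \<open>auto simp: tan_space_def\<close>)
  finally show ?thesis .
qed

text \<open>If no \<open>a n\<close> fixed \<open>p\<close>, then \<open>orbit_direction\<close>
  would give an \<open>X\<close> with \<open>X p\<close> nonzero. The scaled differences of slice
  vectors are normal and converge to \<open>X p\<close>, which is tangential: a
  contradiction.\<close>

lemma slice:
  assumes a: "\<And>n. a n \<in> K" and xi: "\<And>n. \<xi> n \<in> nor_space p" "\<And>n. \<xi>' n \<in> nor_space p"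
    and xi0: "\<xi> \<longlonglongrightarrow> 0" "\<xi>' \<longlonglongrightarrow> 0" and eq: "\<And>n. a n \<star> (p + \<xi>' n) = p + \<xi> n"
  shows "\<exists>n. a n \<star> p = p"
proof (rule ccontr)
  assume "\<not> ?thesis"
  then have ne: "a n \<star> p \<noteq> p" for n by blast
  have "(\<lambda>n. norm (a n \<star> \<xi>' n)) \<longlonglongrightarrow> 0"
    using tendsto_norm[OF xi0(2)] by (simp add: norm_K[OF a])
  then have "(\<lambda>n. p + \<xi> n - a n \<star> \<xi>' n) \<longlonglongrightarrow> p + 0 - 0"
    by (intro tendsto_intros xi0) (simp add: tendsto_norm_zero_iff)
  moreover have "p + \<xi> n - a n \<star> \<xi>' n = a n \<star> p" for n
    using eq[of n] by (simp add: endo.add_right algebra_simps)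
  ultimately have ap: "(\<lambda>n. a n \<star> p) \<longlonglongrightarrow> p" by simp
  obtain r h s X where r: "strict_mono (r :: nat \<Rightarrow> nat)" and h: "\<And>n. h n \<in> stab p"
    and s: "\<And>n. s n > (0::real)" "s \<longlonglongrightarrow> 0" and X: "X \<in> lie" "X \<star> p \<noteq> 0"
    and lim: "(\<lambda>n. (a (r n) * h n - 1) /\<^sub>R s n) \<longlonglongrightarrow> X"
    by (rule orbit_direction[OF a ap ne]) blast
  \<comment> \<open>The isotropy corrections \<open>h n\<close> are absorbed into the slice vectors,
    which stay normal because the isotropy group preserves the normal space.\<close>
  define \<eta> where "\<eta> n = inv_K (h n) \<star> \<xi>' (r n)" for n
  have eta: "\<eta> n \<in> nor_space p" for n unfolding \<eta>_def by (intro nor_stab inv_stab h xi)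
  have xr: "(\<lambda>n. \<xi> (r n)) \<longlonglongrightarrow> 0" "(\<lambda>n. \<xi>' (r n)) \<longlonglongrightarrow> 0"
    using LIMSEQ_subseq_LIMSEQ[OF _ r] xi0 by (auto simp: o_def)
  have "(\<lambda>n. norm (\<eta> n)) \<longlonglongrightarrow> 0"
    using tendsto_norm[OF xr(2)] by (simp add: \<eta>_def norm_K inv_K stab_K[OF h])
  then have eta0: "\<eta> \<longlonglongrightarrow> 0" by (simp add: tendsto_norm_zero_iff)
  have "(\<lambda>n. ((a (r n) * h n - 1) /\<^sub>R s n) \<star> (p + \<eta> n)) \<longlonglongrightarrow> X \<star> (p + 0)"
    by (intro endo.tendsto lim tendsto_intros eta0)
  moreover have "((a (r n) * h n - 1) /\<^sub>R s n) \<star> (p + \<eta> n) = (\<xi> (r n) - \<eta> n) /\<^sub>R s n" for n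
  proof -
    have "h n \<star> (p + \<eta> n) = p + \<xi>' (r n)"
      by (simp add: endo.add_right stab_apply[OF h] \<eta>_def inv_K_apply stab_K[OF h])
    then have "(a (r n) * h n) \<star> (p + \<eta> n) = p + \<xi> (r n)" by (simp add: eq)
    then show ?thesis by (simp add: endo.scaleR_left endo.diff_left)
  qed
  ultimately have "(\<lambda>n. (\<xi> (r n) - \<eta> n) /\<^sub>R s n) \<longlonglongrightarrow> X \<star> p" by simp
  moreover have "(\<xi> (r n) - \<eta> n) /\<^sub>R s n \<in> nor_space p" for n
    by (intro subspace_mul subspace_diff subspace_nor xi eta)
  ultimately have "X \<star> p \<in> nor_space p"
    using closed_sequentially[OF closed_orthogonal_comp[of "tan_space p"],
        where f = "\<lambda>n. (\<xi> (r n) - \<eta> n) /\<^sub>R s n"]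
    unfolding nor_space_def by blast
  moreover have "X \<star> p \<in> tan_space p" using X(1) by (auto simp: tan_space_def)
  ultimately have "(X \<star> p) \<bullet> (X \<star> p) = 0" by (rule nor_tan)
  then show False using X(2) by simp
qed

end

section \<open>Slices, principal isotropy groups and regular points\<close>

context orth_group
begin

lemma seq_of_radii:
  assumes "\<And>e. e > 0 \<Longrightarrow> \<exists>x. P x \<and> norm (x :: 'v) < e"
  obtains f where "\<forall>n. P (f n)" "f \<longlonglongrightarrow> 0"
proof -
  have "\<exists>x. P x \<and> norm x < inverse (real (Suc n))" for n
    by (rule assms) simp
  then obtain f where f: "\<And>n. P (f n)" "\<And>n. norm (f n) < inverse (real (Suc n))" by metis
  have "f \<longlonglongrightarrow> 0"
    by (rule Lim_null_comparison[OF _ LIMSEQ_inverse_real_of_nat])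
      (use f(2) in \<open>auto intro!: always_eventually less_imp_le simp del: of_nat_Suc\<close>)
  with f(1) show thesis by (intro that allI)
qed

text \<open>\<open>slice\<close> with all source vectors zero. It forces the normal coordinate of
  orbit points near \<open>p\<close> to vanish in \<open>local_orbit_section\<close>.\<close>

lemma normal_slice_isolated:
  "\<exists>e>0. \<forall>\<xi>\<in>nor_space p. norm \<xi> < e \<longrightarrow> p + \<xi> \<in> (\<lambda>A. A \<star> p) ` K \<longrightarrow> \<xi> = 0"
proof (rule ccontr)
  assume c: "\<not> ?thesis"
  have "\<exists>\<xi>. (\<xi> \<in> nor_space p \<and> \<xi> \<noteq> 0 \<and> (\<exists>A\<in>K. A \<star> p = p + \<xi>)) \<and> norm \<xi> < e" if "e > 0" for e
  proof -
    have "\<not> (\<forall>\<xi>\<in>nor_space p. norm \<xi> < e \<longrightarrow> p + \<xi> \<in> (\<lambda>A. A \<star> p) ` K \<longrightarrow> \<xi> = 0)"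
      using c that by blast
    then obtain \<xi> where "\<xi> \<in> nor_space p" "norm \<xi> < e" "p + \<xi> \<in> (\<lambda>A. A \<star> p) ` K" "\<xi> \<noteq> 0" by blast
    then show ?thesis by (intro exI[of _ \<xi>]) (auto simp: image_iff)
  qed
  then obtain f where f: "\<forall>n. f n \<in> nor_space p \<and> f n \<noteq> 0 \<and> (\<exists>A\<in>K. A \<star> p = p + f n)" "f \<longlonglongrightarrow> 0"
    by (rule seq_of_radii)
  then obtain a where a: "\<And>n. a n \<in> K" "\<And>n. a n \<star> p = p + f n" by metis
  have "\<exists>n. a n \<star> p = p"
    by (rule slice[where \<xi> = f and \<xi>' = "\<lambda>n. 0"]) (use a f subspace_0[OF subspace_nor] in auto)
  then show False using a(2) f(1) by auto
qed

text \<open>\<open>slice\<close> with equal source and target vectors.\<close>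

lemma slice_stab:
  "\<exists>e>0. \<forall>\<xi>\<in>nor_space p. norm \<xi> < e \<longrightarrow> stab (p + \<xi>) \<subseteq> stab p"
proof (rule ccontr)
  assume c: "\<not> ?thesis"
  have "\<exists>\<xi>. (\<xi> \<in> nor_space p \<and> (\<exists>A\<in>stab (p + \<xi>). A \<star> p \<noteq> p)) \<and> norm \<xi> < e" if "e > 0" for e
  proof -
    have "\<not> (\<forall>\<xi>\<in>nor_space p. norm \<xi> < e \<longrightarrow> stab (p + \<xi>) \<subseteq> stab p)"
      using c that by blast
    then obtain \<xi> A where "\<xi> \<in> nor_space p" "norm \<xi> < e" "A \<in> stab (p + \<xi>)" "A \<notin> stab p" by blast
    then show ?thesis by (intro exI[of _ \<xi>]) (auto simp: stab_def)
  qed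
  then obtain f where f: "\<forall>n. f n \<in> nor_space p \<and> (\<exists>A\<in>stab (p + f n). A \<star> p \<noteq> p)" "f \<longlonglongrightarrow> 0"
    by (rule seq_of_radii)
  then obtain a where a: "\<And>n. a n \<in> stab (p + f n)" "\<And>n. a n \<star> p \<noteq> p" by metis
  have "\<exists>n. a n \<star> p = p"
    by (rule slice[where \<xi> = f and \<xi>' = f])
      (use f in \<open>auto intro: stab_K[OF a(1)] stab_apply[OF a(1)]\<close>)
  then show False using a(2) by auto
qed

lemma norm_mult_K: assumes "A \<in> K" shows "norm (B * A) = norm B"
proof (rule antisym)
  have le: "norm (C * D) \<le> norm C" if "D \<in> K" for C D
    using order_trans[OF norm_mult_ineq mult_left_mono[OF norm_K_le[OF that] norm_ge_zero]] by simp
  show "norm (B * A) \<le> norm B" by (rule le[OF assms])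
  show "norm B \<le> norm (B * A)"
    using le[OF inv_K(1)[OF assms], of "B * A"] by (simp add: mult.assoc inv_K(2)[OF assms])
qed

text \<open>Powers of an element of a compact group return arbitrarily close to the identity, so a
  compact subgroup cannot be conjugate to a proper subgroup of itself.\<close>

lemma conj_subset_eq:
  assumes H: "H \<subseteq> K" "closed H" and c: "c \<in> K" and sub: "\<And>h. h \<in> H \<Longrightarrow> c * h * inv_K c \<in> H"
    and h: "h \<in> H"
  shows "inv_K c * h * c \<in> H"
proof -
  obtain L r where r: "strict_mono r" "((\<lambda>n. c ^ n) \<circ> r) \<longlonglongrightarrow> L"
    using compact_imp_seq_compact[OF compact_K] power_K[OF c] unfolding seq_compact_def by blast
  \<comment> \<open>Gaps between successive indices of a convergent subsequence: as \<open>c\<close>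
    is isometric, \<open>c ^ m n\<close> is as close to 1 as consecutive terms are to each
    other.\<close>
  define m where "m n = r (Suc n) - r n" for n
  have m: "r (Suc n) = m n + r n" "m n \<ge> 1" for n
    using r(1) by (auto simp: m_def strict_mono_Suc_iff less_imp_le Suc_le_eq)
  have "(\<lambda>n. c ^ r (Suc n) - c ^ r n) \<longlonglongrightarrow> L - L"
    using r(2) LIMSEQ_Suc[of "\<lambda>n. c ^ r n"] by (intro tendsto_diff) (simp_all add: o_def)
  moreover have "norm (c ^ m n - 1) = norm (c ^ r (Suc n) - c ^ r n)" for n
    using norm_mult_K[OF power_K[OF c], of "c ^ m n - 1" "r n"]
    by (simp add: m(1) power_add left_diff_distrib)
  ultimately have N0: "(\<lambda>n. norm (c ^ m n - 1)) \<longlonglongrightarrow> 0" using tendsto_norm_zero by fastforce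
  then have c1: "(\<lambda>n. c ^ m n) \<longlonglongrightarrow> 1" by (simp add: tendsto_norm_zero_iff LIM_zero_iff)
  have conj: "c ^ n * h * inv_K c ^ n \<in> H" for n
  proof (induction n)
    case (Suc n)
    have "c ^ Suc n * h * inv_K c ^ Suc n = c * (c ^ n * h * inv_K c ^ n) * inv_K c"
      by (simp only: power_Suc2[of "inv_K c"] power_Suc[of c] mult.assoc)
    with sub[OF Suc] show ?case by simp
  qed (use h in simp)
  have inv: "c ^ n * inv_K c ^ n = 1" for n
  proof (induction n)
    case (Suc n)
    have "c ^ Suc n * inv_K c ^ Suc n = c * (c ^ n * inv_K c ^ n) * inv_K c"
      by (simp only: power_Suc2[of "inv_K c"] power_Suc[of c] mult.assoc)
    with Suc show ?case by (simp add: inv_K(2)[OF c])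
  qed simp
  have eq: "norm (c ^ m n - 1) = norm (inv_K c ^ m n - 1)" for n
  proof -
    have "(c ^ m n - 1) * inv_K c ^ m n = - (inv_K c ^ m n - 1)" by (simp add: left_diff_distrib inv)
    then show ?thesis using norm_mult_K[OF power_K[OF inv_K(1)[OF c]], of "c ^ m n - 1" "m n"]
      by (metis norm_minus_cancel)
  qed
  from N0[unfolded eq] have c2: "(\<lambda>n. inv_K c ^ m n) \<longlonglongrightarrow> 1"
    by (simp add: tendsto_norm_zero_iff LIM_zero_iff)
  have "(\<lambda>n. inv_K c * (c ^ m n * h * inv_K c ^ m n) * c) \<longlonglongrightarrow> inv_K c * (1 * h * 1) * c"
    by (intro tendsto_mult tendsto_const c1 c2)
  moreover have "inv_K c * (c ^ m n * h * inv_K c ^ m n) * c \<in> H" for n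
  proof -
    \<comment> \<open>As \<open>m n\<close> is positive, one factor \<open>c\<close> cancels on each
      side and leaves the conjugate of \<open>h\<close> by a nonnegative power, which is in
      \<open>H\<close>.\<close>
    obtain k where k: "m n = Suc k" using m(2)[of n] by (cases "m n") auto
    have "inv_K c * (c ^ m n * h * inv_K c ^ m n) * c
        = (inv_K c * c) * (c ^ k * h * inv_K c ^ k) * (inv_K c * c)"
      unfolding k by (simp only: power_Suc2[of "inv_K c"] power_Suc[of c] mult.assoc)
    with conj[of k] show ?thesis by (simp add: inv_K(3)[OF c])
  qed
  ultimately show ?thesis using closed_sequentially[OF H(2),
      where f = "\<lambda>n. inv_K c * (c ^ m n * h * inv_K c ^ m n) * c"] by simp
qed

text \<open>Conjugates of isotropy groups appear as isotropy groups of translated points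
  \<open>g \<star> q\<close>; the equivalence with \<open>G_regular\<close> is
  \<open>G_regular_iff\<close>.\<close>

definition regular :: "'v \<Rightarrow> bool" where
  "regular p \<longleftrightarrow> (\<forall>q. \<exists>g\<in>K. stab p \<subseteq> stab (g \<star> q))"

lemma stab_conj:
  assumes "g \<in> K" shows "h \<in> stab (g \<star> q) \<longleftrightarrow> h \<in> K \<and> inv_K g * h * g \<in> stab q"
proof -
  have "h \<star> g \<star> q = g \<star> q \<longleftrightarrow> inv_K g \<star> h \<star> g \<star> q = q"
  proof
    assume "h \<star> g \<star> q = g \<star> q"
    then show "inv_K g \<star> h \<star> g \<star> q = q" by (simp add: inv_K_apply assms)
  next
    assume "inv_K g \<star> h \<star> g \<star> q = q"
    then have "g \<star> inv_K g \<star> h \<star> g \<star> q = g \<star> q" by simp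
    then show "h \<star> g \<star> q = g \<star> q" by (simp only: inv_K_apply assms)
  qed
  then show ?thesis using mult_K inv_K(1)[OF assms] assms by (auto simp: stab_def)
qed

lemma inv_K_inv_K: "g \<in> K \<Longrightarrow> inv_K (inv_K g) = g"
  using inv_K[of g] inv_K[of "inv_K g"] by (metis mult.assoc mult_1_left mult_1_right)

lemma stab_closed: "closed (stab p)"
  using compact_stab compact_imp_closed by blast

lemma stab_subset_conj_eq:
  assumes g: "g \<in> K" and sub: "stab p \<subseteq> stab (g \<star> p)" shows "stab (g \<star> p) = stab p"
proof
  have "inv_K (inv_K g) * h * inv_K g \<in> stab p" if "h \<in> stab p" for h
  proof (rule conj_subset_eq[OF _ stab_closed inv_K(1)[OF g] _ that])
    show "stab p \<subseteq> K" by (auto simp: stab_def)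
    show "inv_K g * h * inv_K (inv_K g) \<in> stab p" if "h \<in> stab p" for h
      using sub that stab_conj[OF g] by (auto simp: inv_K_inv_K g)
  qed
  then have 1: "g * h * inv_K g \<in> stab p" if "h \<in> stab p" for h using that by (simp add: inv_K_inv_K g)
  show "stab (g \<star> p) \<subseteq> stab p"
  proof
    fix h assume "h \<in> stab (g \<star> p)"
    then have "inv_K g * h * g \<in> stab p" using stab_conj[OF g] by blast
    from 1[OF this] have "(g * inv_K g) * h * (g * inv_K g) \<in> stab p" by (simp only: mult.assoc)
    then show "h \<in> stab p" by (simp add: inv_K(2)[OF g])
  qed
qed (rule sub)

text \<open>For a small normal vector \<open>\<xi>\<close> the isotropy group of
  \<open>p + \<xi>\<close> lies in that of \<open>p\<close> by \<open>slice_stab\<close>, and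
  regularity gives an inclusion in the other direction up to conjugation. No compact subgroup is
  conjugate to a proper subgroup of itself, so the two groups agree and fix \<open>\<xi>\<close>,
  hence every multiple of it.\<close>

lemma regular_fix_nor:
  assumes p: "regular p" and h: "h \<in> stab p" and x: "x \<in> nor_space p"
  shows "h \<star> x = x"
proof -
  obtain e where e: "e > 0" "\<And>\<xi>. \<xi> \<in> nor_space p \<Longrightarrow> norm \<xi> < e \<Longrightarrow> stab (p + \<xi>) \<subseteq> stab p"
    using slice_stab by blast
  \<comment> \<open>The summand 1 in the denominator covers \<open>x = 0\<close>; the factor 2
    leaves room for a strict inequality.\<close>
  define \<xi> where "\<xi> = (e / (2 * (norm x + 1))) *\<^sub>R x"
  have c: "e / (2 * (norm x + 1)) > 0" using e(1) by (simp add: add_nonneg_pos)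
  have "norm \<xi> = e * (norm x / (2 * (norm x + 1)))" using e(1) by (simp add: \<xi>_def add_nonneg_pos)
  also have "\<dots> < e * 1"
    by (intro mult_strict_left_mono e(1)) (use norm_ge_zero[of x] in \<open>simp add: divide_less_eq add_nonneg_pos\<close>)
  finally have small: "norm \<xi> < e" by simp
  have xi: "\<xi> \<in> nor_space p" unfolding \<xi>_def by (intro subspace_mul subspace_nor x)
  obtain g where g: "g \<in> K" "stab p \<subseteq> stab (g \<star> (p + \<xi>))" using p unfolding regular_def by blast
  have sub: "stab (p + \<xi>) \<subseteq> stab p" by (rule e(2)[OF xi small])
  have "stab p \<subseteq> stab (g \<star> p)"
  proof
    fix k assume "k \<in> stab p"
    then have "k \<in> stab (g \<star> (p + \<xi>))" using g(2) by blast
    then show "k \<in> stab (g \<star> p)" using stab_conj[OF g(1)] sub by blast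
  qed
  from stab_subset_conj_eq[OF g(1) this] have eq: "stab (g \<star> p) = stab p" .
  \<comment> \<open>By the equality just shown, the conjugate of \<open>h\<close> lies in
    \<open>stab p\<close> and therefore fixes \<open>g \<star> (p + \<xi>)\<close>; conjugating
    back, \<open>h\<close> fixes \<open>p + \<xi>\<close>.\<close>
  have "g * h * inv_K g \<in> stab (g \<star> p)"
  proof -
    have "inv_K g * (g * h * inv_K g) * g = (inv_K g * g) * h * (inv_K g * g)"
      by (simp only: mult.assoc)
    then have "inv_K g * (g * h * inv_K g) * g \<in> stab p" using h by (simp add: inv_K(3)[OF g(1)])
    then show ?thesis using stab_conj[OF g(1)] h g(1) by (simp add: mult_K inv_K stab_K)
  qed
  then have "g * h * inv_K g \<in> stab (g \<star> (p + \<xi>))" using eq g(2) by blast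
  then have "inv_K g * (g * h * inv_K g) * g \<in> stab (p + \<xi>)" using stab_conj[OF g(1)] by blast
  moreover have "inv_K g * (g * h * inv_K g) * g = (inv_K g * g) * h * (inv_K g * g)"
    by (simp only: mult.assoc)
  ultimately have "h \<star> (p + \<xi>) = p + \<xi>" by (simp add: inv_K(3)[OF g(1)] stab_apply)
  then have "h \<star> \<xi> = \<xi>" using stab_apply[OF h] by (simp add: endo.add_right)
  then have "(e / (2 * (norm x + 1))) *\<^sub>R (h \<star> x) = (e / (2 * (norm x + 1))) *\<^sub>R x"
    unfolding \<xi>_def endo.scaleR_right .
  then show ?thesis by (rule scaleR_left_imp_eq[rotated]) (use c in linarith)
qed

lemma regular_K: assumes "regular p" "g \<in> K" shows "regular (g \<star> p)"
  unfolding regular_def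
proof
  fix q
  obtain a where a: "a \<in> K" "stab p \<subseteq> stab (a \<star> q)" using assms(1) unfolding regular_def by blast
  have "stab (g \<star> p) \<subseteq> stab (g \<star> a \<star> q)"
    using stab_conj[OF assms(2)] a(2) by blast
  then show "\<exists>g'\<in>K. stab (g \<star> p) \<subseteq> stab (g' \<star> q)"
    by (intro bexI[of _ "g * a"]) (simp_all add: mult_K assms a)
qed

lemma lie_stab_subset:
  assumes "stab p \<subseteq> stab q" "X \<in> lie" "X \<star> p = 0" shows "X \<star> q = 0"
proof -
  have "exp (t *\<^sub>R X) \<star> q = q" for t
    using exp_fix[OF assms(3), of t] exp_lie[OF assms(2), of t] assms(1) by (auto simp: stab_def)
  then have "((\<lambda>t. exp (t *\<^sub>R X) \<star> q) has_vector_derivative 0) (at 0)" by simp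
  with exp_endo_has_vector_derivative[of X q 0] have "X \<star> exp (0 *\<^sub>R X) \<star> q = 0"
    by (rule vector_derivative_unique_at)
  then show ?thesis by simp
qed

text \<open>\<open>f\<close> is the differential at \<open>p\<close> of the equivariant map between
  orbits sending \<open>A p\<close> to \<open>A q\<close>, which the inclusion of isotropy groups
  makes well defined. It is constructed by linear extension from a basis instead of by
  differentiation.\<close>

lemma tan_transfer:
  assumes sub: "stab p \<subseteq> stab q"
  obtains f where "linear f" "\<forall>X\<in>lie. f (X \<star> p) = X \<star> q"
proof -
  obtain B where B: "B \<subseteq> tan_space p" "independent B" "tan_space p \<subseteq> span B"
    by (rule basis_exists[of "tan_space p"])
  have "\<forall>b\<in>B. \<exists>X. X \<in> lie \<and> b = X \<star> p"
  proof
    fix b assume "b \<in> B"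
    then have "b \<in> (\<lambda>X. X \<star> p) ` lie" using B(1) unfolding tan_space_def by (rule subsetD[rotated])
    then show "\<exists>X. X \<in> lie \<and> b = X \<star> p" by (elim imageE) (intro exI conjI)
  qed
  from bchoice[OF this] obtain Y where Y0: "\<forall>b\<in>B. Y b \<in> lie \<and> b = Y b \<star> p" ..
  have Y: "Y b \<in> lie" "b = Y b \<star> p" if "b \<in> B" for b
    by (rule conjunct1[OF bspec[OF Y0 that]], rule conjunct2[OF bspec[OF Y0 that]])
  obtain f where f0: "linear f \<and> (\<forall>b\<in>B. f b = Y b \<star> q)"
    using linear_independent_extend[OF B(2), of "\<lambda>b. Y b \<star> q"] ..
  have f: "linear f" "\<And>b. b \<in> B \<Longrightarrow> f b = Y b \<star> q" using f0 by simp_all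
  have uniq: "X \<star> q = Z \<star> q" if "X \<in> lie" "Z \<in> lie" "X \<star> p = Z \<star> p" for X Z
  proof -
    have "(X - Z) \<star> q = 0"
      by (rule lie_stab_subset[OF sub subspace_diff[OF subspace_lie that(1,2)]])
        (simp add: endo.diff_left that(3))
    then show ?thesis by (simp add: endo.diff_left)
  qed
  \<comment> \<open>The vectors on which \<open>f\<close> takes the right value form a subspace, so
    it is enough to find the basis \<open>B\<close> in it.\<close>
  define U where "U = {u. \<exists>X\<in>lie. u = X \<star> p \<and> f u = X \<star> q}"
  have "subspace U"
  proof (rule subspaceI)
    show "0 \<in> U" unfolding U_def
      using subspace_0[OF subspace_lie] linear_0[OF f(1)]
      by (intro CollectI bexI[of _ 0]) (auto simp: endo.zero_left)
    fix x y and c :: real assume "x \<in> U"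
    then obtain X where X: "X \<in> lie" "x = X \<star> p" "f x = X \<star> q" by (auto simp: U_def)
    have "c *\<^sub>R X \<in> lie" by (intro subspace_mul subspace_lie X)
    then show "c *\<^sub>R x \<in> U" unfolding U_def
      by (intro CollectI bexI[of _ "c *\<^sub>R X"]) (simp_all add: endo.scaleR_left linear_cmul[OF f(1)] X(3) flip: X(2))
    assume "y \<in> U"
    then obtain Z where Z: "Z \<in> lie" "y = Z \<star> p" "f y = Z \<star> q" by (auto simp: U_def)
    have "X + Z \<in> lie" by (intro subspace_add subspace_lie X Z)
    then show "x + y \<in> U" unfolding U_def
      by (intro CollectI bexI[of _ "X + Z"])
        (simp_all add: endo.add_left linear_add[OF f(1)] X(3) Z(3) flip: X(2) Z(2))
  qed
  moreover have "B \<subseteq> U"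
  proof
    fix b assume b: "b \<in> B"
    show "b \<in> U" unfolding U_def
      by (intro CollectI bexI[of _ "Y b"] conjI Y(1)[OF b] Y(2)[OF b] f(2)[OF b])
  qed
  ultimately have "span B \<subseteq> U" by (simp add: span_minimal)
  have "f (X \<star> p) = X \<star> q" if X: "X \<in> lie" for X
  proof -
    have "X \<star> p \<in> U" using B(3) \<open>span B \<subseteq> U\<close> X by (auto simp: tan_space_def)
    then obtain Z where Z: "Z \<in> lie" "X \<star> p = Z \<star> p" "f (X \<star> p) = Z \<star> q" by (auto simp: U_def)
    show ?thesis unfolding Z(3) by (rule uniq[OF X Z(1,2), symmetric])
  qed
  with f(1) show thesis by (intro that ballI)
qed

lemma dim_tan_K:
  assumes "g \<in> K" shows "dim (tan_space (g \<star> p)) = dim (tan_space p)"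
proof -
  have le: "dim (tan_space p) \<le> dim (tan_space (g \<star> p))" if "g \<in> K" for g p
  proof -
    have "inj ((\<star>) g)" using inv_K_apply(2)[OF that] by (rule inj_on_inverseI)
    then have "dim ((\<star>) g ` tan_space p) = dim (tan_space p)"
      by (intro dim_image_eq linear_endo_apply) (auto intro: inj_on_subset)
    moreover have "(\<star>) g ` tan_space p \<subseteq> tan_space (g \<star> p)" using tan_K[OF that] by blast
    then have "dim ((\<star>) g ` tan_space p) \<le> dim (tan_space (g \<star> p))" by (rule dim_subset)
    ultimately show ?thesis by simp
  qed
  show ?thesis using le[OF assms, of p] le[OF inv_K(1)[OF assms], of "g \<star> p"] inv_K_apply(2)[OF assms] by simp
qed

text \<open>The transfer map from one regular point to a suitable translate of the other is onto;
  exchanging the roles gives equality.\<close>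

lemma dim_tan_regular:
  assumes "regular p" "regular q" shows "dim (tan_space p) = dim (tan_space q)"
proof -
  have "dim (tan_space q) \<le> dim (tan_space p)" if pq: "regular p" for p q
  proof -
    obtain g where g: "g \<in> K" "stab p \<subseteq> stab (g \<star> q)" using pq unfolding regular_def by blast
    obtain f where f: "linear f" "\<forall>X\<in>lie. f (X \<star> p) = X \<star> g \<star> q"
      by (rule tan_transfer[OF g(2)])
    have "tan_space (g \<star> q) = f ` tan_space p"
      unfolding tan_space_def image_image by (rule image_cong) (use f(2) in auto)
    then show ?thesis using dim_image_le[OF f(1), of "tan_space p"] dim_tan_K[OF g(1), of q] by simp
  qed
  then show ?thesis using assms by (intro antisym) blast+
qed

text \<open>At a maximiser of the inner product \<open>(A \<star> q) \<bullet> p\<close> the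
  derivative vanishes along every one-parameter curve that stays in \<open>Q\<close>. The set
  \<open>Q\<close> is kept general because it is taken to be \<open>K\<close> as well as the
  stabiliser of a subspace.\<close>

lemma critical_point:
  assumes Q: "compact Q" "Q \<noteq> {}"
  shows "\<exists>h\<in>Q. \<forall>X. (\<forall>t. exp (t *\<^sub>R X) * h \<in> Q) \<longrightarrow> (X \<star> h \<star> q) \<bullet> p = 0"
proof -
  have "continuous_on Q (\<lambda>A. (A \<star> q) \<bullet> p)"
    by (intro continuous_intros linear_continuous_on endo.bounded_linear_left)
  then obtain h where h: "h \<in> Q" "\<And>k. k \<in> Q \<Longrightarrow> (k \<star> q) \<bullet> p \<le> (h \<star> q) \<bullet> p"
    using continuous_attains_sup[OF Q] by blast
  have "(X \<star> h \<star> q) \<bullet> p = 0" if X: "\<And>t. exp (t *\<^sub>R X) * h \<in> Q" for X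
  proof (rule DERIV_local_max[of "\<lambda>t. (exp (t *\<^sub>R X) \<star> h \<star> q) \<bullet> p" _ 0 1])
    have "((\<lambda>t. (exp (t *\<^sub>R X) \<star> h \<star> q) \<bullet> p) has_vector_derivative (X \<star> exp (0 *\<^sub>R X) \<star> h \<star> q) \<bullet> p) (at 0)"
      by (rule bounded_linear.has_vector_derivative[OF bounded_linear_inner_left exp_endo_has_vector_derivative])
    then show "((\<lambda>t. (exp (t *\<^sub>R X) \<star> h \<star> q) \<bullet> p) has_field_derivative (X \<star> h \<star> q) \<bullet> p) (at 0)"
      by (simp add: has_real_derivative_iff_has_vector_derivative)
    show "\<forall>y. \<bar>0 - y\<bar> < 1 \<longrightarrow> (exp (y *\<^sub>R X) \<star> h \<star> q) \<bullet> p \<le> (exp (0 *\<^sub>R X) \<star> h \<star> q) \<bullet> p"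
      using h(2)[OF X] by simp
  qed simp
  with h(1) show ?thesis by blast
qed

text \<open>A point of the orbit of \<open>q\<close> that is nearest to \<open>p\<close>,
  equivalently one of largest inner product with \<open>p\<close>, lies in the normal space:
  criticality and skewness make it orthogonal to all \<open>X p\<close>.\<close>

lemma orbit_meets_nor: "\<exists>g\<in>K. g \<star> q \<in> nor_space p"
proof -
  obtain h where h: "h \<in> K" "\<And>X. (\<forall>t. exp (t *\<^sub>R X) * h \<in> K) \<Longrightarrow> (X \<star> h \<star> q) \<bullet> p = 0"
    using critical_point[OF compact_K, of q p] one_K by blast
  have "h \<star> q \<in> nor_space p" unfolding nor_space_def
  proof (rule orthogonal_compI)
    fix y assume "y \<in> tan_space p"
    then obtain X where X: "X \<in> lie" "y = X \<star> p" by (auto simp: tan_space_def)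
    have "(X \<star> h \<star> q) \<bullet> p = 0" using h X by (simp add: mult_K exp_lie)
    with lie_skew[OF X(1), of "h \<star> q" p] show "y \<bullet> (h \<star> q) = 0" by (simp add: X(2) inner_commute)
  qed
  with h(1) show ?thesis by blast
qed

end

lemma null_sequence_below:
  assumes "e > (0::real)"
  obtains s where "s \<longlonglongrightarrow> 0" "\<And>n. s n > 0" "\<And>n. s n < e"
proof (rule that[of "\<lambda>n. e * inverse (real (Suc (Suc n)))"])
  have "(\<lambda>n. e * inverse (real (Suc (Suc n)))) \<longlonglongrightarrow> e * 0"
    using LIMSEQ_Suc[OF LIMSEQ_inverse_real_of_nat] by (intro tendsto_intros)
  then show "(\<lambda>n. e * inverse (real (Suc (Suc n)))) \<longlonglongrightarrow> 0" by simp
qed (use assms in \<open>auto simp: field_simps add_pos_nonneg\<close>)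

lemma derivative_in_subspace:
  fixes c :: "real \<Rightarrow> 'a::euclidean_space"
  assumes S: "subspace S" and e: "e > 0" "\<And>t. \<bar>t\<bar> < e \<Longrightarrow> c t \<in> S"
    and c: "(c has_vector_derivative v) (at 0)"
  shows "v \<in> S"
proof -
  obtain s where s0: "s \<longlonglongrightarrow> 0" and spos: "\<And>n. s n > 0" "\<And>n. s n < e"
    by (rule null_sequence_below[OF e(1)]) blast
  have "(\<lambda>n. (c (s n) - c 0) /\<^sub>R s n) \<longlonglongrightarrow> v"
    by (rule has_vector_derivative_quotient_seq[OF c s0]) (use spos(1) less_imp_neq in fastforce)
  moreover have "(c (s n) - c 0) /\<^sub>R s n \<in> S" for n
    by (intro subspace_mul subspace_diff S e(2)) (use spos[of n] e(1) in auto)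
  ultimately show ?thesis
    using closed_sequentially[OF closed_subspace[OF S], where f = "\<lambda>n. (c (s n) - c 0) /\<^sub>R s n"] by simp
qed

section \<open>Linear subspaces containing the normal spaces at their regular points\<close>

context orth_group
begin

text \<open>The conjugates of \<open>Y\<close> by \<open>exp (t X)\<close> stay in
  \<open>lie\<close>, and their derivative at 0 is the commutator. Only its value at
  \<open>p\<close> is wanted, so the limit is taken in the closed subspace
  \<open>tan_space p\<close>.\<close>

lemma bracket_tan:
  assumes X: "X \<in> lie" and Y: "Y \<in> lie"
  shows "X \<star> Y \<star> p - Y \<star> X \<star> p \<in> tan_space p"
proof (rule derivative_in_subspace[OF subspace_tan zero_less_one])
  let ?c = "\<lambda>t. (exp (t *\<^sub>R X) * (Y * exp (t *\<^sub>R (- X)))) \<star> p"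
  have "((\<lambda>t. exp (t *\<^sub>R X) * (Y * exp (t *\<^sub>R (- X)))) has_vector_derivative
      exp (0 *\<^sub>R X) * (Y * (- X * exp (0 *\<^sub>R (- X)))) + (X * exp (0 *\<^sub>R X)) * (Y * exp (0 *\<^sub>R (- X)))) (at 0)"
    by (intro has_vector_derivative_mult exp_scaleR_has_vector_derivative_left
        bounded_linear.has_vector_derivative[OF bounded_linear_mult_right])
  then have "((\<lambda>t. exp (t *\<^sub>R X) * (Y * exp (t *\<^sub>R (- X)))) has_vector_derivative X * Y - Y * X) (at 0)"
    by simp
  from bounded_linear.has_vector_derivative[OF endo.bounded_linear_left this, of p]
  show "(?c has_vector_derivative X \<star> Y \<star> p - Y \<star> X \<star> p) (at 0)" by (simp add: endo.diff_left)
  show "?c t \<in> tan_space p" for t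
  proof -
    have "inv_K (exp (t *\<^sub>R X)) = (exp (- t *\<^sub>R X) * exp (t *\<^sub>R X)) * inv_K (exp (t *\<^sub>R X))"
      unfolding exp_scaleR_minus_mult by simp
    also have "\<dots> = exp (t *\<^sub>R (- X))"
      unfolding mult.assoc inv_K(2)[OF exp_lie[OF X]] by simp
    finally have "exp (t *\<^sub>R X) * (Y * exp (t *\<^sub>R (- X))) = exp (t *\<^sub>R X) * Y * inv_K (exp (t *\<^sub>R X))"
      by (simp add: mult.assoc)
    with lie_conj[OF exp_lie[OF X] Y] show ?thesis unfolding tan_space_def
      by (intro image_eqI[of _ _ "exp (t *\<^sub>R X) * (Y * exp (t *\<^sub>R (- X)))"]) simp_all
  qed
qed

lemma regular_stab_eq:
  assumes p: "regular p" and q: "regular q" and sub: "stab p \<subseteq> stab q"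
  shows "stab q = stab p"
proof -
  obtain g where g: "g \<in> K" "stab q \<subseteq> stab (g \<star> p)" using q unfolding regular_def by blast
  with sub have "stab p \<subseteq> stab (g \<star> p)" by simp
  from stab_subset_conj_eq[OF g(1) this] g(2) sub show ?thesis by simp
qed

text \<open>A single inclusion is demanded, which makes the set visibly closed in \<open>K\<close>;
  that its elements map \<open>W\<close> onto \<open>W\<close> follows by dimension in
  \<open>stab_space_iff\<close>.\<close>

definition stab_space :: "'v set \<Rightarrow> 'v endo set" where
  "stab_space W = {h \<in> K. \<forall>w\<in>W. h \<star> w \<in> W}"

lemma compact_stab_space: assumes "subspace W" shows "compact (stab_space W)"
proof -
  have "stab_space W = K \<inter> (\<Inter>w\<in>W. (\<lambda>h. h \<star> w) -` W)" by (auto simp: stab_space_def)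
  moreover have "closed (\<Inter>w\<in>W. (\<lambda>h. h \<star> w) -` W)"
    by (intro closed_INT ballI closed_vimage closed_subspace assms linear_continuous_on endo.bounded_linear_left)
  ultimately show ?thesis using compact_Int_closed[OF compact_K] by simp
qed

lemma stab_space_iff:
  assumes W: "subspace W" and h: "h \<in> stab_space W" shows "h \<star> w \<in> W \<longleftrightarrow> w \<in> W"
proof
  have hK: "h \<in> K" and sub: "(\<star>) h ` W \<subseteq> W" using h by (auto simp: stab_space_def)
  have inj: "inj ((\<star>) h)" using inv_K_apply(2)[OF hK] by (rule inj_on_inverseI)
  have "dim ((\<star>) h ` W) = dim W"
    by (intro dim_image_eq linear_endo_apply) (rule inj_on_subset[OF inj subset_UNIV])
  then have eq: "(\<star>) h ` W = W"
    by (intro subspace_dim_equal linear_subspace_image linear_endo_apply W sub) simp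
  assume "h \<star> w \<in> W"
  then have "h \<star> w \<in> (\<star>) h ` W" using eq by simp
  then show "w \<in> W" using inj by (simp add: inj_image_mem_iff)
qed (use h in \<open>auto simp: stab_space_def\<close>)

text \<open>The subspace \<open>W\<close> is the sum of \<open>D\<close> and the normal space. Its points can be moved into the normal
  space at \<open>p\<close> by group elements preserving \<open>W\<close>. For a regular point \<open>y\<close> of the normal space the
  equivariant map between the orbits of \<open>p\<close> and \<open>y\<close> is a diffeomorphism whose differential preserves
  \<open>E\<close>, so that \<open>E\<close> is tangent to the orbit of \<open>y\<close>.\<close>

lemma normal_sum_subspace:
  assumes p: "regular p" and D: "subspace D" "D \<subseteq> tan_space p"
    and E_def: "E = tan_space p \<inter> orthogonal_comp D"
    and H1: "\<And>X Z. X \<in> lie \<Longrightarrow> X \<star> p \<in> D \<Longrightarrow> Z \<in> E \<Longrightarrow> X \<star> Z \<in> E"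
    and H2: "\<And>X \<eta>. X \<in> lie \<Longrightarrow> X \<star> p \<in> E \<Longrightarrow> \<eta> \<in> nor_space p \<Longrightarrow> X \<star> \<eta> \<in> tan_space p"
  shows "\<exists>W. subspace W \<and> p \<in> W \<and> dim W = dim (nor_space p) + dim D \<and>
    (\<forall>q\<in>W. regular q \<longrightarrow> nor_space q \<subseteq> W)"
proof -
  have E: "subspace E" unfolding E_def by (intro subspace_inter subspace_tan subspace_orthogonal_comp)
  have Etan: "E \<subseteq> tan_space p" by (auto simp: E_def)
  have ED: "x \<bullet> y = 0" if "x \<in> E" "y \<in> D" for x y
    using orthogonal_compD[of x D y] that by (simp add: E_def inner_commute)
  have EI: "x \<in> E" if "x \<in> tan_space p" "\<And>y. y \<in> D \<Longrightarrow> y \<bullet> x = 0" for x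
    unfolding E_def using that by (intro IntI orthogonal_compI) auto
  \<comment> \<open>The hypothesis \<open>H2\<close> only gives tangency. The component along
    \<open>D\<close> vanishes because, for \<open>Y p\<close> in \<open>D\<close>, both
    \<open>Y X p\<close> (by \<open>H1\<close>) and the commutator at \<open>p\<close> are
    tangential, hence so is \<open>X Y p\<close>, and \<open>\<eta>\<close> is orthogonal to
    it.\<close>
  have H2': "X \<star> \<eta> \<in> E" if X: "X \<in> lie" "X \<star> p \<in> E" and eta: "\<eta> \<in> nor_space p" for X \<eta>
  proof (rule EI[OF H2[OF X eta]])
    fix y assume y: "y \<in> D"
    then obtain Y where Y: "Y \<in> lie" "y = Y \<star> p" using D(2) by (auto simp: tan_space_def)
    have "Y \<star> X \<star> p \<in> tan_space p" using H1[OF Y(1) _ X(2)] y Y(2) Etan by auto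
    then have 1: "\<eta> \<bullet> (Y \<star> X \<star> p) = 0" by (rule nor_tan[OF eta])
    have 2: "\<eta> \<bullet> (X \<star> Y \<star> p - Y \<star> X \<star> p) = 0" by (rule nor_tan[OF eta bracket_tan[OF X(1) Y(1)]])
    have "y \<bullet> (X \<star> \<eta>) = - (\<eta> \<bullet> (X \<star> Y \<star> p))"
      using lie_skew[OF X(1), of \<eta> "Y \<star> p"] by (simp add: Y(2) inner_commute)
    also have "\<dots> = 0" using 1 2 by (simp add: inner_diff_right)
    finally show "y \<bullet> (X \<star> \<eta>) = 0" .
  qed
  \<comment> \<open>With \<open>W\<close> written as the complement of \<open>E\<close>, the goal
    \<open>nor_space q \<subseteq> W\<close> follows once \<open>E\<close> is known to be tangential
    at \<open>q\<close>.\<close>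
  define W where "W = orthogonal_comp E"
  have W: "subspace W" by (simp add: W_def subspace_orthogonal_comp)
  have WI: "x \<in> W" if "\<And>y. y \<in> E \<Longrightarrow> y \<bullet> x = 0" for x
    unfolding W_def by (rule orthogonal_compI) (rule that)
  have WE: "y \<bullet> x = 0" if "x \<in> W" "y \<in> E" for x y using that orthogonal_compD[of x E y] by (simp add: W_def)
  have norW: "nor_space p \<subseteq> W" unfolding W_def nor_space_def by (rule orthogonal_comp_anti_mono[OF Etan])
  have pW: "p \<in> W" using norW self_nor by blast
  have dimE: "dim E + dim D = dim (tan_space p)"
  proof -
    have "E = {y \<in> tan_space p. \<forall>x\<in>D. orthogonal x y}" by (auto simp: E_def orthogonal_comp_def)
    then show ?thesis using dim_subspace_orthogonal_to_vectors[OF D(1) subspace_tan D(2)] by simp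
  qed
  have dimW: "dim W = dim (nor_space p) + dim D"
    using dim_orthogonal_comp[OF E] dim_orthogonal_comp[OF subspace_tan[of p]] dimE
    by (simp add: W_def nor_space_def)
  \<comment> \<open>By \<open>H1\<close> and skewness \<open>X\<close> preserves the complement of
    \<open>E\<close>, so its one-parameter group does.\<close>
  have exp_stab: "exp (t *\<^sub>R X) \<in> stab_space W" if X: "X \<in> lie" "X \<star> p \<in> D" for X t
  proof -
    have XW: "X \<star> w \<in> W" if w: "w \<in> W" for w
    proof (rule WI)
      fix y assume y: "y \<in> E"
      show "y \<bullet> (X \<star> w) = 0" using lie_skew[OF X(1), of y w] WE[OF w H1[OF X y]] by simp
    qed
    show ?thesis unfolding stab_space_def using exp_endo_subspace[OF W XW] exp_lie[OF X(1)] by simp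
  qed
  have key: "nor_space y \<subseteq> W" if y: "regular y" "y \<in> nor_space p" for y
  proof -
    have "stab p \<subseteq> stab y" using regular_fix_nor[OF p _ y(2)] by (auto simp: stab_def)
    \<comment> \<open>Regularity of \<open>y\<close> upgrades the inclusion of isotropy groups to an
      equality, which makes the transfer map injective on \<open>E\<close>.\<close>
    note st = regular_stab_eq[OF p y(1) this]
    obtain f where f: "linear f" "\<forall>X\<in>lie. f (X \<star> p) = X \<star> y"
      by (rule tan_transfer[OF \<open>stab p \<subseteq> stab y\<close>])
    have fE: "f ` E \<subseteq> E"
    proof
      fix v assume "v \<in> f ` E"
      then obtain u where u: "u \<in> E" "v = f u" by blast
      then obtain X where X: "X \<in> lie" "u = X \<star> p" using Etan by (auto simp: tan_space_def)
      with u f(2) H2'[OF X(1) _ y(2)] show "v \<in> E" by simp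
    qed
    have "inj_on f E"
    proof (rule linear_injective_on_subspace_0[THEN iffD2, OF f(1) E], intro ballI impI)
      fix u assume u: "u \<in> E" "f u = 0"
      then obtain X where X: "X \<in> lie" "u = X \<star> p" using Etan by (auto simp: tan_space_def)
      then have "X \<star> y = 0" using f(2) u(2) by simp
      then show "u = 0" using lie_stab_subset[OF _ X(1), of y p] st X(2) by simp
    qed
    then have "dim (f ` E) = dim E"
      using dim_image_eq[OF f(1), of E] span_eq_iff[THEN iffD2, OF E] by simp
    then have "f ` E = E"
      by (intro subspace_dim_equal linear_subspace_image f(1) E fE) simp
    moreover have "f ` E \<subseteq> tan_space y"
    proof
      fix v assume "v \<in> f ` E"
      then obtain u where u: "u \<in> E" "v = f u" by blast
      then obtain X where X: "X \<in> lie" "u = X \<star> p" using Etan by (auto simp: tan_space_def)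
      with u f(2) show "v \<in> tan_space y" by (auto simp: tan_space_def)
    qed
    ultimately have "E \<subseteq> tan_space y" by simp
    then show ?thesis unfolding W_def nor_space_def by (rule orthogonal_comp_anti_mono)
  qed
  have "nor_space q \<subseteq> W" if q: "q \<in> W" "regular q" for q
  proof -
    have "1 \<in> stab_space W" by (simp add: stab_space_def one_K)
    then have "stab_space W \<noteq> {}" by blast
    \<comment> \<open>Maximising over the stabiliser of \<open>W\<close>, and not over
      \<open>K\<close>, keeps \<open>h q\<close> in \<open>W\<close> and thus orthogonal to
      \<open>E\<close>. The directions in \<open>D\<close> are still admissible by
      \<open>exp_stab\<close>, so criticality adds orthogonality to \<open>D\<close>, and
      \<open>h q\<close> is normal at \<open>p\<close>.\<close>
    from critical_point[OF compact_stab_space[OF W] this, of q p]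
    obtain h where h: "h \<in> stab_space W"
      and crit: "\<And>X. (\<forall>t. exp (t *\<^sub>R X) * h \<in> stab_space W) \<Longrightarrow> (X \<star> h \<star> q) \<bullet> p = 0" by blast
    have hK: "h \<in> K" using h by (simp add: stab_space_def)
    have hqW: "h \<star> q \<in> W" using stab_space_iff[OF W h] q(1) by simp
    have hqD: "d \<bullet> (h \<star> q) = 0" if d: "d \<in> D" for d
    proof -
      obtain X where X: "X \<in> lie" "d = X \<star> p" using d D(2) by (auto simp: tan_space_def)
      have "exp (t *\<^sub>R X) * h \<in> stab_space W" for t
        using exp_stab[OF X(1), of t] h d X(2) by (simp add: stab_space_def mult_K)
      then have "(X \<star> h \<star> q) \<bullet> p = 0" using crit by blast
      with lie_skew[OF X(1), of "h \<star> q" p] show ?thesis by (simp add: X(2) inner_commute)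
    qed
    have "h \<star> q \<in> nor_space p" unfolding nor_space_def
    proof (rule orthogonal_compI)
      fix u assume u: "u \<in> tan_space p"
      define d where "d = orth_proj D u"
      have d: "d \<in> D" and ud: "u - d \<in> orthogonal_comp D" unfolding d_def by (rule orth_proj_in[OF D(1)])+
      have "u - d \<in> E" unfolding E_def using ud u d D(2) by (auto intro: subspace_diff[OF subspace_tan])
      from WE[OF hqW this] hqD[OF d] show "u \<bullet> (h \<star> q) = 0" by (simp add: inner_diff_left)
    qed
    from key[OF regular_K[OF q(2) hK] this] have sub: "nor_space (h \<star> q) \<subseteq> W" .
    show ?thesis
    proof
      fix x assume "x \<in> nor_space q"
      then have "h \<star> x \<in> W" using nor_K[OF hK] sub by blast
      then show "x \<in> W" using stab_space_iff[OF W h] by simp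
    qed
  qed
  with W pW dimW show ?thesis by blast
qed

end

subsection \<open>Linear subspaces as totally geodesic submanifolds\<close>

lemma smooth_curve:
  fixes c :: "real \<Rightarrow> 'a::euclidean_space"
  assumes "smooth_open J c"
  shows "t \<in> J \<Longrightarrow> (c has_vector_derivative vector_derivative c (at t)) (at t)"
    and "smooth_open J (\<lambda>t. vector_derivative c (at t))"
proof -
  have der: "(c has_vector_derivative frechet_derivative c (at t) 1) (at t)" if "t \<in> J" for t
  proof -
    have 1: "(c has_derivative frechet_derivative c (at t)) (at t)"
      by (rule smooth_open_has_derivative[OF assms that])
    then interpret bounded_linear "frechet_derivative c (at t)" by (rule has_derivative_bounded_linear)
    have "frechet_derivative c (at t) = (\<lambda>x. x *\<^sub>R frechet_derivative c (at t) 1)"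
    proof
      fix x :: real
      have "frechet_derivative c (at t) (x *\<^sub>R 1) = x *\<^sub>R frechet_derivative c (at t) 1" by (rule scale)
      then show "frechet_derivative c (at t) x = x *\<^sub>R frechet_derivative c (at t) 1"
        unfolding real_scaleR_def mult_1_right .
    qed
    then show ?thesis unfolding has_vector_derivative_def by (rule subst) (rule 1)
  qed
  show "(c has_vector_derivative vector_derivative c (at t)) (at t)" if "t \<in> J"
    using der[OF that] vector_derivative_at[OF der[OF that]] by simp
  show "smooth_open J (\<lambda>t. vector_derivative c (at t))"
    by (rule smooth_open_cong[OF smooth_open_frechet_derivative[OF assms, of 1]])
      (rule vector_derivative_at[OF der, symmetric])
qed

lemma smooth_open_line: "open J \<Longrightarrow> smooth_open J (\<lambda>t::real. p + t *\<^sub>R v)"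
  by (intro smooth_open_add smooth_open_const smooth_open_bilinear[OF bounded_bilinear_scaleR] smooth_open_ident)

lemma line_has_vector_derivative: "((\<lambda>t. p + t *\<^sub>R v) has_vector_derivative v) (at t)"
  by (auto intro!: derivative_eq_intros)

lemma tangent_spaceI:
  assumes "\<epsilon> > 0" "smooth_open {-\<epsilon><..<\<epsilon>} c" "\<And>t. \<bar>t\<bar> < \<epsilon> \<Longrightarrow> c t \<in> M" "c 0 = p"
    "(c has_vector_derivative v) (at 0)"
  shows "v \<in> tangent_space M p"
proof -
  have "smooth_on {-\<epsilon><..<\<epsilon>} c" using assms(2) by (simp add: smooth_on_open_iff)
  moreover have "c ` {-\<epsilon><..<\<epsilon>} \<subseteq> M"
  proof (rule image_subsetI)
    fix t assume "t \<in> {-\<epsilon><..<\<epsilon>}"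
    then have "\<bar>t\<bar> < \<epsilon>" by auto
    then show "c t \<in> M" by (rule assms(3))
  qed
  ultimately show ?thesis unfolding tangent_space_def
    by (intro CollectI exI[of _ \<epsilon>] exI[of _ c] conjI assms(1,4,5))
qed

lemma tangent_spaceE:
  assumes "v \<in> tangent_space M p"
  obtains \<epsilon> c where "\<epsilon> > 0" "smooth_open {-\<epsilon><..<\<epsilon>} c" "c ` {-\<epsilon><..<\<epsilon>} \<subseteq> M" "c 0 = p"
    "(c has_vector_derivative v) (at 0)"
proof -
  from assms obtain \<epsilon> c where "\<epsilon> > 0" "smooth_on {-\<epsilon><..<\<epsilon>} c" "c ` {-\<epsilon><..<\<epsilon>} \<subseteq> M" "c 0 = p"
    "(c has_vector_derivative v) (at 0)"
    unfolding tangent_space_def mem_Collect_eq by (elim exE conjE)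
  then show thesis by (intro that[of \<epsilon> c]) (simp_all only: smooth_on_open_iff open_greaterThanLessThan)
qed

lemma tangent_space_subspace:
  assumes W: "subspace W" and p: "p \<in> W" shows "tangent_space W p = W"
proof
  show "tangent_space W p \<subseteq> W"
  proof
    fix v assume "v \<in> tangent_space W p"
    then obtain \<epsilon> c where c: "\<epsilon> > 0" "c ` {-\<epsilon><..<\<epsilon>} \<subseteq> W" "(c has_vector_derivative v) (at 0)"
      by (rule tangent_spaceE)
    show "v \<in> W"
    proof (rule derivative_in_subspace[OF W c(1) _ c(3)])
      fix t :: real assume "\<bar>t\<bar> < \<epsilon>"
      then have "t \<in> {-\<epsilon><..<\<epsilon>}" by auto
      then show "c t \<in> W" using c(2) by blast
    qed
  qed
  show "W \<subseteq> tangent_space W p"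
  proof
    fix v assume "v \<in> W"
    with p W have "p + t *\<^sub>R v \<in> W" for t by (simp add: subspace_add subspace_mul)
    then show "v \<in> tangent_space W p"
      by (intro tangent_spaceI[of 1 "\<lambda>t. p + t *\<^sub>R v"] smooth_open_line line_has_vector_derivative) auto
  qed
qed

lemma submanifold_subspace:
  fixes W :: "'v::euclidean_space set"
  assumes "subspace W" shows "submanifold W"
proof -
  have "smooth_on UNIV (\<lambda>x::'v. x)" by (simp add: smooth_on_open_iff smooth_open_ident)
  moreover have "homeomorphism UNIV UNIV (\<lambda>x::'v. x) (\<lambda>x. x)" by (simp add: homeomorphism_def)
  ultimately show ?thesis unfolding submanifold_def
    by (intro exI[of _ "dim W"] ballI exI[of _ UNIV] exI[of _ "\<lambda>x. x"] exI[of _ W]) (simp add: assms)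
qed

lemma complete_submanifold_subspace:
  assumes W: "subspace W" shows "complete_submanifold W"
  unfolding complete_submanifold_def
proof (intro conjI ballI)
  show "submanifold W" by (rule submanifold_subspace[OF W])
  fix p v assume p: "p \<in> W" and v: "v \<in> tangent_space W p"
  let ?g = "\<lambda>t. p + t *\<^sub>R v"
  have vW: "v \<in> W" using v tangent_space_subspace[OF W p] by simp
  have g: "?g t \<in> W" for t using p vW W by (simp add: subspace_add subspace_mul)
  have d: "vector_derivative ?g (at t) = v" for t
    by (rule vector_derivative_at[OF line_has_vector_derivative])
  have "complete_geodesic W ?g" unfolding complete_geodesic_def
  proof (intro conjI allI g)
    show "smooth_on UNIV ?g" by (simp add: smooth_on_open_iff smooth_open_line)
    have "vector_derivative (\<lambda>s. vector_derivative ?g (at s)) (at t) = 0" for t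
      unfolding d by (rule vector_derivative_at) simp
    then show "vector_derivative (\<lambda>s. vector_derivative ?g (at s)) (at t) \<in> normal_space W (?g t)" for t
      by (simp add: normal_space_def subspace_0 subspace_orthogonal_comp)
  qed
  with d show "\<exists>\<gamma>. complete_geodesic W \<gamma> \<and> \<gamma> 0 = p \<and> vector_derivative \<gamma> (at 0) = v"
    by (intro exI[of _ ?g]) simp
qed

lemma totally_geodesic_subspace:
  assumes W: "subspace W" shows "totally_geodesic W"
  unfolding totally_geodesic_def
proof (intro allI impI ballI)
  fix X Y p assume XY: "tangent_field W X \<and> tangent_field W Y" and p: "p \<in> W"
  have X: "X p \<in> W" using XY p tangent_space_subspace[OF W p] by (auto simp: tangent_field_def)
  have Y: "smooth_on W Y" "\<And>q. q \<in> W \<Longrightarrow> Y q \<in> W"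
    using XY tangent_space_subspace[OF W] by (auto simp: tangent_field_def)
  have line: "p + t *\<^sub>R X p \<in> W" for t using p X W by (simp add: subspace_add subspace_mul)
  have "((\<lambda>s. Y (p + s *\<^sub>R X p)) has_vector_derivative
      frechet_derivative Y (at (p + 0 *\<^sub>R X p) within W) (X p)) (at 0)"
    by (rule smooth_on_along_curve[OF Y(1) UNIV_I open_UNIV _ line_has_vector_derivative]) (use line in auto)
  then have "frechet_derivative Y (at p within W) (X p) \<in> W"
    by (intro derivative_in_subspace[OF W zero_less_one Y(2)[OF line]]) simp
  then have "frechet_derivative Y (at p within W) (X p) \<in> orthogonal_comp (orthogonal_comp W)"
    using orthogonal_comp_self[OF W] by simp
  then show "second_fundamental_form W X Y p = 0"
    unfolding second_fundamental_form_def normal_space_def tangent_space_subspace[OF W p]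
    by (simp add: orth_proj_eq_0_iff subspace_orthogonal_comp)
qed

subsection \<open>Complete totally geodesic submanifolds are affine subspaces\<close>

definition slice_chart :: "'v::euclidean_space set \<Rightarrow> nat \<Rightarrow> 'v \<Rightarrow> 'v set \<Rightarrow> 'v set \<Rightarrow>
    ('v \<Rightarrow> 'v) \<Rightarrow> ('v \<Rightarrow> 'v) \<Rightarrow> 'v set \<Rightarrow> bool" where
  "slice_chart M d p U W \<Phi> \<Psi> L \<longleftrightarrow> open U \<and> p \<in> U \<and> open W \<and> homeomorphism U W \<Phi> \<Psi> \<and>
     smooth_open U \<Phi> \<and> smooth_open W \<Psi> \<and> subspace L \<and> dim L = d \<and> \<Phi> ` (M \<inter> U) = L \<inter> W"

lemma slice_chartD:
  assumes "slice_chart M d p U W \<Phi> \<Psi> L"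
  shows "open U" "p \<in> U" "open W" "homeomorphism U W \<Phi> \<Psi>" "smooth_open U \<Phi>" "smooth_open W \<Psi>"
    "subspace L" "dim L = d" "\<Phi> ` (M \<inter> U) = L \<inter> W"
  using assms by (simp_all add: slice_chart_def)

lemma submanifoldE:
  assumes "submanifold M"
  obtains d where "\<forall>p\<in>M. \<exists>U W \<Phi> \<Psi> L. slice_chart M d p U W \<Phi> \<Psi> L"
proof -
  obtain d where d: "\<forall>p\<in>M. \<exists>U (W :: 'a set) \<Phi> \<Psi> L. open U \<and> p \<in> U \<and> open W \<and>
        homeomorphism U W \<Phi> \<Psi> \<and> smooth_on U \<Phi> \<and> smooth_on W \<Psi> \<and>
        subspace L \<and> dim L = d \<and> \<Phi> ` (M \<inter> U) = L \<inter> W"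
    using assms unfolding submanifold_def by (elim exE)
  have "\<exists>U W \<Phi> \<Psi> L. slice_chart M d p U W \<Phi> \<Psi> L" if p: "p \<in> M" for p
  proof -
    from bspec[OF d p] obtain U and W :: "'a set" and \<Phi> \<Psi> L where "open U" "p \<in> U" "open W"
      "homeomorphism U W \<Phi> \<Psi>" "smooth_on U \<Phi>" "smooth_on W \<Psi>" "subspace L" "dim L = d"
      "\<Phi> ` (M \<inter> U) = L \<inter> W" by (elim exE conjE)
    then have "slice_chart M d p U W \<Phi> \<Psi> L"
      unfolding slice_chart_def by (simp add: smooth_on_open_iff[symmetric])
    then show ?thesis by (intro exI)
  qed
  then show thesis by (intro that ballI)
qed

text \<open>The derivatives \<open>A\<close> and \<open>B\<close> of the inverse chart and of the
  chart are mutually inverse, so velocities of curves in \<open>M\<close> correspond to velocities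
  of curves in the linear slice \<open>L\<close>.\<close>

lemma chart_tangent_space:
  fixes \<Phi> :: "'v::euclidean_space \<Rightarrow> 'v"
  assumes U: "open U" and W: "open W" and hom: "homeomorphism U W \<Phi> \<Psi>"
    and sm: "smooth_open U \<Phi>" "smooth_open W \<Psi>"
    and L: "subspace L" and chL: "\<Phi> ` (M \<inter> U) = L \<inter> W" and x: "x \<in> M" "x \<in> U"
  defines "A \<equiv> frechet_derivative \<Psi> (at (\<Phi> x))"
  shows "tangent_space M x = A ` L" "linear A" "inj A"
proof -
  have inv: "\<Psi> (\<Phi> z) = z" "\<Phi> z \<in> W" if "z \<in> U" for z
    using hom that by (auto simp: homeomorphism_def)
  have inv': "\<Phi> (\<Psi> z) = z" "\<Psi> z \<in> U" if "z \<in> W" for z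
    using hom that by (auto simp: homeomorphism_def)
  define B where "B = frechet_derivative \<Phi> (at x)"
  have A: "(\<Psi> has_derivative A) (at (\<Phi> x))" unfolding A_def
    by (rule smooth_open_has_derivative[OF sm(2) inv(2)[OF x(2)]])
  have B: "(\<Phi> has_derivative B) (at x)" unfolding B_def
    by (rule smooth_open_has_derivative[OF sm(1) x(2)])
  show linA: "linear A" by (rule has_derivative_linear[OF A])
  have "((\<lambda>z. \<Psi> (\<Phi> z)) has_derivative (\<lambda>v. A (B v))) (at x)"
    by (rule has_derivative_compose[OF B A])
  then have "((\<lambda>z. z) has_derivative (\<lambda>v. A (B v))) (at x)"
    by (rule has_derivative_transform_within_open[OF _ U x(2)]) (rule inv)
  then have AB: "A (B v) = v" for v
    by (rule fun_cong[OF has_derivative_unique[OF _ has_derivative_ident]])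
  have A': "(\<Psi> has_derivative A) (at (\<Phi> x))" by (rule A)
  have "\<Psi> (\<Phi> x) = x" using inv x by blast
  with B have "(\<Phi> has_derivative B) (at (\<Psi> (\<Phi> x)))" by simp
  from has_derivative_compose[OF A' this]
  have "((\<lambda>z. \<Phi> (\<Psi> z)) has_derivative (\<lambda>v. B (A v))) (at (\<Phi> x))" .
  then have "((\<lambda>z. z) has_derivative (\<lambda>v. B (A v))) (at (\<Phi> x))"
    by (rule has_derivative_transform_within_open[OF _ W inv(2)[OF x(2)]]) (rule inv')
  then have BA: "B (A v) = v" for v
    by (rule fun_cong[OF has_derivative_unique[OF _ has_derivative_ident]])
  show "inj A" using BA by (rule inj_on_inverseI)
  show "tangent_space M x = A ` L"
  proof
    show "tangent_space M x \<subseteq> A ` L"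
    proof
      fix v assume "v \<in> tangent_space M x"
      then obtain \<epsilon> c where c: "\<epsilon> > 0" "smooth_open {-\<epsilon><..<\<epsilon>} c" "c ` {-\<epsilon><..<\<epsilon>} \<subseteq> M" "c 0 = x"
        "(c has_vector_derivative v) (at 0)" by (rule tangent_spaceE)
      have "isCont c 0" using c(5) has_vector_derivative_continuous by blast
      then have "eventually (\<lambda>t. c t \<in> U) (at 0)"
        using topological_tendstoD[OF _ U] x(2) c(4) by (simp add: isCont_def)
      then obtain \<delta> where \<delta>: "\<delta> > 0" "\<And>t. t \<noteq> 0 \<Longrightarrow> dist t 0 < \<delta> \<Longrightarrow> c t \<in> U"
        by (auto simp: eventually_at)
      have cU: "c t \<in> M \<inter> U" if "\<bar>t\<bar> < min \<epsilon> \<delta>" for t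
      proof
        have "t \<in> {-\<epsilon><..<\<epsilon>}" using that by auto
        then show "c t \<in> M" using c(3) by blast
        show "c t \<in> U" using c(4) x(2) \<delta>(2)[of t] that by (cases "t = 0") auto
      qed
      have "((\<lambda>t. \<Phi> (c t)) has_vector_derivative B v) (at 0)"
        using vector_derivative_diff_chain_within[OF c(5), of \<Phi> B] B c(4)
        by (simp add: o_def has_derivative_at_withinI)
      moreover have "\<Phi> (c t) \<in> L" if "\<bar>t\<bar> < min \<epsilon> \<delta>" for t
        using imageI[OF cU[OF that], of \<Phi>] chL by simp
      ultimately have "B v \<in> L"
        using derivative_in_subspace[OF L, of "min \<epsilon> \<delta>" "\<lambda>t. \<Phi> (c t)" "B v"] c(1) \<delta>(1) by simp
      from imageI[OF this, of A] show "v \<in> A ` L" unfolding AB .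
    qed
    show "A ` L \<subseteq> tangent_space M x"
    proof
      fix v assume "v \<in> A ` L"
      then obtain l where l: "l \<in> L" "v = A l" by blast
      let ?g = "\<lambda>t. \<Phi> x + t *\<^sub>R l"
      have yL: "\<Phi> x \<in> L" using imageI[of x "M \<inter> U" \<Phi>] x chL by simp
      have cont: "continuous_on UNIV ?g" by (intro continuous_intros)
      have "open (?g -` W)" by (rule open_vimage[OF W cont])
      moreover have "0 \<in> ?g -` W" using inv(2)[OF x(2)] by simp
      ultimately obtain \<epsilon> where e: "\<epsilon> > 0" "ball 0 \<epsilon> \<subseteq> ?g -` W" unfolding open_contains_ball by blast
      have gW: "?g t \<in> W" if "\<bar>t\<bar> < \<epsilon>" for t using e(2) that by (auto simp: subset_iff)
      have gM: "\<Psi> (?g t) \<in> M" if "\<bar>t\<bar> < \<epsilon>" for t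
      proof -
        have "?g t \<in> L \<inter> W" using gW[OF that] l yL L by (simp add: subspace_add subspace_mul)
        then obtain m where "m \<in> M \<inter> U" "?g t = \<Phi> m" unfolding chL[symmetric] by blast
        then show ?thesis using inv(1)[of m] by simp
      qed
      show "v \<in> tangent_space M x"
      proof (rule tangent_spaceI[OF e(1), of "\<lambda>t. \<Psi> (?g t)"])
        show "smooth_open {-\<epsilon><..<\<epsilon>} (\<lambda>t. \<Psi> (?g t))"
          by (rule smooth_open_compose[OF smooth_open_line sm(2)]) (use gW in auto)
        have "(\<Psi> has_derivative A) (at (\<Phi> x + 0 *\<^sub>R l))" using A by simp
        then show "((\<lambda>t. \<Psi> (?g t)) has_vector_derivative v) (at 0)"
          unfolding l(2)
          using vector_derivative_diff_chain_within[OF line_has_vector_derivative[of "\<Phi> x" l 0], of \<Psi> A]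
          by (simp add: o_def has_derivative_at_withinI)
      qed (use gM inv(1) x in auto)
    qed
  qed
qed

text \<open>One notion for three bundles: tangent spaces of a submanifold, tangent spaces of an
  orbit, and a given distribution. The frames live on open sets of the ambient space, as
  \<open>smooth_orth_proj_frame\<close> expects, and are compared with \<open>E\<close> only along
  \<open>M\<close>.\<close>

definition tangent_frames :: "'v::euclidean_space set \<Rightarrow> ('v \<Rightarrow> 'v set) \<Rightarrow> nat \<Rightarrow> bool" where
  "tangent_frames M E d \<longleftrightarrow> (\<forall>p\<in>M. \<exists>U (F :: nat \<Rightarrow> 'v \<Rightarrow> 'v). open U \<and> p \<in> U \<and>
     (\<forall>i<d. smooth_open U (F i)) \<and> (\<forall>x\<in>M \<inter> U. E x = span {F i x | i. i < d} \<and> dim (E x) = d))"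

lemma indexed_basis:
  fixes L :: "'v::euclidean_space set"
  assumes "subspace L"
  obtains l :: "nat \<Rightarrow> 'v" where "L = span {l i | i. i < dim L}"
proof -
  obtain B where B: "B \<subseteq> L" "independent B" "L \<subseteq> span B" "card B = dim L"
    by (rule basis_exists[of L])
  have fin: "finite B" using B(2) by (rule independent_imp_finite)
  obtain l where l: "bij_betw l {0..<card B} B" using ex_bij_betw_nat_finite[OF fin] by blast
  have "B = {l i | i. i < dim L}" using l B(4) by (auto simp: bij_betw_def)
  moreover have "span B = L" using B(1,3) span_minimal[OF _ assms] by blast
  ultimately have "L = span {l i | i. i < dim L}" by simp
  then show thesis by (rule that)
qed

lemma submanifold_tangent_frames:
  assumes charts: "\<forall>p\<in>M. \<exists>U W \<Phi> \<Psi> L. slice_chart M d p U W \<Phi> \<Psi> L"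
  shows "tangent_frames M (tangent_space M) d"
  unfolding tangent_frames_def
proof
  fix p assume "p \<in> M"
  from bspec[OF charts this] obtain U W \<Phi> \<Psi> L where "slice_chart M d p U W \<Phi> \<Psi> L" by (elim exE)
  note U = slice_chartD(1,2)[OF this] and W = slice_chartD(3)[OF this] and hom = slice_chartD(4)[OF this]
    and sm = slice_chartD(5,6)[OF this] and L = slice_chartD(7,8)[OF this] and chL = slice_chartD(9)[OF this]
  obtain l where l: "L = span {l i | i. i < dim L}" by (rule indexed_basis[OF L(1)])
  define F where "F i x = frechet_derivative \<Psi> (at (\<Phi> x)) (l i)" for i x
  have sF: "smooth_open U (F i)" for i
    unfolding F_def
    by (rule smooth_open_compose[OF sm(1) smooth_open_frechet_derivative[OF sm(2)]])
      (use hom in \<open>auto simp: homeomorphism_def\<close>)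
  have tF: "tangent_space M x = span {F i x | i. i < d} \<and> dim (tangent_space M x) = d"
    if x: "x \<in> M \<inter> U" for x
  proof -
    define A where "A = frechet_derivative \<Psi> (at (\<Phi> x))"
    note ch = chart_tangent_space[OF U(1) W hom sm L(1) chL IntD1[OF x] IntD2[OF x], folded A_def]
    have "A ` {l i | i. i < d} = {F i x | i. i < d}" by (auto simp: F_def A_def)
    moreover have "A ` L = span (A ` {l i | i. i < d})"
      using linear_span_image[OF ch(2), of "{l i | i. i < d}"] l L(2) by simp
    moreover have "dim (A ` L) = d"
      using dim_image_eq[OF ch(2), of L] inj_on_subset[OF ch(3) subset_UNIV] L(2) by simp
    ultimately show ?thesis using ch(1) by simp
  qed
  show "\<exists>U F. open U \<and> p \<in> U \<and> (\<forall>i<d. smooth_open U (F i)) \<and>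
      (\<forall>x\<in>M \<inter> U. tangent_space M x = span {F i x | i. i < d} \<and> dim (tangent_space M x) = d)"
    by (intro exI[of _ U] exI[of _ F] conjI[OF U(1)] conjI[OF U(2)] conjI allI impI ballI sF tF)
qed

text \<open>Projecting a constant vector that lies in \<open>E p\<close> yields a global smooth
  section with this value at \<open>p\<close>, without a partition of unity.\<close>

lemma tangent_frames_smooth_proj:
  assumes "tangent_frames M E d"
  shows "smooth_on M (\<lambda>x. orth_proj (E x) v)" "p \<in> M \<Longrightarrow> subspace (E p)" "p \<in> M \<Longrightarrow> dim (E p) = d"
proof -
  show "smooth_on M (\<lambda>x. orth_proj (E x) v)"
  proof (rule smooth_onI)
    fix p assume p: "p \<in> M"
    obtain U and F :: "nat \<Rightarrow> 'a \<Rightarrow> 'a" where U: "open U" "p \<in> U" and F: "\<forall>i<d. smooth_open U (F i)"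
      and E: "\<forall>x\<in>M \<inter> U. E x = span {F i x | i. i < d} \<and> dim (E x) = d"
      using bspec[OF assms[unfolded tangent_frames_def] p] by (elim exE conjE)
    have e: "E p = span {F i p | i. i < d}" "dim (E p) = d" using bspec[OF E IntI[OF p U(2)]] by blast+
    then have Ep: "dim (span {F i p | i. i < d}) = d" by (rule subst)
    obtain V where V: "p \<in> V" "V \<subseteq> U" "\<forall>v. smooth_open V (\<lambda>x. orth_proj (span {F i x | i. i < d}) v)"
      by (rule smooth_orth_proj_frame[where k = d and F = F, OF F U Ep])
    have "orth_proj (span {F i x | i. i < d}) v = orth_proj (E x) v" if "x \<in> M \<inter> V" for x
      using E V(2) that by auto
    with V show "\<exists>U G. smooth_open U G \<and> p \<in> U \<and> (\<forall>y\<in>M \<inter> U. G y = orth_proj (E y) v)"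
      by (intro exI[of _ V] exI[of _ "\<lambda>x. orth_proj (span {F i x | i. i < d}) v"]) simp
  qed
  assume p: "p \<in> M"
  obtain U and F :: "nat \<Rightarrow> 'a \<Rightarrow> 'a" where "p \<in> U"
    "\<forall>x\<in>M \<inter> U. E x = span {F i x | i. i < d} \<and> dim (E x) = d"
    using bspec[OF assms[unfolded tangent_frames_def] p] by (elim exE conjE)
  with p have e: "E p = span {F i p | i. i < d} \<and> dim (E p) = d" by blast
  from e show "dim (E p) = d" by (rule conjunct2)
  show "subspace (E p)" unfolding conjunct1[OF e] by (rule subspace_span)
qed

lemma geodesic_velocity_tangent:
  assumes "smooth_open UNIV \<gamma>" "\<And>t. \<gamma> t \<in> M"
  shows "vector_derivative \<gamma> (at t) \<in> tangent_space M (\<gamma> t)"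
proof (rule tangent_spaceI[of 1 "\<lambda>s. \<gamma> (t + s)"])
  have "smooth_open {-1<..<1} (\<lambda>s::real. t + s)"
    by (intro smooth_open_add smooth_open_const smooth_open_ident) auto
  then show "smooth_open {-1<..<1} (\<lambda>s. \<gamma> (t + s))"
    by (rule smooth_open_compose[OF _ assms(1)]) simp
  have "(\<gamma> has_vector_derivative vector_derivative \<gamma> (at t)) (at (t + 0))"
    using smooth_curve(1)[OF assms(1), of t] by simp
  moreover have "((\<lambda>s. t + s) has_vector_derivative 1) (at (0::real))"
    by (auto intro!: derivative_eq_intros)
  ultimately show "((\<lambda>s. \<gamma> (t + s)) has_vector_derivative vector_derivative \<gamma> (at t)) (at 0)"
    using vector_diff_chain_at[of "\<lambda>s. t + s" 1 0 \<gamma> "vector_derivative \<gamma> (at t)"] by (simp add: o_def)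
qed (use assms in auto)

text \<open>Differentiate \<open>\<gamma>' = P \<gamma>'\<close>, where \<open>P\<close> is the field of tangential projections: as \<open>M\<close> is totally
  geodesic, the derivative of \<open>P\<close> applied to \<open>\<gamma>'\<close> is tangential, so \<open>\<gamma>''\<close> has no normal part.\<close>

lemma totally_geodesic_straight:
  assumes frames: "tangent_frames M (tangent_space M) d" and tg: "totally_geodesic M"
    and g: "complete_geodesic M \<gamma>"
  shows "\<gamma> t = \<gamma> 0 + t *\<^sub>R vector_derivative \<gamma> (at 0)"
proof -
  note P = tangent_frames_smooth_proj[OF frames]
  have sg: "smooth_open UNIV \<gamma>" and gM: "\<And>t. \<gamma> t \<in> M"
    using g by (auto simp: complete_geodesic_def smooth_on_open_iff)
  define v where "v t = vector_derivative \<gamma> (at t)" for t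
  define a where "a t = vector_derivative v (at t)" for t
  have gv: "(\<gamma> has_vector_derivative v t) (at t)" for t unfolding v_def by (rule smooth_curve(1)[OF sg UNIV_I])
  have va: "(v has_vector_derivative a t) (at t)" for t
    unfolding a_def by (rule smooth_curve(1)[OF _ UNIV_I]) (unfold v_def, rule smooth_curve(2)[OF sg])
  have vT: "v t \<in> tangent_space M (\<gamma> t)" for t
    unfolding v_def by (rule geodesic_velocity_tangent[OF sg gM])
  have aN: "a t \<in> normal_space M (\<gamma> t)" for t
    using g unfolding complete_geodesic_def a_def v_def by blast
  define Q where "Q b x = orth_proj (tangent_space M x) b" for b x
  have Qf: "tangent_field M (Q b)" for b
    unfolding tangent_field_def Q_def using P(1) orth_proj_in(1)[OF P(2)] by blast
  have "a t = 0" for t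
  proof -
    define DQ where "DQ b = frechet_derivative (Q b) (at (\<gamma> t) within M) (v t)" for b
    let ?N = "normal_space M (\<gamma> t)"
    have N: "subspace ?N" by (simp add: normal_space_def subspace_orthogonal_comp)
    have lin: "linear (orth_proj ?N)" by (rule linear_orth_proj[OF N])
    have Qv: "Q (v t) (\<gamma> t) = v t" unfolding Q_def by (rule orth_proj_id[OF P(2)[OF gM] vT])
    \<comment> \<open>The tangent field \<open>Q (v t)\<close> has the value \<open>v t\<close> at
      \<open>\<gamma> t\<close>, so it supplies the direction of differentiation for total
      geodesy.\<close>
    have DQ0: "orth_proj ?N (DQ b) = 0" for b
      using tg[unfolded totally_geodesic_def, rule_format, OF conjI[OF Qf Qf] gM, of "v t" b t]
      unfolding second_fundamental_form_def DQ_def Qv .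
    have "((\<lambda>s. \<Sum>b\<in>Basis. (v s \<bullet> b) *\<^sub>R Q b (\<gamma> s)) has_vector_derivative
        (\<Sum>b\<in>Basis. (v t \<bullet> b) *\<^sub>R DQ b + (a t \<bullet> b) *\<^sub>R Q b (\<gamma> t))) (at t)"
      unfolding DQ_def
      by (intro has_vector_derivative_sum bounded_bilinear.has_vector_derivative[OF bounded_bilinear_scaleR]
          bounded_linear.has_vector_derivative[OF bounded_linear_inner_left va]
          smooth_on_along_curve[OF conjunct1[OF Qf[unfolded tangent_field_def]] UNIV_I open_UNIV _ gv])
        (use gM in auto)
    moreover have "(\<Sum>b\<in>Basis. (v s \<bullet> b) *\<^sub>R Q b (\<gamma> s)) = v s" for s
    proof -
      have "(\<Sum>b\<in>Basis. (v s \<bullet> b) *\<^sub>R Q b (\<gamma> s)) = orth_proj (tangent_space M (\<gamma> s)) (v s)"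
        unfolding Q_def by (rule linear_euclidean_expand[OF linear_orth_proj[OF P(2)[OF gM]], symmetric])
      then show ?thesis using orth_proj_id[OF P(2)[OF gM] vT] by simp
    qed
    ultimately have "(v has_vector_derivative
        (\<Sum>b\<in>Basis. (v t \<bullet> b) *\<^sub>R DQ b + (a t \<bullet> b) *\<^sub>R Q b (\<gamma> t))) (at t)" by simp
    from vector_derivative_unique_at[OF va this]
    have at: "a t = (\<Sum>b\<in>Basis. (v t \<bullet> b) *\<^sub>R DQ b) + (\<Sum>b\<in>Basis. (a t \<bullet> b) *\<^sub>R Q b (\<gamma> t))"
      by (simp add: sum.distrib)
    \<comment> \<open>The acceleration is normal, so its tangential projection drops out and
      \<open>a t\<close> is a combination of the vectors \<open>DQ b\<close>, which have no normal
      part.\<close>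
    also have "(\<Sum>b\<in>Basis. (a t \<bullet> b) *\<^sub>R Q b (\<gamma> t)) = orth_proj (tangent_space M (\<gamma> t)) (a t)"
      unfolding Q_def by (rule linear_euclidean_expand[OF linear_orth_proj[OF P(2)[OF gM]], symmetric])
    also have "\<dots> = 0" using aN[of t] by (simp add: orth_proj_eq_0_iff[OF P(2)[OF gM]] normal_space_def)
    finally have "orth_proj ?N (a t) = (\<Sum>b\<in>Basis. (v t \<bullet> b) *\<^sub>R orth_proj ?N (DQ b))"
      by (simp add: linear_sum[OF lin] linear_scale[OF lin])
    then show ?thesis using DQ0 orth_proj_id[OF N aN] by simp
  qed
  then have "(v has_vector_derivative 0) (at s within UNIV)" for s using va[of s] by simp
  then obtain c where c: "\<And>s. v s = c"
    using has_vector_derivative_zero_constant[of UNIV v] by auto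
  have "((\<lambda>s. \<gamma> s - s *\<^sub>R c) has_vector_derivative 0) (at s within UNIV)" for s
    using gv[of s] c[of s] by (auto intro!: derivative_eq_intros)
  then obtain c' where c': "\<And>s. \<gamma> s - s *\<^sub>R c = c'"
    using has_vector_derivative_zero_constant[of UNIV "\<lambda>s. \<gamma> s - s *\<^sub>R c"] by auto
  from c'[of t] c'[of 0] c[of 0] show ?thesis by (simp add: v_def algebra_simps)
qed

text \<open>Completeness and straightness of geodesics put the affine tangent space at
  \<open>p\<close> inside \<open>M\<close>. It is closed in the ambient space and, having the
  dimension of \<open>M\<close>, open in \<open>M\<close> by invariance of domain; connectedness
  leaves only equality.\<close>

theorem complete_totally_geodesic_affine:
  fixes M :: "'v::euclidean_space set"
  assumes comp: "complete_submanifold M" and tg: "totally_geodesic M" and conn: "connected M" and p: "p \<in> M"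
  shows "subspace (tangent_space M p)" "M = (+) p ` tangent_space M p"
proof -
  have "submanifold M" using comp by (simp add: complete_submanifold_def)
  then obtain d where d: "\<forall>p\<in>M. \<exists>U W \<Phi> \<Psi> L. slice_chart M d p U W \<Phi> \<Psi> L" by (rule submanifoldE)
  note frames = submanifold_tangent_frames[OF d]
  define S where "S = tangent_space M p"
  have S: "subspace S" and dimS: "dim S = d"
    unfolding S_def by (rule tangent_frames_smooth_proj(2,3)[OF frames p])+
  then show "subspace (tangent_space M p)" by (simp add: S_def)
  have AM: "(+) p ` S \<subseteq> M"
  proof
    fix x assume "x \<in> (+) p ` S"
    then obtain v where v: "v \<in> tangent_space M p" "x = p + v" unfolding S_def by blast
    have "\<exists>\<gamma>. complete_geodesic M \<gamma> \<and> \<gamma> 0 = p \<and> vector_derivative \<gamma> (at 0) = v"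
      using comp p v(1) unfolding complete_submanifold_def by simp
    then obtain \<gamma> where g: "complete_geodesic M \<gamma>" "\<gamma> 0 = p" "vector_derivative \<gamma> (at 0) = v"
      by (elim exE conjE)
    have "\<gamma> 1 = x" using totally_geodesic_straight[OF frames tg g(1), of 1] g v(2) by simp
    moreover have "\<gamma> 1 \<in> M" using g(1) by (simp add: complete_geodesic_def)
    ultimately show "x \<in> M" by simp
  qed
  have "openin (top_of_set M) ((+) p ` S)"
  proof (subst openin_subopen, rule ballI)
    fix q assume q: "q \<in> (+) p ` S"
    then have "q \<in> M" using AM by blast
    from bspec[OF d this] obtain U W \<Phi> \<Psi> L where "slice_chart M d q U W \<Phi> \<Psi> L" by (elim exE)
    note U = slice_chartD(1,2)[OF this] and hom = slice_chartD(4)[OF this]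
      and L = slice_chartD(7,8)[OF this] and chL = slice_chartD(9)[OF this]
    define R where "R = S \<inter> (+) p -` U"
    have contU: "continuous_on U \<Phi>" and injU: "\<And>z. z \<in> U \<Longrightarrow> \<Psi> (\<Phi> z) = z"
      using hom by (auto simp: homeomorphism_def)
    have RMU: "p + u \<in> M \<inter> U" if "u \<in> R" for u using that AM by (auto simp: R_def)
    \<comment> \<open>The chart maps the affine piece continuously and injectively into
      \<open>L\<close>, a subspace of the same dimension, so the image is open in \<open>L\<close>
      and pulls back to a neighbourhood of \<open>q\<close> in \<open>M\<close>.\<close>
    have "openin (top_of_set L) ((\<lambda>u. \<Phi> (p + u)) ` R)"
    proof (rule invariance_of_domain_subspaces[OF _ S L(1)])
      have "open ((+) p -` U)" by (intro open_vimage U continuous_intros)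
      then show "openin (top_of_set S) R" unfolding R_def by (rule openin_open_Int)
      show "dim L \<le> dim S" using L(2) dimS by simp
      show "continuous_on R (\<lambda>u. \<Phi> (p + u))"
        by (rule continuous_on_compose2[OF contU]) (use RMU in \<open>auto intro: continuous_intros\<close>)
      show "(\<lambda>u. \<Phi> (p + u)) \<in> R \<rightarrow> L"
      proof
        fix u assume "u \<in> R"
        from imageI[OF RMU[OF this], of \<Phi>] show "\<Phi> (p + u) \<in> L" unfolding chL by simp
      qed
      show "inj_on (\<lambda>u. \<Phi> (p + u)) R"
      proof (rule inj_onI)
        fix u w assume uw: "u \<in> R" "w \<in> R" "\<Phi> (p + u) = \<Phi> (p + w)"
        then have "\<Psi> (\<Phi> (p + u)) = \<Psi> (\<Phi> (p + w))" by simp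
        then show "u = w" using injU RMU[OF uw(1)] RMU[OF uw(2)] by simp
      qed
    qed
    then obtain Z where Z: "open Z" "(\<lambda>u. \<Phi> (p + u)) ` R = L \<inter> Z" unfolding openin_open by blast
    have "open (U \<inter> \<Phi> -` Z)" by (rule continuous_open_preimage[OF contU U(1) Z(1)])
    then have "openin (top_of_set M) (M \<inter> (U \<inter> \<Phi> -` Z))" by (rule openin_open_Int)
    moreover have "q \<in> M \<inter> (U \<inter> \<Phi> -` Z)"
    proof -
      obtain u where u: "u \<in> S" "q = p + u" using q by blast
      then have "\<Phi> q \<in> L \<inter> Z" unfolding Z(2)[symmetric] using U(2) by (auto simp: R_def)
      then show ?thesis using \<open>q \<in> M\<close> U(2) by simp
    qed
    moreover have "M \<inter> (U \<inter> \<Phi> -` Z) \<subseteq> (+) p ` S"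
    proof
      fix x assume x: "x \<in> M \<inter> (U \<inter> \<Phi> -` Z)"
      then have "\<Phi> x \<in> L \<inter> W" unfolding chL[symmetric] by blast
      with x have "\<Phi> x \<in> L \<inter> Z" by simp
      then obtain u where u: "u \<in> R" "\<Phi> x = \<Phi> (p + u)" unfolding Z(2)[symmetric] by blast
      then have "\<Psi> (\<Phi> x) = \<Psi> (\<Phi> (p + u))" by simp
      then have "x = p + u" using injU RMU[OF u(1)] x by simp
      then show "x \<in> (+) p ` S" using u(1) by (simp add: R_def)
    qed
    ultimately show "\<exists>T. openin (top_of_set M) T \<and> q \<in> T \<and> T \<subseteq> (+) p ` S"
      by (intro exI[of _ "M \<inter> (U \<inter> \<Phi> -` Z)"] conjI)
  qed
  moreover have "closedin (top_of_set M) ((+) p ` S)"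
    by (rule closed_subset[OF AM closed_translation[OF closed_subspace[OF S]]])
  moreover have "(+) p ` S \<noteq> {}" using subspace_0[OF S] by blast
  ultimately have "(+) p ` S = M"
    using conn unfolding connected_clopen by blast
  then show "M = (+) p ` tangent_space M p" by (simp add: S_def)
qed

subsection \<open>The smooth inverse function theorem\<close>

text \<open>The coordinate of \<open>inv (f' x) v\<close> along a basis vector \<open>b\<close> is read off by pairing \<open>v\<close> with the
  component of \<open>f' x b\<close> orthogonal to the images of the other basis vectors.\<close>

lemma smooth_open_inv_linear:
  fixes f' :: "'a::euclidean_space \<Rightarrow> 'a \<Rightarrow> 'a"
  assumes U: "open U" and lin: "\<And>x. x \<in> U \<Longrightarrow> linear (f' x)" and bij: "\<And>x. x \<in> U \<Longrightarrow> bij (f' x)"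
    and sm: "\<And>v. smooth_open U (\<lambda>x. f' x v)"
  shows "smooth_open U (\<lambda>x. inv_into UNIV (f' x) v)"
proof -
  have coord: "smooth_open U (\<lambda>x. inv_into UNIV (f' x) v \<bullet> b)" if b: "b \<in> Basis" for b
  proof -
    define k where "k = card (Basis - {b} :: 'a set)"
    obtain l where l: "bij_betw l {0..<k} (Basis - {b} :: 'a set)"
      unfolding k_def using ex_bij_betw_nat_finite[of "Basis - {b} :: 'a set"] by auto
    have "{l i | i. i < k} = l ` {0..<k}" by auto
    then have lB: "{l i | i. i < k} = Basis - {b}" using l by (simp add: bij_betw_def)
    define S where "S x = span {f' x (l i) | i. i < k}" for x
    have sub: "subspace (S x)" for x by (simp add: S_def)
    have Simg: "S x = f' x ` span (Basis - {b})" if x: "x \<in> U" for x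
    proof -
      have "{f' x (l i) | i. i < k} = f' x ` (Basis - {b})" unfolding lB[symmetric] by blast
      then show ?thesis unfolding S_def by (simp add: linear_span_image[OF lin[OF x]])
    qed
    have inj: "inj (f' x)" if "x \<in> U" for x using bij[OF that] by (rule bij_is_inj)
    have ind: "independent (Basis - {b} :: 'a set)"
      by (rule independent_mono[OF independent_Basis]) blast
    have dimS: "dim (S x) = k" if x: "x \<in> U" for x
    proof -
      have "dim (S x) = dim (span (Basis - {b} :: 'a set))"
        unfolding Simg[OF x] by (rule dim_image_eq[OF lin[OF x] inj_on_subset[OF inj[OF x] subset_UNIV]])
      also have "\<dots> = k" unfolding dim_span k_def by (rule dim_eq_card_independent[OF ind])
      finally show ?thesis .
    qed
    define u where "u x = f' x b - orth_proj (S x) (f' x b)" for x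
    have usm: "smooth_open U u"
    proof (rule smooth_open_Un[OF U])
      fix q assume q: "q \<in> U"
      obtain V where V: "q \<in> V" "V \<subseteq> U" "open V" "\<forall>v. smooth_open V (\<lambda>x. orth_proj (S x) v)"
        unfolding S_def
        by (rule smooth_orth_proj_frame[where k = k and F = "\<lambda>i x. f' x (l i)", OF _ U q dimS[OF q, unfolded S_def]])
          (use sm in blast)
      have smV: "smooth_open V (\<lambda>x. f' x b)" by (rule smooth_open_subset[OF sm V(3,2)])
      have "smooth_open V u" unfolding u_def
        by (intro smooth_open_diff smV smooth_open_orth_proj_field[OF V(3) sub spec[OF V(4)] smV])
      with V(1) show "\<exists>V. q \<in> V \<and> smooth_open V u" by blast
    qed
    have uperp: "u x \<in> orthogonal_comp (S x)" for x unfolding u_def by (rule orth_proj_in(2)[OF sub])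
    have bu: "f' x b \<bullet> u x = u x \<bullet> u x" for x
    proof -
      have "orth_proj (S x) (f' x b) \<bullet> u x = 0" by (rule orthogonal_compD[OF uperp orth_proj_in(1)[OF sub]])
      moreover have "f' x b = u x + orth_proj (S x) (f' x b)" by (simp add: u_def)
      ultimately show ?thesis by (metis add.right_neutral inner_add_left)
    qed
    have unz: "u x \<noteq> 0" if x: "x \<in> U" for x
    proof
      assume "u x = 0"
      then have "f' x b = orth_proj (S x) (f' x b)" by (simp add: u_def)
      then have "f' x b \<in> S x" using orth_proj_in(1)[OF sub, of x "f' x b"] by simp
      then have "b \<in> span (Basis - {b})" unfolding Simg[OF x] using inj[OF x] by (simp add: inj_image_mem_iff)
      then have "dependent (Basis :: 'a set)" using b by (auto simp: dependent_def)
      then show False using independent_Basis by blast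
    qed
    have eq: "(v \<bullet> u x) / (u x \<bullet> u x) = inv_into UNIV (f' x) v \<bullet> b" if x: "x \<in> U" for x
    proof -
      define a where "a = inv_into UNIV (f' x) v"
      have "v = f' x a" unfolding a_def using bij[OF x] by (simp add: bij_is_surj surj_f_inv_f)
      then have "v = (\<Sum>c\<in>Basis. (a \<bullet> c) *\<^sub>R f' x c)" using linear_euclidean_expand[OF lin[OF x], of a] by simp
      then have "v \<bullet> u x = (\<Sum>c\<in>Basis. (a \<bullet> c) * (f' x c \<bullet> u x))" by (simp add: inner_sum_left)
      also have "\<dots> = (\<Sum>c\<in>Basis. if c = b then (a \<bullet> b) * (u x \<bullet> u x) else 0)"
      proof (rule sum.cong[OF refl])
        fix c :: 'a assume c: "c \<in> Basis"
        show "(a \<bullet> c) * (f' x c \<bullet> u x) = (if c = b then (a \<bullet> b) * (u x \<bullet> u x) else 0)"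
        proof (cases "c = b")
          case False
          then have "c \<in> span (Basis - {b})" using c by (intro span_base) simp
          then have "f' x c \<in> S x" unfolding Simg[OF x] by (rule imageI)
          then have "f' x c \<bullet> u x = 0" by (rule orthogonal_compD[OF uperp])
          with False show ?thesis by simp
        qed (simp add: bu)
      qed
      also have "\<dots> = (a \<bullet> b) * (u x \<bullet> u x)" using b by simp
      finally show ?thesis using unz[OF x] by (simp add: a_def)
    qed
    have "smooth_open U (\<lambda>x. (v \<bullet> u x) / (u x \<bullet> u x))"
      by (rule smooth_open_divide[OF smooth_open_linear[OF bounded_linear_inner_right usm]
            smooth_open_bilinear[OF bounded_bilinear_inner usm usm]]) (use unz in simp)
    then show ?thesis by (rule smooth_open_cong) (rule eq)
  qed
  have "smooth_open U (\<lambda>x. \<Sum>b\<in>Basis. (inv_into UNIV (f' x) v \<bullet> b) *\<^sub>R b)"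
    by (intro smooth_open_sum U smooth_open_bilinear[OF bounded_bilinear_scaleR] coord smooth_open_const)
  then show ?thesis by (rule smooth_open_cong) (rule euclidean_representation)
qed

text \<open>Bootstrapping: the derivative of \<open>g\<close> at \<open>y\<close> is the inverse of
  the derivative of \<open>F\<close> at \<open>g y\<close>. Being a smooth function composed with
  \<open>g\<close>, it is as regular as \<open>g\<close>, so \<open>g\<close> gains one order in
  each step.\<close>

lemma smooth_inverse_function:
  fixes F :: "'a::euclidean_space \<Rightarrow> 'a"
  assumes F: "smooth_open U F" and x0: "x0 \<in> U" and id: "\<And>v. frechet_derivative F (at x0) v = v"
  obtains V g where "open V" "F x0 \<in> V" "smooth_open V g" "g ` V \<subseteq> U" "g (F x0) = x0" "\<forall>y\<in>V. F (g y) = y"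
proof -
  have U: "open U" using F by (simp add: smooth_open_def)
  define f' where "f' x = Blinfun (frechet_derivative F (at x))" for x
  have der: "(F has_derivative frechet_derivative F (at x)) (at x)" if "x \<in> U" for x
    by (rule smooth_open_has_derivative[OF F that])
  have app: "blinfun_apply (f' x) = frechet_derivative F (at x)" if "x \<in> U" for x
    unfolding f'_def by (rule bounded_linear_Blinfun_apply[OF has_derivative_bounded_linear[OF der[OF that]]])
  have cont: "continuous_on U f'"
  proof (rule continuous_on_blinfun_componentwise)
    fix i :: 'a
    have "continuous_on U (\<lambda>x. frechet_derivative F (at x) i)"
      by (rule smooth_open_continuous[OF smooth_open_frechet_derivative[OF F]])
    then show "continuous_on U (\<lambda>x. blinfun_apply (f' x) i)"
      by (rule continuous_on_eq) (simp add: app)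
  qed
  have idf: "id_blinfun o\<^sub>L f' x0 = id_blinfun" by (rule blinfun_eqI) (simp add: app[OF x0] id)
  have der': "(F has_derivative blinfun_apply (f' x)) (at x)" if "x \<in> U" for x
    unfolding app[OF that] by (rule der[OF that])
  obtain U' V g g' where U': "open U'" "U' \<subseteq> U" "x0 \<in> U'" and V: "open V" "F x0 \<in> V"
    and hom: "homeomorphism U' V F g" and g: "\<And>y. y \<in> V \<Longrightarrow> (g has_derivative g' y) (at y)"
    and g': "\<And>y. y \<in> V \<Longrightarrow> g' y = inv_into UNIV (blinfun_apply (f' (g y)))"
    and bij: "\<And>y. y \<in> V \<Longrightarrow> bij (blinfun_apply (f' (g y)))"
    by (rule inverse_function_theorem[OF U _ cont x0 idf], erule der', rule that)
  have gU: "g y \<in> U'" if "y \<in> V" for y using hom that by (auto simp: homeomorphism_def)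
  have Fg: "F (g y) = y" if "y \<in> V" for y using hom that by (auto simp: homeomorphism_def)
  have gF: "g (F x) = x" "F x \<in> V" if "x \<in> U'" for x using hom that by (auto simp: homeomorphism_def)
  let ?A = "\<lambda>v x. inv_into UNIV (frechet_derivative F (at x)) v"
  have A: "smooth_open U' (?A v)" for v
  proof (rule smooth_open_inv_linear[OF U'(1)])
    fix x assume x: "x \<in> U'"
    then have xU: "x \<in> U" using U'(2) by blast
    show "linear (frechet_derivative F (at x))" by (rule has_derivative_linear[OF der[OF xU]])
    show "bij (frechet_derivative F (at x))" using bij[OF gF(2)[OF x]] by (simp add: gF(1)[OF x] app[OF xU])
  next
    show "smooth_open U' (\<lambda>x. frechet_derivative F (at x) v)" for v
      by (rule smooth_open_subset[OF smooth_open_frechet_derivative[OF F] U'(1,2)])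
  qed
  have gder: "(g has_derivative (\<lambda>v. ?A v (g y))) (at y)" if y: "y \<in> V" for y
  proof -
    have "g y \<in> U" using gU[OF y] U'(2) by blast
    then have "g' y = (\<lambda>v. ?A v (g y))" using g'[OF y] by (simp add: app)
    with g[OF y] show ?thesis by simp
  qed
  have "C_on n V g" for n
  proof (induction n)
    case 0
    show ?case using hom by (simp add: homeomorphism_def)
  next
    case (Suc n)
    show ?case
    proof (rule C_on_SucI[OF V(1)])
      show "(g has_derivative (\<lambda>v. ?A v (g y))) (at y)" if "y \<in> V" for y by (rule gder[OF that])
      show "C_on n V (\<lambda>y. ?A v (g y))" for v
        by (rule C_on_compose[OF V(1) U'(1) _ Suc]) (use gU A in \<open>auto simp: smooth_open_def\<close>)
    qed
  qed
  then have "smooth_open V g" using V(1) by (simp add: smooth_open_def)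
  then show thesis
    by (rule that[OF V]) (use gU U'(2,3) gF(1) Fg in auto)
qed

subsection \<open>Geometry of the orbits\<close>

lemma exp_scaleR_has_derivative:
  fixes X :: "'v::euclidean_space endo" and c :: "'a::euclidean_space \<Rightarrow> real"
  assumes "(c has_derivative c') (at x)"
  shows "((\<lambda>x. exp (c x *\<^sub>R X)) has_derivative (\<lambda>v. c' v *\<^sub>R (X * exp (c x *\<^sub>R X)))) (at x)"
  using has_derivative_compose[OF assms exp_scaleR_has_vector_derivative_left[of X "c x", unfolded has_vector_derivative_def]] .

text \<open>The vector \<open>g x\<close> is allowed to vary so that the induction closes:
  differentiation produces terms of the same shape, with \<open>g\<close> or its derivative and with
  linear maps applied outside.\<close>

lemma C_on_exp_apply:
  fixes X :: "'v::euclidean_space endo" and c :: "'a::euclidean_space \<Rightarrow> real"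
  assumes U: "open U" and "C_on n U c" "C_on n U g"
  shows "C_on n U (\<lambda>x. exp (c x *\<^sub>R X) \<star> g x)"
  using assms(2,3)
proof (induction n arbitrary: g)
  case 0
  have "continuous_on UNIV (\<lambda>t. exp (t *\<^sub>R X))"
    by (rule continuous_at_imp_continuous_on)
      (simp add: has_vector_derivative_continuous[OF exp_scaleR_has_vector_derivative_left])
  then have "continuous_on U (\<lambda>x. exp (c x *\<^sub>R X))"
    by (rule continuous_on_compose2) (use 0 in auto)
  with 0 show ?case by (simp add: endo.continuous_on)
next
  case (Suc n)
  note D = C_on_SucD[OF Suc.prems(1)] C_on_SucD[OF Suc.prems(2)]
  note M = C_on_Suc_mono[OF Suc.prems(1)] C_on_Suc_mono[OF Suc.prems(2)]
  let ?c = "\<lambda>x. frechet_derivative c (at x)" and ?g = "\<lambda>x. frechet_derivative g (at x)"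
  have der: "((\<lambda>x. exp (c x *\<^sub>R X) \<star> g x) has_derivative
      (\<lambda>v. exp (c x *\<^sub>R X) \<star> ?g x v + (?c x v *\<^sub>R (X * exp (c x *\<^sub>R X))) \<star> g x)) (at x)" if "x \<in> U" for x
    by (rule bounded_bilinear.FDERIV[OF bounded_bilinear_endo_apply
          exp_scaleR_has_derivative[OF D(1)[OF that]] D(3)[OF that]])
  have "C_on n U (\<lambda>x. exp (c x *\<^sub>R X) \<star> ?g x v + ?c x v *\<^sub>R (X \<star> exp (c x *\<^sub>R X) \<star> g x))" for v
    by (intro C_on_add U Suc.IH M D(4) C_on_bilinear[OF bounded_bilinear_scaleR U D(2)]
        C_on_linear[OF endo.bounded_linear_right U])
  then have "C_on n U (\<lambda>x. exp (c x *\<^sub>R X) \<star> ?g x v + (?c x v *\<^sub>R (X * exp (c x *\<^sub>R X))) \<star> g x)" for v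
    by (simp add: endo.scaleR_left)
  then show ?case by (intro C_on_SucI[OF U der])
qed

lemma smooth_open_exp_apply:
  "smooth_open U c \<Longrightarrow> smooth_open U g \<Longrightarrow> smooth_open U (\<lambda>x. exp (c x *\<^sub>R X) \<star> g x)"
  by (simp add: smooth_open_def C_on_exp_apply)

context orth_group
begin

definition orb :: "'v \<Rightarrow> 'v set" where
  "orb p = (\<lambda>A. A \<star> p) ` K"

lemma self_orb: "p \<in> orb p"
  unfolding orb_def by (rule image_eqI[of _ _ 1]) (simp_all add: one_K)

lemma K_orb: "A \<in> K \<Longrightarrow> q \<in> orb p \<Longrightarrow> A \<star> q \<in> orb p"
  unfolding orb_def by (auto intro!: image_eqI[of _ _ "A * _"] mult_K)

lemma orb_eq: assumes "q \<in> orb p" shows "orb q = orb p"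
proof -
  obtain A where A: "A \<in> K" "q = A \<star> p" using assms by (auto simp: orb_def)
  have "p \<in> orb q" unfolding orb_def A(2)
    by (rule image_eqI[of _ _ "inv_K A"]) (simp_all add: inv_K inv_K_apply A)
  have sub: "orb y \<subseteq> orb x" if "y \<in> orb x" for x y
  proof
    fix z assume "z \<in> orb y"
    then obtain B where "B \<in> K" "z = B \<star> y" by (auto simp: orb_def)
    with K_orb that show "z \<in> orb x" by simp
  qed
  show ?thesis using sub[OF assms] sub[OF \<open>p \<in> orb q\<close>] by blast
qed

lemma exp_curve: "smooth_open UNIV (\<lambda>t. exp (t *\<^sub>R X) \<star> (p :: 'v))"
  by (intro smooth_open_exp_apply smooth_open_ident smooth_open_const open_UNIV)

lemma exp_curve_orb: "X \<in> lie \<Longrightarrow> exp (t *\<^sub>R X) \<star> p \<in> orb p"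
  using K_orb[OF exp_lie self_orb] .

lemma exp_curve_velocity: "((\<lambda>t. exp (t *\<^sub>R X) \<star> (p :: 'v)) has_vector_derivative X \<star> p) (at 0)"
  using exp_endo_has_vector_derivative[of X p 0] by simp

text \<open>A curve in the orbit need not come with a lift to the group. Group elements are chosen
  only along a null sequence of parameters, with no continuity, and \<open>tan_velocity\<close> asks
  for no more.\<close>

lemma tangent_space_orb:
  assumes "q \<in> orb p" shows "tangent_space (orb p) q = tan_space q"
proof -
  have "tangent_space (orb q) q = tan_space q"
  proof
    show "tan_space q \<subseteq> tangent_space (orb q) q"
    proof
      fix v assume "v \<in> tan_space q"
      then obtain X where X: "X \<in> lie" "v = X \<star> q" by (auto simp: tan_space_def)
      show "v \<in> tangent_space (orb q) q"
      proof (rule tangent_spaceI[OF zero_less_one, of "\<lambda>t. exp (t *\<^sub>R X) \<star> q"])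
        show "smooth_open {- 1<..<1} (\<lambda>t. exp (t *\<^sub>R X) \<star> q)"
          by (rule smooth_open_subset[OF exp_curve]) auto
        show "((\<lambda>t. exp (t *\<^sub>R X) \<star> q) has_vector_derivative v) (at 0)"
          unfolding X(2) by (rule exp_curve_velocity)
      qed (simp_all add: exp_curve_orb[OF X(1)])
    qed
    show "tangent_space (orb q) q \<subseteq> tan_space q"
    proof
      fix v assume "v \<in> tangent_space (orb q) q"
      then obtain \<epsilon> c where c: "\<epsilon> > 0" "c ` {-\<epsilon><..<\<epsilon>} \<subseteq> orb q" "c 0 = q"
        "(c has_vector_derivative v) (at 0)" by (rule tangent_spaceE)
      obtain s where s0: "s \<longlonglongrightarrow> 0" and spos: "\<And>n. s n > 0" "\<And>n. s n < \<epsilon>"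
        by (rule null_sequence_below[OF c(1)]) blast
      have "\<exists>A. A \<in> K \<and> c (s n) = A \<star> q" for n
      proof -
        have "s n \<in> {-\<epsilon><..<\<epsilon>}" using spos[of n] c(1) by simp
        then have "c (s n) \<in> orb q" using c(2) by blast
        then show ?thesis by (auto simp: orb_def)
      qed
      from choice[OF allI[OF this]] obtain a where a: "\<forall>n. a n \<in> K \<and> c (s n) = a n \<star> q" ..
      have "(\<lambda>n. (c (s n) - c 0) /\<^sub>R s n) \<longlonglongrightarrow> v"
        by (rule has_vector_derivative_quotient_seq[OF c(4) s0]) (use spos(1) less_imp_neq in fastforce)
      then have "(\<lambda>n. (a n \<star> q - q) /\<^sub>R s n) \<longlonglongrightarrow> v" using a c(3) by simp
      with a show "v \<in> tan_space q" by (intro tan_velocity[OF _ spos(1) s0]) simp_all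
    qed
  qed
  then show ?thesis using orb_eq[OF assms] by simp
qed

text \<open>Elements \<open>Y i\<close> of \<open>lie\<close> are fixed at \<open>q\<close> and used
  as linear vector fields. They stay independent nearby, and as the dimension is constant along the
  orbit they still span.\<close>

lemma orb_tangent_frames: "tangent_frames (orb p) tan_space (dim (tan_space p))"
  unfolding tangent_frames_def
proof
  fix q assume q: "q \<in> orb p"
  define d where "d = dim (tan_space p)"
  have dimd: "dim (tan_space x) = d" if "x \<in> orb p" for x
    using that dim_tan_K unfolding orb_def d_def by auto
  obtain l where l0: "tan_space q = span {l i | i. i < dim (tan_space q)}"
    by (rule indexed_basis[OF subspace_tan])
  then have l: "tan_space q = span {l i | i. i < d}" by (simp add: dimd[OF q])
  have "\<forall>i. \<exists>X. i < d \<longrightarrow> X \<in> lie \<and> X \<star> q = l i"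
  proof
    fix i show "\<exists>X. i < d \<longrightarrow> X \<in> lie \<and> X \<star> q = l i"
    proof (cases "i < d")
      case True
      then have "l i \<in> span {l i | i. i < d}" by (intro span_base) blast
      then show ?thesis unfolding l[symmetric] tan_space_def by auto
    qed simp
  qed
  from choice[OF this] obtain Y where Y: "\<forall>i. i < d \<longrightarrow> Y i \<in> lie \<and> Y i \<star> q = l i" ..
  have sm: "smooth_open UNIV (\<lambda>x. Y i \<star> x)" for i
    by (intro smooth_open_linear[OF endo.bounded_linear_right] smooth_open_ident open_UNIV)
  have "{Y i \<star> q | i. i < d} = {l i | i. i < d}"
    unfolding setcompr_eq_image by (rule image_cong) (use Y in auto)
  then have "span {Y i \<star> q | i. i < d} = tan_space q" using l by simp
  then have dq: "dim (span {Y i \<star> q | i. i < d}) = d" using dimd[OF q] by simp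
  obtain V where V: "q \<in> V" "open V" "\<forall>x\<in>V. dim (span {Y i \<star> x | i. i < d}) = d"
    by (rule smooth_orth_proj_frame[where k = d and F = "\<lambda>i x. Y i \<star> x", OF _ open_UNIV UNIV_I dq])
      (use sm in blast)
  have tF: "tan_space x = span {Y i \<star> x | i. i < d} \<and> dim (tan_space x) = d" if x: "x \<in> orb p \<inter> V" for x
  proof -
    have dx: "dim (tan_space x) = d" using dimd x by blast
    have "{Y i \<star> x | i. i < d} \<subseteq> tan_space x" using Y by (auto simp: tan_space_def)
    then have "span {Y i \<star> x | i. i < d} \<subseteq> tan_space x" by (rule span_minimal[OF _ subspace_tan])
    moreover have "dim (span {Y i \<star> x | i. i < d}) = d" using V(3) x by blast
    ultimately have "span {Y i \<star> x | i. i < d} = tan_space x"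
      using dx by (intro subspace_dim_equal subspace_span subspace_tan) simp_all
    with dx show ?thesis by simp
  qed
  have smV: "smooth_open V (\<lambda>x. Y i \<star> x)" for i by (rule smooth_open_subset[OF sm V(2)]) simp
  show "\<exists>U F. open U \<and> q \<in> U \<and> (\<forall>i<dim (tan_space p). smooth_open U (F i)) \<and>
     (\<forall>x\<in>orb p \<inter> U. tan_space x = span {F i x | i. i < dim (tan_space p)} \<and> dim (tan_space x) = dim (tan_space p))"
    unfolding d_def[symmetric]
    by (rule exI[of _ V], rule exI[of _ "\<lambda>i x. Y i \<star> x"])
      (intro conjI[OF V(2)] conjI[OF V(1)] conjI allI impI ballI smV tF)
qed

end

text \<open>Coordinates of the second kind; only finitely many one-parameter groups are multiplied, which
  avoids differentiating \<open>exp\<close> in noncommuting directions.\<close>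

primrec coord_prod :: "(nat \<Rightarrow> 'v::euclidean_space endo) \<Rightarrow> (nat \<Rightarrow> 'v) \<Rightarrow> nat \<Rightarrow> 'v \<Rightarrow> 'v endo" where
  "coord_prod Y l 0 w = 1"
| "coord_prod Y l (Suc m) w = coord_prod Y l m w * exp ((w \<bullet> l m) *\<^sub>R Y m)"

lemma coord_prod_smooth:
  "smooth_open U g \<Longrightarrow> smooth_open U (\<lambda>w. coord_prod Y l m w \<star> g w)"
proof (induction m arbitrary: g)
  case (Suc m)
  have "open U" using Suc.prems by (simp add: smooth_open_def)
  then have "smooth_open U (\<lambda>w. exp ((w \<bullet> l m) *\<^sub>R Y m) \<star> g w)"
    by (intro smooth_open_exp_apply Suc.prems smooth_open_linear[OF bounded_linear_inner_left] smooth_open_ident)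
  from Suc.IH[OF this] show ?case by simp
qed simp

lemma coord_prod_0: "coord_prod Y l m 0 = 1"
  by (induction m) simp_all

lemma coord_prod_has_derivative:
  "(coord_prod Y l m has_derivative (\<lambda>v. \<Sum>i<m. (v \<bullet> l i) *\<^sub>R Y i)) (at 0)"
proof (induction m)
  case 0
  have "coord_prod Y l 0 = (\<lambda>w. 1)" by (intro ext) simp
  then show ?case by simp
next
  case (Suc m)
  have "((\<lambda>w. w \<bullet> l m) has_derivative (\<lambda>v. v \<bullet> l m)) (at 0)"
    by (rule bounded_linear.has_derivative[OF bounded_linear_inner_left has_derivative_ident])
  from has_derivative_mult[OF Suc exp_scaleR_has_derivative[OF this]]
  have "((\<lambda>w. coord_prod Y l m w * exp ((w \<bullet> l m) *\<^sub>R Y m)) has_derivative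
      (\<lambda>v. coord_prod Y l m 0 * ((v \<bullet> l m) *\<^sub>R (Y m * exp ((0 \<bullet> l m) *\<^sub>R Y m)))
        + (\<Sum>i<m. (v \<bullet> l i) *\<^sub>R Y i) * exp ((0 \<bullet> l m) *\<^sub>R Y m))) (at 0)" .
  moreover have "coord_prod Y l (Suc m) = (\<lambda>w. coord_prod Y l m w * exp ((w \<bullet> l m) *\<^sub>R Y m))"
    by (intro ext) simp
  ultimately show ?case by (simp add: coord_prod_0 add.commute)
qed

section \<open>Local sections of the orbit map and equivariant normal fields\<close>

context orth_group
begin

lemma coord_prod_K: "(\<And>i. i < m \<Longrightarrow> Y i \<in> lie) \<Longrightarrow> coord_prod Y l m w \<in> K"
  by (induction m) (simp_all add: one_K mult_K exp_lie)

text \<open>The map \<open>F\<close> takes the slice point with normal coordinate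
  \<open>w - T w\<close> and moves it by exponentials in the tangential coordinates of
  \<open>w\<close>. Its derivative at 0 is the identity, so it has a smooth local inverse
  \<open>g\<close>. For points of the orbit the normal coordinate must vanish, and then the
  exponential part alone carries \<open>p\<close> to the point.\<close>

lemma local_orbit_section:
  obtains V g Y l d where "open V" "p \<in> V" "smooth_open V g" "\<forall>i<d. Y i \<in> lie"
    "\<forall>x\<in>V \<inter> orb p. coord_prod Y l d (g x) \<star> p = x"
proof -
  obtain B where B: "B \<subseteq> tan_space p" "pairwise orthogonal B" "\<And>x. x \<in> B \<Longrightarrow> norm x = 1"
    "independent B" "card B = dim (tan_space p)" "span B = tan_space p"
    by (rule orthonormal_basis_subspace[OF subspace_tan]) (rule that)
  define d where "d = card B"
  have "finite B" using B(4) by (rule independent_imp_finite)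
  from ex_bij_betw_nat_finite[OF this] obtain l where "bij_betw l {0..<d} B" unfolding d_def ..
  then have l: "inj_on l {0..<d}" "l ` {0..<d} = B" by (auto simp: bij_betw_def)
  have ortho: "l i \<bullet> l j = (if i = j then 1 else 0)" if "i < d" "j < d" for i j
  proof (cases "i = j")
    case True
    have "l i \<in> B" using l(2) that by auto
    then show ?thesis using B(3) True by (simp add: dot_square_norm)
  next
    case False
    have "l i \<in> B" "l j \<in> B" using l(2) that by auto
    moreover have "l i \<noteq> l j" using inj_onD[OF l(1), of i j] that False by auto
    ultimately show ?thesis using B(2) False by (simp add: pairwise_def orthogonal_def)
  qed
  have "\<forall>i. \<exists>X. i < d \<longrightarrow> X \<in> lie \<and> X \<star> p = l i"
  proof
    fix i show "\<exists>X. i < d \<longrightarrow> X \<in> lie \<and> X \<star> p = l i"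
    proof (cases "i < d")
      case True
      then have "l i \<in> B" using l(2) by auto
      then have "l i \<in> tan_space p" using B(1) by blast
      then show ?thesis unfolding tan_space_def by auto
    qed simp
  qed
  from choice[OF this] obtain Y where Y: "\<forall>i. i < d \<longrightarrow> Y i \<in> lie \<and> Y i \<star> p = l i" ..
  \<comment> \<open>Orthogonal projection onto \<open>tan_space p\<close>, written in the
    orthonormal basis \<open>l\<close>; as \<open>Y i \<star> p = l i\<close>, it equals the
    derivative of \<open>coord_prod\<close> at 0 applied to \<open>p\<close>.\<close>
  define T where "T w = (\<Sum>i<d. (w \<bullet> l i) *\<^sub>R l i)" for w
  have T_nor: "w - T w \<in> nor_space p" for w
  proof -
    have lT: "l j \<bullet> (w - T w) = 0" if "j < d" for j
    proof -
      have "l j \<bullet> T w = (\<Sum>i<d. if i = j then w \<bullet> l j else 0)"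
        unfolding T_def inner_sum_right by (rule sum.cong) (use ortho that in auto)
      also have "\<dots> = w \<bullet> l j" using that by simp
      finally show ?thesis by (simp add: inner_diff_right inner_commute)
    qed
    have "\<forall>x\<in>B. orthogonal (w - T w) x" unfolding l(2)[symmetric]
      using lT by (auto simp: orthogonal_def inner_commute)
    then have "orthogonal (w - T w) y" if "y \<in> span B" for y using that orthogonal_to_span by blast
    then show ?thesis unfolding nor_space_def B(6)[symmetric]
      by (intro orthogonal_compI) (simp add: orthogonal_def inner_commute)
  qed
  have T0: "T 0 = 0" by (simp add: T_def)
  have Tsm: "smooth_open UNIV T" unfolding T_def
    by (intro smooth_open_sum smooth_open_bilinear[OF bounded_bilinear_scaleR] smooth_open_const
        smooth_open_linear[OF bounded_linear_inner_left] smooth_open_ident open_UNIV)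
  have Tder: "(T has_derivative T) (at 0)"
  proof -
    have "T = (\<lambda>w. \<Sum>i<d. (w \<bullet> l i) *\<^sub>R l i)" by (intro ext) (simp add: T_def)
    moreover have "bounded_linear (\<lambda>w. \<Sum>i<d. (w \<bullet> l i) *\<^sub>R l i)"
      by (intro bounded_linear_sum bounded_linear_compose[OF bounded_linear_scaleR_left bounded_linear_inner_left])
    ultimately have "bounded_linear T" by simp
    then show ?thesis by (rule bounded_linear_imp_has_derivative)
  qed
  define P where "P = coord_prod Y l d"
  define F where "F w = P w \<star> (p + (w - T w))" for w
  have qsm: "smooth_open UNIV (\<lambda>w. p + (w - T w))"
    by (intro smooth_open_add smooth_open_diff Tsm smooth_open_const smooth_open_ident open_UNIV)
  have Fsm: "smooth_open UNIV F" unfolding F_def P_def by (rule coord_prod_smooth[OF qsm])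
  have F0: "F 0 = p" by (simp add: F_def P_def coord_prod_0 T0)
  have "((\<lambda>w. p + (w - T w)) has_derivative (\<lambda>v. 0 + (v - T v))) (at 0)"
    by (intro has_derivative_add has_derivative_diff has_derivative_ident has_derivative_const Tder)
  from bounded_bilinear.FDERIV[OF bounded_bilinear_endo_apply coord_prod_has_derivative this, of Y l d]
  have "(F has_derivative (\<lambda>v. P 0 \<star> (0 + (v - T v)) + (\<Sum>i<d. (v \<bullet> l i) *\<^sub>R Y i) \<star> (p + (0 - T 0)))) (at 0)"
    unfolding F_def P_def .
  moreover have "P 0 \<star> (0 + (v - T v)) + (\<Sum>i<d. (v \<bullet> l i) *\<^sub>R Y i) \<star> (p + (0 - T 0)) = v" for v
  proof -
    have "(\<Sum>i<d. (v \<bullet> l i) *\<^sub>R Y i) \<star> p = (\<Sum>i<d. (v \<bullet> l i) *\<^sub>R (Y i \<star> p))"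
      by (simp add: endo.sum_left endo.scaleR_left)
    also have "\<dots> = T v" unfolding T_def by (rule sum.cong) (use Y in auto)
    finally show ?thesis by (simp add: P_def coord_prod_0 T0)
  qed
  ultimately have "(F has_derivative (\<lambda>v. v)) (at 0)" by simp
  from frechet_derivative_at[OF this] have Fder: "frechet_derivative F (at 0) v = v" for v
    by (rule fun_cong[OF sym])
  obtain V g where V: "open V" "F 0 \<in> V" "smooth_open V g" "g ` V \<subseteq> UNIV" "g (F 0) = 0"
    and Fg: "\<forall>y\<in>V. F (g y) = y"
    by (rule smooth_inverse_function[OF Fsm UNIV_I[of 0] Fder])
  from normal_slice_isolated[of p, folded orb_def]
  obtain e where e0: "e > 0 \<and> (\<forall>\<xi>\<in>nor_space p. norm \<xi> < e \<longrightarrow> p + \<xi> \<in> orb p \<longrightarrow> \<xi> = 0)"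
    by (rule exE)
  then have e: "e > 0" "\<And>\<xi>. \<xi> \<in> nor_space p \<Longrightarrow> norm \<xi> < e \<Longrightarrow> p + \<xi> \<in> orb p \<Longrightarrow> \<xi> = 0"
    by simp_all
  \<comment> \<open>Within radius \<open>e\<close> the slice meets the orbit only in
    \<open>p\<close>, so the neighbourhood is shrunk until normal coordinates stay below
    \<open>e\<close>.\<close>
  define V' where "V' = V \<inter> (\<lambda>y. norm (g y - T (g y))) -` {..<e}"
  have gsm: "smooth_open V (\<lambda>y. g y - T (g y))"
    by (rule smooth_open_diff[OF V(3) smooth_open_compose[OF V(3) Tsm subset_UNIV]])
  have V'o: "open V'" unfolding V'_def
    by (rule continuous_open_preimage[OF continuous_on_norm[OF smooth_open_continuous[OF gsm]] V(1) open_lessThan])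
  show thesis
  proof (rule that[of V' g d Y l])
    show "open V'" by (rule V'o)
    show "p \<in> V'" using V(2,5) e(1) unfolding F0 V'_def by (simp add: T0)
    show "smooth_open V' g" by (rule smooth_open_subset[OF V(3) V'o]) (simp add: V'_def)
    show "\<forall>i<d. Y i \<in> lie" using Y by blast
    show "\<forall>x\<in>V' \<inter> orb p. coord_prod Y l d (g x) \<star> p = x"
    proof
      fix x assume x: "x \<in> V' \<inter> orb p"
      define \<xi> where "\<xi> = g x - T (g x)"
      have PK: "P (g x) \<in> K" unfolding P_def by (rule coord_prod_K) (use Y in blast)
      have "x \<in> V" using x by (simp add: V'_def)
      from bspec[OF Fg this] have Fx: "P (g x) \<star> (p + \<xi>) = x" unfolding F_def \<xi>_def .
      \<comment> \<open>Undoing the motion keeps the point in the orbit and brings it back to the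
        slice, where \<open>p\<close> is the only candidate.\<close>
      have "inv_K (P (g x)) \<star> x \<in> orb p" using x by (intro K_orb inv_K PK) simp
      then have "inv_K (P (g x)) \<star> P (g x) \<star> (p + \<xi>) \<in> orb p" by (simp only: Fx)
      then have "p + \<xi> \<in> orb p" unfolding inv_K_apply(2)[OF PK] .
      moreover have "norm \<xi> < e" using x by (simp add: V'_def \<xi>_def)
      ultimately have "\<xi> = 0" using e(2)[OF T_nor[of "g x", folded \<xi>_def]] by blast
      then show "coord_prod Y l d (g x) \<star> p = x" using Fx by (simp add: P_def)
    qed
  qed
qed

text \<open>Two group elements that move \<open>p\<close> to the same point differ by an isotropy
  element, which fixes \<open>\<eta>\<close> by \<open>regular_fix_nor\<close>; so the choice in the
  definition of the field is harmless. Smoothness near \<open>A p\<close> comes from translating the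
  local section at \<open>p\<close> by \<open>A\<close>.\<close>

lemma equivariant_normal_field:
  assumes p: "regular p" and eta: "\<eta> \<in> nor_space p"
  obtains \<xi> where "smooth_on (orb p) \<xi>" "\<And>A. A \<in> K \<Longrightarrow> \<xi> (A \<star> p) = A \<star> \<eta>"
proof -
  define \<xi> where "\<xi> x = (SOME A. A \<in> K \<and> A \<star> p = x) \<star> \<eta>" for x
  have xi: "\<xi> (A \<star> p) = A \<star> \<eta>" if A: "A \<in> K" for A
  proof -
    define B where "B = (SOME B. B \<in> K \<and> B \<star> p = A \<star> p)"
    have B: "B \<in> K \<and> B \<star> p = A \<star> p" unfolding B_def by (rule someI[of _ A]) (simp add: A)
    have "inv_K A * B \<in> stab p"
      using B A inv_K(1)[OF A] by (simp add: stab_def mult_K inv_K_apply)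
    from regular_fix_nor[OF p this eta] have "A \<star> inv_K A \<star> B \<star> \<eta> = A \<star> \<eta>" by simp
    then have "B \<star> \<eta> = A \<star> \<eta>" unfolding inv_K_apply(1)[OF A] .
    then show ?thesis by (simp add: \<xi>_def B_def)
  qed
  obtain V g Y l d where V: "open V" "p \<in> V" "smooth_open V g" and Y: "\<forall>i<d. Y i \<in> lie"
    and loc: "\<forall>x\<in>V \<inter> orb p. coord_prod Y l d (g x) \<star> p = x"
    by (rule local_orbit_section[of p])
  have "smooth_on (orb p) \<xi>"
  proof (rule smooth_onI)
    fix x assume "x \<in> orb p"
    then obtain A where A: "A \<in> K" "x = A \<star> p" by (auto simp: orb_def)
    define V' where "V' = (\<lambda>y. inv_K A \<star> y) -` V"
    have V'o: "open V'" unfolding V'_def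
      by (intro open_vimage V(1) linear_continuous_on endo.bounded_linear_right)
    have gsm: "smooth_open V' (\<lambda>y. g (inv_K A \<star> y))"
      by (rule smooth_open_compose[OF smooth_open_linear[OF endo.bounded_linear_right smooth_open_ident[OF V'o]] V(3)])
        (auto simp: V'_def)
    have "smooth_open UNIV (\<lambda>w. coord_prod Y l d w \<star> \<eta>)"
      by (intro coord_prod_smooth smooth_open_const open_UNIV)
    from smooth_open_compose[OF gsm this subset_UNIV]
    have sm: "smooth_open V' (\<lambda>y. A \<star> coord_prod Y l d (g (inv_K A \<star> y)) \<star> \<eta>)"
      by (rule smooth_open_linear[OF endo.bounded_linear_right])
    have "x \<in> V'" using V(2) by (simp add: V'_def A inv_K_apply)
    moreover have "A \<star> coord_prod Y l d (g (inv_K A \<star> y)) \<star> \<eta> = \<xi> y" if y: "y \<in> orb p \<inter> V'" for y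
    proof -
      define B where "B = coord_prod Y l d (g (inv_K A \<star> y))"
      have BK: "B \<in> K" unfolding B_def by (rule coord_prod_K) (use Y in blast)
      have "inv_K A \<star> y \<in> V \<inter> orb p" using y K_orb[OF inv_K(1)[OF A(1)]] by (simp add: V'_def)
      then have "B \<star> p = inv_K A \<star> y" using loc by (simp add: B_def)
      then have "(A * B) \<star> p = y" by (simp add: inv_K_apply(1)[OF A(1)])
      then have "\<xi> y = (A * B) \<star> \<eta>" using xi[OF mult_K[OF A(1) BK]] by simp
      then show ?thesis by (simp add: B_def)
    qed
    ultimately show "\<exists>U F. smooth_open U F \<and> x \<in> U \<and> (\<forall>y\<in>orb p \<inter> U. F y = \<xi> y)"
      by (intro exI[of _ V'] exI[of _ "\<lambda>y. A \<star> coord_prod Y l d (g (inv_K A \<star> y)) \<star> \<eta>"] conjI sm ballI)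
  qed
  then show thesis using xi by (rule that)
qed

end

subsection \<open>Distributions on an orbit\<close>

text \<open>The frame fields of a \<open>distribution\<close> are smooth only along
  \<open>M\<close>, each with its own local extension; the finitely many neighbourhoods are
  intersected.\<close>

lemma smooth_on_common_extension:
  fixes F :: "nat \<Rightarrow> 'a::euclidean_space \<Rightarrow> 'b::euclidean_space"
  assumes "\<And>i. i < k \<Longrightarrow> smooth_on (M \<inter> U) (F i)" "open U" "p \<in> M" "p \<in> U"
  shows "\<exists>V G. open V \<and> p \<in> V \<and> V \<subseteq> U \<and> (\<forall>i<k. smooth_open V (G i)) \<and>
    (\<forall>i<k. \<forall>x\<in>M \<inter> V. G i x = F i x)"
  using assms(1)
proof (induction k)
  case 0
  then show ?case using assms(2-4) by (intro exI[of _ U]) simp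
next
  case (Suc k)
  then obtain V G where V: "open V" "p \<in> V" "V \<subseteq> U" and G: "\<forall>i<k. smooth_open V (G i)"
    "\<forall>i<k. \<forall>x\<in>M \<inter> V. G i x = F i x"
    by (metis less_Suc_eq)
  have "smooth_on (M \<inter> U) (F k)" by (rule Suc.prems) simp
  then obtain W H where W: "smooth_open W H" "p \<in> W" "\<forall>y\<in>(M \<inter> U) \<inter> W. H y = F k y"
    by (rule smooth_onE) (use assms in simp)
  have Wo: "open W" using W(1) by (simp add: smooth_open_def)
  show ?case
  proof (intro exI[of _ "V \<inter> W"] exI[of _ "G(k := H)"] conjI allI impI ballI)
    show "open (V \<inter> W)" using V(1) Wo by (rule open_Int)
    fix i assume i: "i < Suc k"
    show "smooth_open (V \<inter> W) ((G(k := H)) i)"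
    proof (cases "i = k")
      case True
      then show ?thesis using smooth_open_subset[OF W(1) open_Int[OF V(1) Wo]] by simp
    next
      case False
      with i G(1) have "smooth_open V (G i)" by simp
      from smooth_open_subset[OF this open_Int[OF V(1) Wo]] False show ?thesis by simp
    qed
    fix x assume "x \<in> M \<inter> (V \<inter> W)"
    then show "(G(k := H)) i x = F i x" using i G(2) W(3) V(3) by (cases "i = k") auto
  qed (use V W in auto)
qed

lemma distribution_tangent_frames:
  assumes "distribution M k D" shows "tangent_frames M D k"
  unfolding tangent_frames_def
proof
  fix p assume p: "p \<in> M"
  have dimD: "dim (D q) = k" if "q \<in> M" for q using assms that by (simp add: distribution_def)
  from assms have "\<forall>p\<in>M. \<exists>U (F :: nat \<Rightarrow> 'a \<Rightarrow> 'a). open U \<and> p \<in> U \<and>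
        (\<forall>i<k. smooth_on (M \<inter> U) (F i)) \<and> (\<forall>q\<in>M \<inter> U. D q = span {F i q | i. i < k})"
    unfolding distribution_def by (rule conjunct2)
  from bspec[OF this p] obtain U and F :: "nat \<Rightarrow> 'a \<Rightarrow> 'a" where U: "open U" "p \<in> U"
    and F: "\<forall>i<k. smooth_on (M \<inter> U) (F i)" and D: "\<forall>q\<in>M \<inter> U. D q = span {F i q | i. i < k}"
    by (elim exE conjE)
  have "\<exists>V G. open V \<and> p \<in> V \<and> V \<subseteq> U \<and> (\<forall>i<k. smooth_open V (G i)) \<and>
    (\<forall>i<k. \<forall>x\<in>M \<inter> V. G i x = F i x)"
    by (rule smooth_on_common_extension[OF _ U(1) p U(2)]) (use F in blast)
  then obtain V G where V: "open V" "p \<in> V" "V \<subseteq> U" and G: "\<forall>i<k. smooth_open V (G i)"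
    and GF: "\<forall>i<k. \<forall>x\<in>M \<inter> V. G i x = F i x" by (elim exE conjE)
  have DG: "D x = span {G i x | i. i < k} \<and> dim (D x) = k" if x: "x \<in> M \<inter> V" for x
  proof
    have "{G i x | i. i < k} = {F i x | i. i < k}"
      unfolding setcompr_eq_image by (rule image_cong) (use GF x in auto)
    moreover have "D x = span {F i x | i. i < k}" using bspec[OF D, of x] x V(3) by blast
    ultimately show "D x = span {G i x | i. i < k}" by simp
    show "dim (D x) = k" using dimD x by blast
  qed
  show "\<exists>U (F :: nat \<Rightarrow> 'a \<Rightarrow> 'a). open U \<and> p \<in> U \<and> (\<forall>i<k. smooth_open U (F i)) \<and>
        (\<forall>x\<in>M \<inter> U. D x = span {F i x | i. i < k} \<and> dim (D x) = k)"
    by (rule exI[of _ V], rule exI[of _ G]) (intro conjI V(1,2) G ballI DG)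
qed

lemma smooth_on_diff: "smooth_on M f \<Longrightarrow> smooth_on M g \<Longrightarrow> smooth_on M (\<lambda>x. f x - g x)"
proof (rule smooth_onI)
  fix x assume fg: "smooth_on M f" "smooth_on M g" and x: "x \<in> M"
  obtain U F where U: "smooth_open U F" "x \<in> U" "\<forall>y\<in>M \<inter> U. F y = f y" by (rule smooth_onE[OF fg(1) x])
  obtain V G where V: "smooth_open V G" "x \<in> V" "\<forall>y\<in>M \<inter> V. G y = g y" by (rule smooth_onE[OF fg(2) x])
  have o: "open (U \<inter> V)" using U(1) V(1) by (auto simp: smooth_open_def)
  have "smooth_open (U \<inter> V) (\<lambda>x. F x - G x)"
    by (rule smooth_open_diff[OF smooth_open_subset[OF U(1) o] smooth_open_subset[OF V(1) o]]) auto
  then show "\<exists>U H. smooth_open U H \<and> x \<in> U \<and> (\<forall>y\<in>M \<inter> U. H y = f y - g y)"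
    using U V by (intro exI[of _ "U \<inter> V"] exI[of _ "\<lambda>x. F x - G x"]) simp
qed

context orth_group
begin

lemma field_along_exp_curve:
  assumes "smooth_on (orb p) f" "X \<in> lie"
  shows "((\<lambda>t. f (exp (t *\<^sub>R X) \<star> p)) has_vector_derivative
    frechet_derivative f (at p within orb p) (X \<star> p)) (at 0)"
proof -
  have "(\<lambda>t. exp (t *\<^sub>R X) \<star> p) ` UNIV \<subseteq> orb p" using exp_curve_orb[OF assms(2)] by blast
  from smooth_on_along_curve[OF assms(1) UNIV_I open_UNIV this exp_curve_velocity]
  show ?thesis by simp
qed

text \<open>The derivative of a section of an invariant distribution \<open>q \<mapsto> S q\<close> is compared with the action
  of \<open>X\<close> by pulling the section back to \<open>p\<close> with \<open>exp (- t X)\<close>.\<close>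

lemma invariant_section_derivative:
  assumes f: "smooth_on (orb p) f" and X: "X \<in> lie" and S: "subspace S"
    and fS: "\<And>t. f (exp (t *\<^sub>R X) \<star> p) \<in> (\<star>) (exp (t *\<^sub>R X)) ` S"
  shows "frechet_derivative f (at p within orb p) (X \<star> p) - X \<star> f p \<in> S"
proof (rule derivative_in_subspace[OF S zero_less_one])
  let ?w = "\<lambda>t. exp (t *\<^sub>R (- X)) \<star> f (exp (t *\<^sub>R X) \<star> p)"
  have "(?w has_vector_derivative exp (0 *\<^sub>R (- X)) \<star> frechet_derivative f (at p within orb p) (X \<star> p)
      + (- X * exp (0 *\<^sub>R (- X))) \<star> f (exp (0 *\<^sub>R X) \<star> p)) (at 0)"
    by (rule bounded_bilinear.has_vector_derivative[OF bounded_bilinear_endo_apply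
          exp_scaleR_has_vector_derivative_left field_along_exp_curve[OF f X]])
  then show "(?w has_vector_derivative frechet_derivative f (at p within orb p) (X \<star> p) - X \<star> f p) (at 0)"
    by (simp add: endo.minus_left)
  show "?w t \<in> S" for t
  proof -
    obtain s where s: "s \<in> S" "f (exp (t *\<^sub>R X) \<star> p) = exp (t *\<^sub>R X) \<star> s" using fS[of t] by (rule imageE)
    have "exp (t *\<^sub>R (- X)) * exp (t *\<^sub>R X) = 1" using exp_scaleR_minus_mult(1)[of t X] by simp
    then have "exp (t *\<^sub>R (- X)) \<star> exp (t *\<^sub>R X) \<star> s = s" by (metis endo_mult_apply endo_one_apply)
    then show ?thesis using s by simp
  qed
qed

lemma normal_space_orb: "q \<in> orb p \<Longrightarrow> normal_space (orb p) q = nor_space q"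
  by (simp add: normal_space_def nor_space_def tangent_space_orb)

lemma nor_nor: "orthogonal_comp (nor_space q) = tan_space q"
  unfolding nor_space_def by (rule orthogonal_comp_self[OF subspace_tan])

lemma orth_proj_nor_0: "orth_proj (nor_space q) x = 0 \<longleftrightarrow> x \<in> tan_space q"
  by (simp add: orth_proj_eq_0_iff[OF subspace_nor] nor_nor)

lemma complement_distribution_orb:
  "q \<in> orb p \<Longrightarrow> complement_distribution (orb p) D q = tan_space q \<inter> orthogonal_comp (D q)"
  by (simp add: complement_distribution_def tangent_space_orb)

lemma complement_invariant:
  assumes A: "A \<in> K" and inv: "D (A \<star> q) = (\<star>) A ` D q"
  shows "tan_space (A \<star> q) \<inter> orthogonal_comp (D (A \<star> q)) \<subseteq> (\<star>) A ` (tan_space q \<inter> orthogonal_comp (D q))"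
proof
  fix x assume x: "x \<in> tan_space (A \<star> q) \<inter> orthogonal_comp (D (A \<star> q))"
  have "inv_K A \<star> x \<in> tan_space q"
    using tan_K[OF inv_K(1)[OF A], of x "A \<star> q"] x by (simp add: inv_K_apply A)
  moreover have "inv_K A \<star> x \<in> orthogonal_comp (D q)"
  proof (rule orthogonal_compI)
    fix y assume "y \<in> D q"
    then have "A \<star> y \<in> D (A \<star> q)" unfolding inv by (rule imageI)
    then have "(A \<star> y) \<bullet> x = 0" using orthogonal_compD[of x "D (A \<star> q)" "A \<star> y"] x by blast
    then show "y \<bullet> (inv_K A \<star> x) = 0"
      using inner_K[OF A, of y "inv_K A \<star> x"] by (simp add: inv_K_apply A)
  qed
  ultimately show "x \<in> (\<star>) A ` (tan_space q \<inter> orthogonal_comp (D q))"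
    by (intro image_eqI[of _ _ "inv_K A \<star> x"]) (simp_all add: inv_K_apply A)
qed

text \<open>By invariance, the derivative along \<open>X p\<close> of a section of \<open>D\<close>
  or of its complement differs from \<open>X\<close> applied to its value by an element of the same
  distribution. Autoparallelism then puts the tangential part of \<open>X Y\<close> into
  \<open>D p\<close> for \<open>Y\<close> in \<open>D p\<close>, and the condition on the second
  fundamental form makes \<open>X Z\<close> tangential.\<close>

lemma autoparallel_invariant_complement:
  assumes frames: "tangent_frames (orb p) D k" and Dtan: "\<And>q. q \<in> orb p \<Longrightarrow> D q \<subseteq> tan_space q"
    and inv: "\<And>A q. A \<in> K \<Longrightarrow> q \<in> orb p \<Longrightarrow> D (A \<star> q) = (\<star>) A ` D q"
    and ap: "autoparallel (orb p) D" and sff: "sff_invariant (orb p) D"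
    and X: "X \<in> lie" "X \<star> p \<in> D p" and Z: "Z \<in> tan_space p \<inter> orthogonal_comp (D p)"
  shows "X \<star> Z \<in> tan_space p \<inter> orthogonal_comp (D p)"
proof -
  note PD = tangent_frames_smooth_proj[OF frames]
  note PT = tangent_frames_smooth_proj[OF orb_tangent_frames, of p]
  have p: "p \<in> orb p" by (rule self_orb)
  note expK = exp_lie[OF X(1)] and curve = exp_curve_orb[OF X(1)]
  define FD where "FD v q = orth_proj (D q) v" for v q
  have FD: "section_of (orb p) D (FD v)" for v
    unfolding section_of_def FD_def using PD(1) orth_proj_in(1)[OF PD(2)] by blast
  \<comment> \<open>The difference of the two projections is the projection onto the complement of
    \<open>D\<close>, so smooth sections of the complement arise without a frame for it.\<close>
  define FE where "FE v q = orth_proj (tan_space q) v - orth_proj (D q) v" for v q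
  have FE_in: "FE v q \<in> tan_space q \<inter> orthogonal_comp (D q)" if q: "q \<in> orb p" for v q
  proof
    show "FE v q \<in> tan_space q" unfolding FE_def
      using orth_proj_in(1)[OF PD(2)[OF q], of v] Dtan[OF q]
      by (intro subspace_diff[OF subspace_tan] orth_proj_in(1)[OF subspace_tan]) blast
    show "FE v q \<in> orthogonal_comp (D q)"
    proof (rule orthogonal_compI)
      fix y assume y: "y \<in> D q"
      then have "y \<bullet> orth_proj (tan_space q) v = y \<bullet> v" using Dtan[OF q] by (intro orth_proj_inner subspace_tan) blast
      moreover have "y \<bullet> orth_proj (D q) v = y \<bullet> v" using y by (rule orth_proj_inner[OF PD(2)[OF q]])
      ultimately show "y \<bullet> FE v q = 0" by (simp add: FE_def inner_diff_right)
    qed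
  qed
  have FEs: "smooth_on (orb p) (FE v)" for v unfolding FE_def by (rule smooth_on_diff[OF PT(1) PD(1)])
  have FE: "section_of (orb p) (complement_distribution (orb p) D) (FE v)" for v
    unfolding section_of_def using FEs FE_in complement_distribution_orb by blast
  have FDX: "FD (X \<star> p) p = X \<star> p" unfolding FD_def by (rule orth_proj_id[OF PD(2)[OF p] X(2)])
  have DY: "orth_proj (tan_space p) (X \<star> Y) \<in> D p" if Y: "Y \<in> D p" for Y
  proof -
    define u where "u = frechet_derivative (FD Y) (at p within orb p) (X \<star> p)"
    have FDY: "FD Y p = Y" unfolding FD_def by (rule orth_proj_id[OF PD(2)[OF p] Y])
    have "u - X \<star> FD Y p \<in> D p" unfolding u_def
    proof (rule invariant_section_derivative[OF _ X(1) PD(2)[OF p]])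
      show "smooth_on (orb p) (FD Y)" using FD by (simp add: section_of_def)
      show "FD Y (exp (t *\<^sub>R X) \<star> p) \<in> (\<star>) (exp (t *\<^sub>R X)) ` D p" for t
        unfolding inv[OF expK p, symmetric] using FD curve by (simp add: section_of_def)
    qed
    then have d: "u - X \<star> Y \<in> D p" unfolding FDY .
    have "levi_civita (orb p) (FD (X \<star> p)) (FD Y) p \<in> D p"
      using ap FD p unfolding autoparallel_def by blast
    then have "orth_proj (tan_space p) u \<in> D p"
      unfolding levi_civita_def tangent_space_orb[OF p] FDX u_def .
    then have "orth_proj (tan_space p) u - (u - X \<star> Y) \<in> D p" using d by (rule subspace_diff[OF PD(2)[OF p]])
    moreover have "orth_proj (tan_space p) (u - X \<star> Y) = u - X \<star> Y"
      using d Dtan[OF p] by (intro orth_proj_id subspace_tan) blast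
    then have "orth_proj (tan_space p) (X \<star> Y) = orth_proj (tan_space p) u - (u - X \<star> Y)"
      by (simp add: linear_diff[OF linear_orth_proj[OF subspace_tan]] algebra_simps)
    ultimately show ?thesis by simp
  qed
  have FEZ: "FE Z p = Z"
  proof -
    have "orth_proj (tan_space p) Z = Z" using Z by (intro orth_proj_id subspace_tan) blast
    moreover have "orth_proj (D p) Z = 0" using Z orth_proj_eq_0_iff[OF PD(2)[OF p]] by blast
    ultimately show ?thesis by (simp add: FE_def)
  qed
  define w where "w = frechet_derivative (FE Z) (at p within orb p) (X \<star> p)"
  have Esub: "subspace (tan_space p \<inter> orthogonal_comp (D p))"
    by (intro subspace_inter subspace_tan subspace_orthogonal_comp)
  have "w - X \<star> FE Z p \<in> tan_space p \<inter> orthogonal_comp (D p)" unfolding w_def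
  proof (rule invariant_section_derivative[OF FEs X(1) Esub])
    show "FE Z (exp (t *\<^sub>R X) \<star> p) \<in> (\<star>) (exp (t *\<^sub>R X)) ` (tan_space p \<inter> orthogonal_comp (D p))" for t
      using complement_invariant[where D = D and q = p, OF expK[of t] inv[OF expK[of t] p]]
        FE_in[OF curve[of t]] by blast
  qed
  then have d: "w - X \<star> Z \<in> tan_space p" unfolding FEZ by blast
  have "second_fundamental_form (orb p) (FD (X \<star> p)) (FE Z) p = 0"
    using sff FD FE p unfolding sff_invariant_def by blast
  then have "orth_proj (nor_space p) w = 0"
    unfolding second_fundamental_form_def normal_space_orb[OF p] FDX w_def .
  then have "w \<in> tan_space p" by (simp add: orth_proj_nor_0)
  from subspace_diff[OF subspace_tan this d] have XZ: "X \<star> Z \<in> tan_space p" by simp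
  \<comment> \<open>By skewness, the pairing of \<open>X Z\<close> with \<open>Y\<close> is up to
    sign that of \<open>Z\<close> with the tangential part of \<open>X Y\<close>, which lies in
    \<open>D p\<close>.\<close>
  moreover have "X \<star> Z \<in> orthogonal_comp (D p)"
  proof (rule orthogonal_compI)
    fix Y assume Y: "Y \<in> D p"
    have "Z \<bullet> (X \<star> Y) = Z \<bullet> orth_proj (tan_space p) (X \<star> Y)"
      using Z by (intro orth_proj_inner[symmetric] subspace_tan) blast
    also have "\<dots> = 0" using orthogonal_compD[of Z "D p", OF _ DY[OF Y]] Z by (simp add: inner_commute)
    finally show "Y \<bullet> (X \<star> Z) = 0" using lie_skew[OF X(1), of Z Y] by (simp add: inner_commute)
  qed
  ultimately show ?thesis by blast
qed

text \<open>Along the exponential curve the equivariant field through \<open>\<eta>\<close> is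
  \<open>exp (t X)\<close> applied to \<open>\<eta>\<close>, so its derivative at \<open>p\<close>
  is \<open>X \<eta>\<close>; parallelism says that this derivative has no normal part.\<close>

lemma parallel_normal_derivative:
  assumes p: "regular p" and eta: "\<eta> \<in> nor_space p" and X: "X \<in> lie" "X \<star> p \<in> E p"
    and par: "\<And>\<xi>. normal_field (orb p) \<xi> \<Longrightarrow> (\<And>A q. A \<in> K \<Longrightarrow> q \<in> orb p \<Longrightarrow> \<xi> (A \<star> q) = A \<star> \<xi> q)
      \<Longrightarrow> parallel_along (orb p) E \<xi>"
  shows "X \<star> \<eta> \<in> tan_space p"
proof -
  obtain \<xi> where sm: "smooth_on (orb p) \<xi>" and xi: "\<forall>A\<in>K. \<xi> (A \<star> p) = A \<star> \<eta>"
    by (rule equivariant_normal_field[OF p eta]) blast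
  have pp: "p \<in> orb p" by (rule self_orb)
  have "normal_field (orb p) \<xi>" unfolding normal_field_def
  proof (intro conjI sm ballI)
    fix q assume q: "q \<in> orb p"
    then obtain A where A: "A \<in> K" "q = A \<star> p" by (auto simp: orb_def)
    show "\<xi> q \<in> normal_space (orb p) q"
      unfolding normal_space_orb[OF q] using nor_K[OF A(1) eta] xi A by simp
  qed
  moreover have "\<xi> (A \<star> q) = A \<star> \<xi> q" if A: "A \<in> K" "q \<in> orb p" for A q
  proof -
    obtain B where B: "B \<in> K" "q = B \<star> p" using A(2) by (auto simp: orb_def)
    have "\<xi> ((A * B) \<star> p) = (A * B) \<star> \<eta>" using xi mult_K[OF A(1) B(1)] by blast
    moreover have "\<xi> (B \<star> p) = B \<star> \<eta>" using xi B(1) by blast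
    ultimately show ?thesis by (simp add: B(2))
  qed
  ultimately have "parallel_along (orb p) E \<xi>" by (rule par)
  then have "normal_connection (orb p) (X \<star> p) \<xi> p = 0"
    using pp X(2) unfolding parallel_along_def by blast
  then have t: "frechet_derivative \<xi> (at p within orb p) (X \<star> p) \<in> tan_space p"
    unfolding normal_connection_def normal_space_orb[OF pp] orth_proj_nor_0 .
  have "((\<lambda>t. \<xi> (exp (t *\<^sub>R X) \<star> p)) has_vector_derivative X \<star> \<eta>) (at 0)"
    using exp_curve_velocity[of X \<eta>] xi exp_lie[OF X(1)] by simp
  from vector_derivative_unique_at[OF field_along_exp_curve[OF sm X(1)] this] t
  show ?thesis by simp
qed

subsection \<open>Sections of the action\<close>

definition section_K :: "nat \<Rightarrow> 'v set \<Rightarrow> bool" where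
  "section_K k \<Sigma> \<longleftrightarrow> connected \<Sigma> \<and> complete_submanifold \<Sigma> \<and> totally_geodesic \<Sigma> \<and>
     (\<forall>x. \<Sigma> \<inter> orb x \<noteq> {}) \<and>
     (\<forall>p\<in>\<Sigma>. regular p \<longrightarrow> nor_space p \<subseteq> tangent_space \<Sigma> p \<and>
        dim (tangent_space \<Sigma> p) = dim (nor_space p) + k) \<and>
     (\<forall>p\<in>\<Sigma>. regular p \<longrightarrow> (\<forall>A\<in>K. A \<star> p \<in> \<Sigma> \<longrightarrow> (\<star>) A ` \<Sigma> = \<Sigma>))"

text \<open>Encodes (C1) to (C3) for linear subspaces, with (C2) hidden in
  \<open>orbit_meets_nor\<close> and the index read off from the dimension. (C4) is left out because
  it is not established for the subspace from \<open>normal_sum_subspace\<close>; members of least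
  dimension recover it.\<close>

definition nor_saturated :: "'v set \<Rightarrow> bool" where
  "nor_saturated W \<longleftrightarrow> subspace W \<and> (\<exists>p\<in>W. regular p) \<and> (\<forall>q\<in>W. regular q \<longrightarrow> nor_space q \<subseteq> W)"

lemma dim_nor_regular: "regular p \<Longrightarrow> regular q \<Longrightarrow> dim (nor_space p) = dim (nor_space q)"
  using dim_tan_regular[of p q] dim_orthogonal_comp[OF subspace_tan, of p] dim_orthogonal_comp[OF subspace_tan, of q]
  by (simp add: nor_space_def)

text \<open>A section is an affine subspace through some regular \<open>p\<close>, and
  \<open>p\<close> is itself normal at \<open>p\<close> by \<open>self_nor\<close>, hence a tangent
  vector of the section. So the section contains the origin and equals its tangent space.\<close>

lemma section_nor_saturated:
  assumes S: "section_K k \<Sigma>" and r: "regular r"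
  shows "nor_saturated \<Sigma>" "dim \<Sigma> = dim (nor_space r) + k"
proof -
  have "\<Sigma> \<inter> orb r \<noteq> {}" using S by (simp add: section_K_def)
  then obtain p where p: "p \<in> \<Sigma>" "p \<in> orb r" by blast
  then obtain A where "A \<in> K" "p = A \<star> r" by (auto simp: orb_def)
  then have rp: "regular p" using regular_K[OF r] by simp
  have aff: "subspace (tangent_space \<Sigma> p)" "\<Sigma> = (+) p ` tangent_space \<Sigma> p"
    using S complete_totally_geodesic_affine[of \<Sigma> p] p(1) by (simp_all add: section_K_def)
  have nt: "nor_space p \<subseteq> tangent_space \<Sigma> p" "dim (tangent_space \<Sigma> p) = dim (nor_space p) + k"
    using S p(1) rp by (simp_all add: section_K_def)
  then have "p \<in> tangent_space \<Sigma> p" using self_nor by blast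
  have eq: "\<Sigma> = tangent_space \<Sigma> p"
  proof -
    have "(+) p ` tangent_space \<Sigma> p = tangent_space \<Sigma> p"
    proof
      show "(+) p ` tangent_space \<Sigma> p \<subseteq> tangent_space \<Sigma> p"
        using subspace_add[OF aff(1) \<open>p \<in> tangent_space \<Sigma> p\<close>] by blast
      show "tangent_space \<Sigma> p \<subseteq> (+) p ` tangent_space \<Sigma> p"
      proof
        fix x assume "x \<in> tangent_space \<Sigma> p"
        then have "x - p \<in> tangent_space \<Sigma> p" using \<open>p \<in> tangent_space \<Sigma> p\<close> by (rule subspace_diff[OF aff(1)])
        then show "x \<in> (+) p ` tangent_space \<Sigma> p" by (intro image_eqI[of _ _ "x - p"]) simp_all
      qed
    qed
    with aff(2) show ?thesis by simp
  qed
  have sub: "subspace \<Sigma>" using aff(1) eq by simp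
  show "dim \<Sigma> = dim (nor_space r) + k" using nt(2) eq dim_nor_regular[OF rp r] by simp
  have "nor_space q \<subseteq> \<Sigma>" if q: "q \<in> \<Sigma>" "regular q" for q
  proof -
    have "nor_space q \<subseteq> tangent_space \<Sigma> q" using S q by (simp add: section_K_def)
    then show ?thesis unfolding tangent_space_subspace[OF sub q(1)] .
  qed
  with sub p(1) rp show "nor_saturated \<Sigma>" unfolding nor_saturated_def by blast
qed

text \<open>(C2) holds because the normal space at a single regular point already meets every
  orbit.\<close>

lemma nor_saturated_section:
  assumes W: "nor_saturated W" and r: "regular r" and dW: "dim W = dim (nor_space r) + k"
    and C4: "\<And>p A. p \<in> W \<Longrightarrow> regular p \<Longrightarrow> A \<in> K \<Longrightarrow> A \<star> p \<in> W \<Longrightarrow> (\<star>) A ` W = W"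
  shows "section_K k W"
proof -
  have sub: "subspace W" using W by (simp add: nor_saturated_def)
  obtain p where p: "p \<in> W" "regular p" "nor_space p \<subseteq> W" using W unfolding nor_saturated_def by blast
  have "W \<inter> orb x \<noteq> {}" for x
  proof -
    obtain g where "g \<in> K" "g \<star> x \<in> nor_space p" using orbit_meets_nor by blast
    then have "g \<star> x \<in> W \<inter> orb x" using p(3) by (auto simp: orb_def)
    then show ?thesis by blast
  qed
  moreover have "nor_space q \<subseteq> tangent_space W q \<and> dim (tangent_space W q) = dim (nor_space q) + k"
    if q: "q \<in> W" "regular q" for q
    using W q dW dim_nor_regular[OF q(2) r] by (simp add: tangent_space_subspace[OF sub q(1)] nor_saturated_def)
  ultimately show ?thesis unfolding section_K_def
    using C4 complete_submanifold_subspace[OF sub] totally_geodesic_subspace[OF sub]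
      convex_connected[OF subspace_imp_convex[OF sub]] by blast
qed

lemma nor_saturated_Int:
  assumes "nor_saturated W1" "nor_saturated W2" "p \<in> W1 \<inter> W2" "regular p" shows "nor_saturated (W1 \<inter> W2)"
  using assms unfolding nor_saturated_def by (auto intro: subspace_inter)

lemma nor_saturated_image:
  assumes W: "nor_saturated W" and A: "A \<in> K" shows "nor_saturated ((\<star>) A ` W)" "dim ((\<star>) A ` W) = dim W"
proof -
  have inj: "inj ((\<star>) A)" using inv_K_apply(2)[OF A] by (rule inj_on_inverseI)
  show "dim ((\<star>) A ` W) = dim W"
    by (rule dim_image_eq[OF linear_endo_apply inj_on_subset[OF inj subset_UNIV]])
  obtain p where p: "p \<in> W" "regular p" using W unfolding nor_saturated_def by blast
  have "nor_space q \<subseteq> (\<star>) A ` W" if q: "q \<in> (\<star>) A ` W" "regular q" for q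
  proof
    obtain w where w: "w \<in> W" "q = A \<star> w" using q(1) by blast
    have "w = inv_K A \<star> q" by (simp add: w(2) inv_K_apply A)
    then have rw: "regular w" using regular_K[OF q(2) inv_K(1)[OF A]] by simp
    fix x assume "x \<in> nor_space q"
    from nor_K[OF inv_K(1)[OF A] this] have "inv_K A \<star> x \<in> nor_space w" by (simp add: w(2) inv_K_apply A)
    then have "inv_K A \<star> x \<in> W" using W w(1) rw unfolding nor_saturated_def by blast
    then show "x \<in> (\<star>) A ` W" by (intro image_eqI[of _ _ "inv_K A \<star> x"]) (simp_all add: inv_K_apply A)
  qed
  moreover have "A \<star> p \<in> (\<star>) A ` W" "regular (A \<star> p)" using p regular_K[OF p(2) A] by auto
  moreover have "subspace ((\<star>) A ` W)"
    using W by (intro linear_subspace_image linear_endo_apply) (simp add: nor_saturated_def)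
  ultimately show "nor_saturated ((\<star>) A ` W)" unfolding nor_saturated_def by blast
qed

definition minimal_K :: "'v \<Rightarrow> 'v set \<Rightarrow> bool" where
  "minimal_K p \<Sigma> \<longleftrightarrow> (p \<in> \<Sigma> \<and> (\<exists>k. section_K k \<Sigma>)) \<and>
     (\<forall>\<Sigma>'. p \<in> \<Sigma>' \<and> (\<exists>k. section_K k \<Sigma>') \<longrightarrow> \<Sigma>' \<subseteq> \<Sigma> \<longrightarrow> \<Sigma>' = \<Sigma>)"

text \<open>Such subspaces with a common regular point are closed under intersection. Hence one of least
  dimension satisfies (C4), and it is the minimal section through each of its regular points.\<close>

lemma copolarity_le:
  assumes W: "nor_saturated W" and r: "regular r" and dW: "dim W = dim (nor_space r) + k"
  shows "(THE k. \<forall>p. regular p \<longrightarrow> (\<exists>\<Sigma>. minimal_K p \<Sigma> \<and> section_K k \<Sigma>)) \<le> k"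
proof -
  define m where "m = (LEAST m. \<exists>W. nor_saturated W \<and> dim W = m)"
  define n where "n = dim (nor_space r)"
  have "\<exists>W. nor_saturated W \<and> dim W = m" unfolding m_def by (rule LeastI[of _ "dim W"]) (use W in blast)
  then obtain W0 where W0: "nor_saturated W0" "dim W0 = m" by blast
  have least: "m \<le> dim S" if "nor_saturated S" for S unfolding m_def by (rule Least_le) (use that in blast)
  have sub: "subspace S" if "nor_saturated S" for S using that by (simp add: nor_saturated_def)
  have subeq: "S = S'" if "nor_saturated S" "nor_saturated S'" "S \<subseteq> S'" "dim S' = m" for S S'
    using that least[OF that(1)] by (intro subspace_dim_equal sub) simp_all
  \<comment> \<open>Keeps the natural-number difference \<open>m - n\<close> from being
    truncated.\<close>
  have nm: "n \<le> m"
  proof -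
    obtain p where p: "p \<in> W0" "regular p" "nor_space p \<subseteq> W0" using W0(1) unfolding nor_saturated_def by blast
    show ?thesis using dim_subset[OF p(3)] dim_nor_regular[OF p(2) r] W0(2) by (simp add: n_def)
  qed
  have sec: "section_K (m - n) S" if S: "nor_saturated S" "dim S = m" for S
  proof (rule nor_saturated_section[OF S(1) r])
    show "dim S = dim (nor_space r) + (m - n)" using S(2) nm by (simp add: n_def)
    fix p A assume p: "p \<in> S" "regular p" "A \<in> K" "A \<star> p \<in> S"
    have A: "nor_saturated ((\<star>) A ` S)" "dim ((\<star>) A ` S) = m" using nor_saturated_image[OF S(1) p(3)] S(2) by simp_all
    \<comment> \<open>The point \<open>A \<star> p\<close> is regular and common to \<open>S\<close>
      and its image under \<open>A\<close>, so their intersection belongs to the class, and least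
      dimension makes it equal to both.\<close>
    have "nor_saturated (S \<inter> (\<star>) A ` S)"
      by (rule nor_saturated_Int[OF S(1) A(1) _ regular_K[OF p(2,3)]]) (use p in blast)
    note i = this
    have "S \<inter> (\<star>) A ` S = S" by (rule subeq[OF i S(1) Int_lower1 S(2)])
    moreover have "S \<inter> (\<star>) A ` S = (\<star>) A ` S" by (rule subeq[OF i A(1) Int_lower2 A(2)])
    ultimately show "(\<star>) A ` S = S" by simp
  qed
  have ex: "\<exists>S. nor_saturated S \<and> dim S = m \<and> p \<in> S" if p: "regular p" for p
  proof -
    have "W0 \<inter> orb p \<noteq> {}" using sec[OF W0] by (simp add: section_K_def)
    then obtain A where A: "A \<in> K" "A \<star> p \<in> W0" by (auto simp: orb_def)
    have "p \<in> (\<star>) (inv_K A) ` W0"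
      using A by (intro image_eqI[of _ _ "A \<star> p"]) (simp_all add: inv_K_apply)
    with nor_saturated_image[OF W0(1) inv_K(1)[OF A(1)]] W0(2) show ?thesis by blast
  qed
  have min: "minimal_K p S" if S: "nor_saturated S" "dim S = m" "p \<in> S" and p: "regular p" for S p
    unfolding minimal_K_def
  proof (intro conjI allI impI)
    show "p \<in> S" by (rule S(3))
    show "\<exists>k. section_K k S" using sec[OF S(1,2)] by blast
    fix S' assume S': "p \<in> S' \<and> (\<exists>k. section_K k S')" "S' \<subseteq> S"
    then obtain k' where k': "section_K k' S'" by blast
    show "S' = S" by (rule subeq[OF section_nor_saturated(1)[OF k' r] S(1) S'(2) S(2)])
  qed
  have "(THE k. \<forall>p. regular p \<longrightarrow> (\<exists>\<Sigma>. minimal_K p \<Sigma> \<and> section_K k \<Sigma>)) = m - n"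
  proof (rule the_equality)
    show "\<forall>p. regular p \<longrightarrow> (\<exists>\<Sigma>. minimal_K p \<Sigma> \<and> section_K (m - n) \<Sigma>)"
    proof (intro allI impI)
      fix p assume p: "regular p"
      from ex[OF p] obtain S where S: "nor_saturated S" "dim S = m" "p \<in> S" by blast
      with min[OF S p] sec[OF S(1,2)] show "\<exists>\<Sigma>. minimal_K p \<Sigma> \<and> section_K (m - n) \<Sigma>" by blast
    qed
    \<comment> \<open>A minimal section through \<open>r\<close>, of whatever index, contains a
      subspace of least dimension, since their intersection cannot drop below \<open>m\<close>.
      Minimality makes the two equal, and the dimension determines the index.\<close>
    fix k' assume "\<forall>p. regular p \<longrightarrow> (\<exists>\<Sigma>. minimal_K p \<Sigma> \<and> section_K k' \<Sigma>)"
    with r obtain S' where S': "minimal_K r S'" "section_K k' S'" by blast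
    from ex[OF r] obtain S where S: "nor_saturated S" "dim S = m" "r \<in> S" by blast
    have g': "nor_saturated S'" by (rule section_nor_saturated(1)[OF S'(2) r])
    have rS': "r \<in> S'" using S'(1) by (simp add: minimal_K_def)
    have i: "nor_saturated (S \<inter> S')" by (rule nor_saturated_Int[OF S(1) g' _ r]) (use S(3) rS' in blast)
    have "S \<inter> S' = S" by (rule subeq[OF i S(1) Int_lower1 S(2)])
    then have "S \<subseteq> S'" by blast
    moreover have "r \<in> S \<and> (\<exists>k. section_K k S)" using S(3) sec[OF S(1,2)] by blast
    ultimately have "S = S'" using S'(1) unfolding minimal_K_def by blast
    then have "dim (nor_space r) + k' = m" using section_nor_saturated(2)[OF S'(2) r] S(2) by simp
    then show "k' = m - n" by (simp add: n_def)
  qed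
  also have "\<dots> \<le> k" using least[OF W] dW by (simp add: n_def)
  finally show ?thesis .
qed

end

subsection \<open>The image of the representation\<close>

lemma smooth_on_continuous_on:
  assumes "smooth_on S f" shows "continuous_on S f"
  unfolding continuous_on_eq_continuous_within
proof
  fix x assume x: "x \<in> S"
  from smooth_on_has_derivative_within[OF assms x] show "continuous (at x within S) f"
    by (rule has_derivative_continuous)
qed

text \<open>Smoothness of the representation is given chart by chart, so openness of preimages is
  checked around each group element inside a chart domain.\<close>

lemma rep_continuous:
  fixes A :: "('g set \<times> ('g \<Rightarrow> 'e::euclidean_space)) set" and \<rho> :: "'g \<Rightarrow> 'v::euclidean_space \<Rightarrow> 'v"
  assumes atlas: "smooth_atlas T L A"
    and rep: "\<forall>(U, \<phi>)\<in>A. \<forall>v. smooth_on (\<phi> ` U) (\<lambda>x. \<rho> (inv_into U \<phi> x) v)"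
  shows "continuous_map T euclidean (\<lambda>g. \<rho> g v)"
  unfolding continuous_map_def
proof (intro conjI allI impI)
  fix W :: "'v set" assume W: "openin euclidean W"
  have cov: "(\<Union>(fst ` A)) = topspace T"
    and chart: "\<forall>(U, \<phi>)\<in>A. openin T U \<and> openin (top_of_set L) (\<phi> ` U) \<and>
        homeomorphic_map (subtopology T U) (top_of_set (\<phi> ` U)) \<phi>"
    using atlas by (simp_all add: smooth_atlas_def)
  show "openin T {g \<in> topspace T. \<rho> g v \<in> W}"
  proof (subst openin_subopen, rule ballI)
    fix g assume g: "g \<in> {g \<in> topspace T. \<rho> g v \<in> W}"
    then have "g \<in> \<Union>(fst ` A)" using cov by simp
    then obtain a where a: "a \<in> A" "g \<in> fst a" by blast
    obtain U \<phi> where "a = (U, \<phi>)" by (cases a)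
    with a have U: "(U, \<phi>) \<in> A" "g \<in> U" by simp_all
    have oU: "openin T U" and hom: "homeomorphic_map (subtopology T U) (top_of_set (\<phi> ` U)) \<phi>"
      using bspec[OF chart U(1)] by simp_all
    have sub: "U \<subseteq> topspace T" using oU by (rule openin_subset)
    then have tU: "topspace (subtopology T U) = U" by auto
    have inj: "inj_on \<phi> U" using homeomorphic_imp_injective_map[OF hom] unfolding tU .
    have "smooth_on (\<phi> ` U) (\<lambda>x. \<rho> (inv_into U \<phi> x) v)" using bspec[OF rep U(1)] by simp
    then have "continuous_map (top_of_set (\<phi> ` U)) euclidean (\<lambda>x. \<rho> (inv_into U \<phi> x) v)"
      by (simp add: smooth_on_continuous_on)
    from continuous_map_compose[OF homeomorphic_imp_continuous_map[OF hom] this]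
    have "openin (subtopology T U) {x \<in> U. ((\<lambda>x. \<rho> (inv_into U \<phi> x) v) \<circ> \<phi>) x \<in> W}"
      using W unfolding continuous_map_def tU by blast
    moreover have "{x \<in> U. ((\<lambda>x. \<rho> (inv_into U \<phi> x) v) \<circ> \<phi>) x \<in> W} = {x \<in> U. \<rho> x v \<in> W}"
      using inj by auto
    ultimately have "openin T {x \<in> U. \<rho> x v \<in> W}" using openin_open_subtopology[OF oU] by simp
    then show "\<exists>T'. openin T T' \<and> g \<in> T' \<and> T' \<subseteq> {g \<in> topspace T. \<rho> g v \<in> W}"
      by (rule exI[of _ "{x \<in> U. \<rho> x v \<in> W}", OF conjI]) (use g U(2) sub in auto)
  qed
qed simp

text \<open>In finite dimension pointwise continuity is enough: an endomorphism is the finite sum of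
  the rank-one maps \<open>R b u\<close>, where \<open>u\<close> is the image of the basis vector
  \<open>b\<close>, and these depend linearly on \<open>u\<close>.\<close>

lemma rep_endo_continuous:
  fixes \<rho> :: "'g \<Rightarrow> 'v::euclidean_space \<Rightarrow> 'v"
  assumes cont: "\<And>v. continuous_map T euclidean (\<lambda>g. \<rho> g v)"
    and lin: "\<And>g. g \<in> topspace T \<Longrightarrow> linear (\<rho> g)"
  shows "continuous_map T euclidean (\<lambda>g. endo_of (\<rho> g))"
proof -
  define R where "R b u = endo_of (\<lambda>x. (x \<bullet> b) *\<^sub>R u)" for b u :: 'v
  have R: "R b u \<star> x = (x \<bullet> b) *\<^sub>R u" for b u x
    unfolding R_def
    by (rule endo_of_apply) (intro bounded_linear.linear bounded_linear_compose[OF bounded_linear_scaleR_left bounded_linear_inner_left])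
  have linR: "linear (R b)" for b
  proof (rule linearI)
    show "R b (u + w) = R b u + R b w" for u w
      by (rule endo_eqI) (simp add: R endo.add_left scaleR_add_right)
    show "R b (r *\<^sub>R u) = r *\<^sub>R R b u" for r u
      by (rule endo_eqI) (simp add: R endo.scaleR_left)
  qed
  have cR: "continuous_map euclidean euclidean (R b)" for b
    using linear_continuous_on[of "R b" UNIV] linR linear_conv_bounded_linear by auto
  have "continuous_map T euclidean (\<lambda>g. \<Sum>b\<in>Basis. R b (\<rho> g b))"
  proof (rule continuous_map_sum)
    show "continuous_map T euclidean (\<lambda>g. R b (\<rho> g b))" for b
      using continuous_map_compose[OF cont cR, of b b] by (simp add: o_def)
  qed simp
  moreover have "(\<Sum>b\<in>Basis. R b (\<rho> g b)) = endo_of (\<rho> g)" if g: "g \<in> topspace T" for g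
  proof (rule endo_eqI)
    fix x
    have "(\<Sum>b\<in>Basis. R b (\<rho> g b)) \<star> x = (\<Sum>b\<in>Basis. (x \<bullet> b) *\<^sub>R \<rho> g b)"
      by (simp add: endo.sum_left R)
    also have "\<dots> = \<rho> g x" by (rule linear_euclidean_expand[OF lin[OF g], symmetric])
    finally show "(\<Sum>b\<in>Basis. R b (\<rho> g b)) \<star> x = endo_of (\<rho> g) \<star> x" by (simp add: endo_of_apply[OF lin[OF g]])
  qed
  ultimately show ?thesis by (rule continuous_map_eq)
qed

locale compact_orthogonal_rep =
  fixes G :: "'g monoid" and T :: "'g topology"
    and L :: "'e::euclidean_space set" and A :: "('g set \<times> ('g \<Rightarrow> 'e)) set"
    and \<rho> :: "'g \<Rightarrow> 'v::euclidean_space \<Rightarrow> 'v"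
  assumes lie_group: "compact_lie_group G T L A" and rep: "orthogonal_representation G A \<rho>"
begin

lemma action: "group_action G UNIV \<rho>" and orth: "g \<in> carrier G \<Longrightarrow> orthogonal_transformation (\<rho> g)"
  using rep by (simp_all add: orthogonal_representation_def)

lemma grp: "group G" using lie_group by (simp add: compact_lie_group_def)

definition K :: "'v endo set" where "K = (\<lambda>g. endo_of (\<rho> g)) ` carrier G"

lemma mem_K: "B \<in> K \<longleftrightarrow> (\<exists>g\<in>carrier G. B = endo_of (\<rho> g))"
  by (auto simp: K_def)

lemma endo_rho: "g \<in> carrier G \<Longrightarrow> endo_of (\<rho> g) \<star> v = \<rho> g v"
  by (rule endo_of_apply[OF orthogonal_transformation_linear[OF orth]])

lemma rho_mult: "g \<in> carrier G \<Longrightarrow> h \<in> carrier G \<Longrightarrow> \<rho> (g \<otimes>\<^bsub>G\<^esub> h) v = \<rho> g (\<rho> h v)"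
  using group_action.composition_rule[OF action] by simp

lemma rho_inv: "g \<in> carrier G \<Longrightarrow> \<rho> (m_inv G g) (\<rho> g v) = v"
  using group_action.orbit_sym_aux[OF action] by simp

lemma inv_closed: "g \<in> carrier G \<Longrightarrow> m_inv G g \<in> carrier G"
  using grp by (rule group.inv_closed)

lemma rho_inv': "g \<in> carrier G \<Longrightarrow> \<rho> g (\<rho> (m_inv G g) v) = v"
  using rho_inv[OF inv_closed] group.inv_inv[OF grp] by simp

lemma mult_closed: "g \<in> carrier G \<Longrightarrow> h \<in> carrier G \<Longrightarrow> g \<otimes>\<^bsub>G\<^esub> h \<in> carrier G"
  using monoid.m_closed[OF group.is_monoid[OF grp]] .

lemma rho_one: "\<rho> \<one>\<^bsub>G\<^esub> v = v"
  using fun_cong[OF group_action.id_eq_one[OF action], of v] by simp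

sublocale orth_group K
proof
  show "compact K"
  proof -
    have top: "topspace T = carrier G" "compact_space T" "smooth_atlas T L A"
      using lie_group by (simp_all add: compact_lie_group_def)
    have "continuous_map T euclidean (\<lambda>g. \<rho> g v)" for v
      by (rule rep_continuous[OF top(3)]) (use rep in \<open>simp add: orthogonal_representation_def\<close>)
    then have "continuous_map T euclidean (\<lambda>g. endo_of (\<rho> g))"
      by (rule rep_endo_continuous) (use orth top(1) orthogonal_transformation_linear in blast)
    from image_compactin[OF _ this, of "carrier G"] top show ?thesis
      by (simp add: K_def compact_space_def)
  qed
  show "1 \<in> K" unfolding K_def
  proof (rule image_eqI)
    show one: "\<one>\<^bsub>G\<^esub> \<in> carrier G" using monoid.one_closed[OF group.is_monoid[OF grp]] .
    show "1 = endo_of (\<rho> \<one>\<^bsub>G\<^esub>)" by (rule endo_eqI) (simp add: endo_rho[OF one] rho_one)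
  qed
  show "A * B \<in> K" if AB: "A \<in> K" "B \<in> K" for A B
  proof -
    obtain g h where gh: "g \<in> carrier G" "A = endo_of (\<rho> g)" "h \<in> carrier G" "B = endo_of (\<rho> h)"
      using AB by (auto simp: K_def)
    have "A * B = endo_of (\<rho> (g \<otimes>\<^bsub>G\<^esub> h))"
      by (rule endo_eqI) (simp add: gh endo_rho mult_closed rho_mult)
    then show ?thesis using mult_closed gh by (auto simp: K_def)
  qed
  show "\<exists>B\<in>K. A * B = 1 \<and> B * A = 1" if A: "A \<in> K" for A
  proof -
    obtain g where g: "g \<in> carrier G" "A = endo_of (\<rho> g)" using A by (auto simp: K_def)
    have "A * endo_of (\<rho> (m_inv G g)) = 1"
      by (rule endo_eqI) (simp add: g endo_rho inv_closed rho_inv')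
    moreover have "endo_of (\<rho> (m_inv G g)) * A = 1"
      by (rule endo_eqI) (simp add: g endo_rho inv_closed rho_inv)
    moreover have "endo_of (\<rho> (m_inv G g)) \<in> K" using inv_closed[OF g(1)] by (auto simp: K_def)
    ultimately show ?thesis by blast
  qed
  show "norm (A \<star> v) = norm v" if A: "A \<in> K" for A v
  proof -
    obtain g where g: "g \<in> carrier G" "A = endo_of (\<rho> g)" using A by (auto simp: K_def)
    then show ?thesis using orth[OF g(1)] by (simp add: endo_rho orthogonal_transformation)
  qed
qed

lemma orbit_eq_orb: "orbit G \<rho> x = orb x"
proof -
  have "orbit G \<rho> x = (\<lambda>g. \<rho> g x) ` carrier G" unfolding orbit_def by (rule setcompr_eq_image[of _ "\<lambda>g. g \<in> carrier G", simplified])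
  also have "\<dots> = (\<lambda>g. endo_of (\<rho> g) \<star> x) ` carrier G" by (rule image_cong) (simp_all add: endo_rho)
  also have "\<dots> = orb x" unfolding orb_def unfolding K_def image_image ..
  finally show ?thesis .
qed

lemma ball_K: "(\<forall>B\<in>K. P B) \<longleftrightarrow> (\<forall>g\<in>carrier G. P (endo_of (\<rho> g)))"
  by (auto simp: K_def)

lemma endo_rho_fun: "g \<in> carrier G \<Longrightarrow> (\<star>) (endo_of (\<rho> g)) = \<rho> g"
  by (intro ext) (rule endo_rho)

text \<open>The representation need not be faithful. Inclusions still correspond because every
  isotropy group in \<open>G\<close> contains the kernel and is thus the full preimage of its image
  in \<open>K\<close>.\<close>

lemma stab_subset_iff:
  "stab p \<subseteq> stab q \<longleftrightarrow> stabilizer G \<rho> p \<subseteq> stabilizer G \<rho> q"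
proof
  have st: "endo_of (\<rho> g) \<in> stab x \<longleftrightarrow> g \<in> stabilizer G \<rho> x" if g: "g \<in> carrier G" for g x
    using g mem_K endo_rho[OF g, of x] unfolding stab_def stabilizer_def by auto
  have sc: "g \<in> carrier G" if "g \<in> stabilizer G \<rho> x" for g x using that by (simp add: stabilizer_def)
  show "stabilizer G \<rho> p \<subseteq> stabilizer G \<rho> q" if sub: "stab p \<subseteq> stab q"
  proof
    fix g assume g: "g \<in> stabilizer G \<rho> p"
    then have "endo_of (\<rho> g) \<in> stab q" using st[OF sc[OF g]] sub by blast
    then show "g \<in> stabilizer G \<rho> q" using st[OF sc[OF g]] by blast
  qed
  show "stab p \<subseteq> stab q" if sub: "stabilizer G \<rho> p \<subseteq> stabilizer G \<rho> q"
  proof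
    fix B assume B: "B \<in> stab p"
    obtain g where g: "g \<in> carrier G" "B = endo_of (\<rho> g)" using stab_K[OF B] unfolding mem_K by (elim bexE)
    then show "B \<in> stab q" using st[OF g(1)] B sub by blast
  qed
qed

text \<open>Conjugating the isotropy group of \<open>p\<close> into that of \<open>q\<close> amounts
  to including it in that of a translate of \<open>q\<close> by the inverse element; since inversion
  is a bijection of the group, the quantifier over \<open>g\<close> absorbs the difference.\<close>

lemma G_regular_iff: "G_regular G \<rho> p \<longleftrightarrow> regular p"
proof -
  have conj: "(\<lambda>h. g \<otimes>\<^bsub>G\<^esub> h \<otimes>\<^bsub>G\<^esub> m_inv G g) ` stabilizer G \<rho> p \<subseteq> stabilizer G \<rho> q
      \<longleftrightarrow> stabilizer G \<rho> p \<subseteq> stabilizer G \<rho> (\<rho> (m_inv G g) q)" if g: "g \<in> carrier G" for g q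
  proof -
    have "g \<otimes>\<^bsub>G\<^esub> h \<otimes>\<^bsub>G\<^esub> m_inv G g \<in> stabilizer G \<rho> q \<longleftrightarrow> h \<in> stabilizer G \<rho> (\<rho> (m_inv G g) q)"
      if h: "h \<in> carrier G" for h
    proof -
      have "\<rho> (g \<otimes>\<^bsub>G\<^esub> h \<otimes>\<^bsub>G\<^esub> m_inv G g) q = \<rho> g (\<rho> h (\<rho> (m_inv G g) q))"
        using g h by (simp add: rho_mult mult_closed inv_closed)
      moreover have "\<rho> g (\<rho> h (\<rho> (m_inv G g) q)) = q \<longleftrightarrow> \<rho> h (\<rho> (m_inv G g) q) = \<rho> (m_inv G g) q"
      proof
        assume "\<rho> g (\<rho> h (\<rho> (m_inv G g) q)) = q"
        then have "\<rho> (m_inv G g) (\<rho> g (\<rho> h (\<rho> (m_inv G g) q))) = \<rho> (m_inv G g) q" by simp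
        then show "\<rho> h (\<rho> (m_inv G g) q) = \<rho> (m_inv G g) q" by (simp only: rho_inv[OF g])
      next
        assume "\<rho> h (\<rho> (m_inv G g) q) = \<rho> (m_inv G g) q"
        then show "\<rho> g (\<rho> h (\<rho> (m_inv G g) q)) = q" by (simp only: rho_inv'[OF g])
      qed
      ultimately show ?thesis using g h by (simp add: stabilizer_def mult_closed inv_closed)
    qed
    then show ?thesis by (auto simp: stabilizer_def)
  qed
  have "regular p \<longleftrightarrow> (\<forall>q. \<exists>g\<in>carrier G. stabilizer G \<rho> p \<subseteq> stabilizer G \<rho> (\<rho> g q))"
  proof -
    have "(\<exists>B\<in>K. P B) \<longleftrightarrow> (\<exists>g\<in>carrier G. P (endo_of (\<rho> g)))" for P
      unfolding K_def by blast
    then show ?thesis unfolding regular_def stab_subset_iff by (simp add: endo_rho cong: bex_cong)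
  qed
  also have "\<dots> \<longleftrightarrow> (\<forall>q. \<exists>g\<in>carrier G. stabilizer G \<rho> p \<subseteq> stabilizer G \<rho> (\<rho> (m_inv G g) q))"
  proof -
    have "(\<exists>g\<in>carrier G. P g) \<longleftrightarrow> (\<exists>g\<in>carrier G. P (m_inv G g))" for P
    proof
      assume "\<exists>g\<in>carrier G. P g"
      then obtain g where g: "g \<in> carrier G" "P g" by blast
      then have "P (m_inv G (m_inv G g))" using group.inv_inv[OF grp g(1)] by simp
      then show "\<exists>g\<in>carrier G. P (m_inv G g)" using inv_closed[OF g(1)] by blast
    qed (use inv_closed in blast)
    then show ?thesis by (intro arg_cong[where f = All] ext)
  qed
  also have "\<dots> \<longleftrightarrow> G_regular G \<rho> p" unfolding G_regular_def
    by (intro arg_cong[where f = All] ext bex_cong refl) (rule conj[symmetric])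
  finally show ?thesis by simp
qed

lemma normal_space_orbit: "normal_space (orbit G \<rho> p) p = nor_space p"
  unfolding orbit_eq_orb by (rule normal_space_orb[OF self_orb])

lemma k_section_iff: "k_section G \<rho> k \<Sigma> \<longleftrightarrow> section_K k \<Sigma>"
proof -
  have "(\<forall>g\<in>carrier G. \<rho> g p \<in> \<Sigma> \<longrightarrow> \<rho> g ` \<Sigma> = \<Sigma>) \<longleftrightarrow> (\<forall>A\<in>K. A \<star> p \<in> \<Sigma> \<longrightarrow> (\<star>) A ` \<Sigma> = \<Sigma>)" for p
    unfolding ball_K by (rule ball_cong) (simp_all add: endo_rho endo_rho_fun)
  then show ?thesis
    unfolding k_section_def section_K_def G_regular_iff normal_space_orbit unfolding orbit_eq_orb by simp
qed

lemma copol_eq: "copol G \<rho> = (THE k. \<forall>p. regular p \<longrightarrow> (\<exists>\<Sigma>. minimal_K p \<Sigma> \<and> section_K k \<Sigma>))"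
proof -
  have "minimal_section G \<rho> p \<Sigma> \<longleftrightarrow> minimal_K p \<Sigma>" for p \<Sigma>
    unfolding minimal_section_def minimal_K_def sections_through_def k_section_iff by blast
  then show ?thesis unfolding copol_def G_regular_iff k_section_iff by simp
qed

end

theorem corollary10:
  fixes G :: "'g monoid" and T :: "'g topology"
    and L :: "'e::euclidean_space set" and A :: "('g set \<times> ('g \<Rightarrow> 'e)) set"
    and \<rho> :: "'g \<Rightarrow> 'v::euclidean_space \<Rightarrow> 'v"
    and N :: "'v set" and k :: nat and \<D> \<E> :: "'v \<Rightarrow> 'v set"
  assumes "compact_lie_group G T L A"
    and "orthogonal_representation G A \<rho>"
    and "principal_orbit G \<rho> N"
    and "distribution N k \<D>"
    and "invariant_distribution G \<rho> N \<D>"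
    and "autoparallel N \<D>"
    and "sff_invariant N \<D>"
    and "\<E> = complement_distribution N \<D>"
    and "\<And>\<xi>. normal_field N \<xi> \<Longrightarrow> equivariant_field G \<rho> N \<xi> \<Longrightarrow> parallel_along N \<E> \<xi>"
  shows "copol G \<rho> \<le> k"
proof -
  interpret compact_orthogonal_rep G T L A \<rho> by unfold_locales (rule assms(1,2))+
  obtain p where p: "regular p" and N: "N = orb p"
    using assms(3) unfolding principal_orbit_def G_regular_iff orbit_eq_orb by blast
  have pN: "p \<in> orb p" by (rule self_orb)
  have frames: "tangent_frames (orb p) \<D> k" using distribution_tangent_frames[OF assms(4)] by (simp add: N)
  have dist: "subspace (\<D> q)" "\<D> q \<subseteq> tan_space q" "dim (\<D> q) = k" if "q \<in> orb p" for q
  proof -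
    have "subspace (\<D> q) \<and> \<D> q \<subseteq> tangent_space (orb p) q \<and> dim (\<D> q) = k"
      using assms(4) that unfolding distribution_def N by blast
    then show "subspace (\<D> q)" "\<D> q \<subseteq> tan_space q" "dim (\<D> q) = k"
      by (simp_all only: tangent_space_orb[OF that])
  qed
  have inv: "\<D> (B \<star> q) = (\<star>) B ` \<D> q" if B: "B \<in> K" and q: "q \<in> orb p" for B q
  proof -
    obtain g where g: "g \<in> carrier G" "B = endo_of (\<rho> g)"
      using B unfolding mem_K by (elim bexE)
    then show ?thesis using assms(5) q
      by (simp add: invariant_distribution_def N endo_rho endo_rho_fun)
  qed
  have par: "parallel_along (orb p) \<E> \<xi>" if "normal_field (orb p) \<xi>"
    and eq: "\<And>B q. B \<in> K \<Longrightarrow> q \<in> orb p \<Longrightarrow> \<xi> (B \<star> q) = B \<star> \<xi> q" for \<xi>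
  proof -
    have "equivariant_field G \<rho> (orb p) \<xi>" unfolding equivariant_field_def
    proof (intro ballI)
      fix g q assume g: "g \<in> carrier G" and q: "q \<in> orb p"
      have "endo_of (\<rho> g) \<in> K" using g by (auto simp: mem_K)
      from eq[OF this q] show "\<xi> (\<rho> g q) = \<rho> g (\<xi> q)" by (simp add: endo_rho g)
    qed
    with assms(9)[of \<xi>] that(1) show ?thesis by (simp add: N)
  qed
  define E where "E = tan_space p \<inter> orthogonal_comp (\<D> p)"
  have Ep: "\<E> p = E" by (simp add: assms(8) N complement_distribution_orb[OF pN] E_def)
  \<comment> \<open>Autoparallelism, invariance under the second fundamental form and parallelism
    along \<open>\<E>\<close> enter only through the two infinitesimal conditions at
    \<open>p\<close> verified here.\<close>
  have "\<exists>W. subspace W \<and> p \<in> W \<and> dim W = dim (nor_space p) + dim (\<D> p) \<and>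
    (\<forall>q\<in>W. regular q \<longrightarrow> nor_space q \<subseteq> W)"
  proof (rule normal_sum_subspace[OF p dist(1)[OF pN] dist(2)[OF pN] E_def])
    show "X \<star> Z \<in> E" if "X \<in> lie" "X \<star> p \<in> \<D> p" "Z \<in> E" for X Z
      unfolding E_def
      by (rule autoparallel_invariant_complement[OF frames dist(2) inv _ _ that(1,2)])
        (use assms(6,7) that(3) in \<open>simp_all add: N E_def\<close>)
    show "X \<star> \<eta> \<in> tan_space p" if "X \<in> lie" "X \<star> p \<in> E" "\<eta> \<in> nor_space p" for X \<eta>
      by (rule parallel_normal_derivative[where E = \<E>, OF p that(3,1) _ par]) (use that(2) Ep in simp_all)
  qed
  then obtain W where W: "subspace W" "p \<in> W" "dim W = dim (nor_space p) + dim (\<D> p)"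
    "\<forall>q\<in>W. regular q \<longrightarrow> nor_space q \<subseteq> W" by (elim exE conjE)
  have "nor_saturated W" unfolding nor_saturated_def using W(1,2,4) p by blast
  from copolarity_le[OF this p, of k] W(3) dist(3)[OF pN] show ?thesis by (simp add: copol_eq)
qed

end
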